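(* Let $n\geq 2$ and $m\ge 2$ be integers and let $B_1,\dots,B_m$ be $n\times n$ (complex) Hermitian matrices. For $\lambda\ge 0$ put $$H_1=\begin{pmatrix}\lambda&0\\0&-\lambda\end{pmatrix},\quad H_2=\begin{pmatrix}0&\lambda\\ \lambda&0\end{pmatrix},\quad H_3=\begin{pmatrix}0&-\lambda\mathbf{i}\\ \lambda\mathbf{i}&0\end{pmatrix}.$$ (1) If $m\geq 3$, then $$\sum_{r,s=1}^m\|[B_r,B_s]\|^2\leq\frac43\Big(\sum_{r=1}^m\|B_r\|^2\Big)^2.$$ Equality holds if and only if there are $(P,R)\in K=U(n)\times O(m)$ and $\lambda\geq 0$ such that in the tuple $(P,R)\cdot(B_1,\dots,B_m)$ all matrices are zero except for three matrices, which are $\operatorname{diag}(H_1,0)$, $\operatorname{diag}(H_2,0)$ and $\operatorname{diag}(H_3,0)$. (2) If $m=2$, then $$\sum_{r,s=1}^2\|[B_r,B_s]\|^2\leq\Big(\sum_{r=1}^2\|B_r\|^2\Big)^2.$$ Equality holds if and only if there are $(P,R)\in K=U(n)\times O(2)$, $\lambda\ge 0$ and $\theta\in\mathbb{R}$ such that $(P,R)\cdot(B_1,B_2)=\big(\operatorname{diag}(H_1,0),\ \operatorname{diag}(\cos\theta\, H_2+\sin\theta\, H_3,0)\big)$. Moreover, if $B_1,\dots,B_m$ are instead $n\times n$ skew-Hermitian matrices, the same statements (1) and (2) hold with $H_j$ replaced by $\mathbf{i}H_j$ for $j=1,2,3$.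
   Context: Notation: $[A,B]=AB-BA$ is the commutator, $\|B\|^2=\operatorname{tr}(BB^* )$ is the squared Frobenius norm, $\mathbf{i}$ is the imaginary unit. For a $2\times 2$ matrix $H$, $\operatorname{diag}(H,0)$ denotes the $n\times n$ block diagonal matrix with upper left block $H$ and all other entries zero. The group $K=U(n)\times O(m)$ acts on $m$-tuples of $n\times n$ matrices by $$(P,R)\cdot(B_1,\dots,B_m)=\Big(\sum_{j=1}^m R_{j1}P^*B_jP,\ \dots,\ \sum_{j=1}^m R_{jm}P^*B_jP\Big),\qquad R=(R_{jk})\in O(m).$$ *)

theory Defs
  imports Complex_Main "Jordan_Normal_Form.Schur_Decomposition"
begin

text \<open>
  Matrices are those of the Jordan normal form entry, so the size \<open>n\<close> is an ordinary natural number.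
  An \<open>m\<close>-tuple of matrices is a function on the indices \<open>0, \<dots>, m - 1\<close>; values at indices
  \<open>\<ge> m\<close> are irrelevant.
\<close>

definition hermitian_mat :: "complex mat \<Rightarrow> bool" where
  "hermitian_mat A \<longleftrightarrow> mat_adjoint A = A"

definition skew_hermitian_mat :: "complex mat \<Rightarrow> bool" where
  "skew_hermitian_mat A \<longleftrightarrow> mat_adjoint A = - A"

definition mat_commutator :: "complex mat \<Rightarrow> complex mat \<Rightarrow> complex mat" where
  "mat_commutator A B = A * B - B * A"

definition mat_trace :: "complex mat \<Rightarrow> complex" where
  "mat_trace A = (\<Sum>i<dim_row A. A $$ (i, i))"

text \<open>
  The trace of \<open>B B\<^sup>*\<close> is a nonnegative real number; \<^const>\<open>Re\<close> only changes its type.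
\<close>

definition frobenius_sq :: "complex mat \<Rightarrow> real" where
  "frobenius_sq B = Re (mat_trace (B * mat_adjoint B))"

definition unitary_group :: "nat \<Rightarrow> complex mat set" where
  "unitary_group n =
     {P \<in> carrier_mat n n. P * mat_adjoint P = 1\<^sub>m n \<and> mat_adjoint P * P = 1\<^sub>m n}"

text \<open>
  \<^const>\<open>orthogonal_mat\<close> of the library only asks for pairwise orthogonal nonzero columns,
  hence the separate definition of \<open>O(m)\<close>.
\<close>

definition orthogonal_group :: "nat \<Rightarrow> real mat set" where
  "orthogonal_group m =
     {R \<in> carrier_mat m m. R * transpose_mat R = 1\<^sub>m m \<and> transpose_mat R * R = 1\<^sub>m m}"

definition K_group :: "nat \<Rightarrow> nat \<Rightarrow> (complex mat \<times> real mat) set" where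
  "K_group n m = unitary_group n \<times> orthogonal_group m"

text \<open>
  The \<open>k\<close>-th component of \<open>(P, R) \<cdot> (B\<^sub>0, \<dots>, B\<^sub>m\<^sub>-\<^sub>1)\<close> is \<open>\<Sum>j<m. R\<^sub>j\<^sub>k P\<^sup>* B\<^sub>j P\<close>.  Matrices without
  a fixed size do not form a monoid, so the sum is written entrywise.
\<close>

definition K_act ::
  "nat \<Rightarrow> nat \<Rightarrow> complex mat \<times> real mat \<Rightarrow> (nat \<Rightarrow> complex mat) \<Rightarrow> nat \<Rightarrow> complex mat" where
  "K_act n m g B k = (case g of (P, R) \<Rightarrow>
     mat n n (\<lambda>(a, b). \<Sum>j<m. (complex_of_real (R $$ (j, k)) \<cdot>\<^sub>m (mat_adjoint P * B j * P)) $$ (a, b)))"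

definition H1 :: "real \<Rightarrow> complex mat" where
  "H1 l = mat_of_rows_list 2 [[complex_of_real l, 0], [0, - complex_of_real l]]"

definition H2 :: "real \<Rightarrow> complex mat" where
  "H2 l = mat_of_rows_list 2 [[0, complex_of_real l], [complex_of_real l, 0]]"

definition H3 :: "real \<Rightarrow> complex mat" where
  "H3 l = mat_of_rows_list 2 [[0, - complex_of_real l * \<i>], [complex_of_real l * \<i>, 0]]"

text \<open>\<open>diag(H, 0)\<close> of size \<open>n \<times> n\<close>, for a \<open>2 \<times> 2\<close> matrix \<open>H\<close> and \<open>n \<ge> 2\<close>.\<close>

definition diag_zero :: "nat \<Rightarrow> complex mat \<Rightarrow> complex mat" where
  "diag_zero n H = four_block_mat H (0\<^sub>m 2 (n - 2)) (0\<^sub>m (n - 2) 2) (0\<^sub>m (n - 2) (n - 2))"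

end

theory Submission
  imports Defs "HOL-Combinatorics.Transposition"
begin

text \<open>
  Everything rests on a bound for one matrix against a family: if \<open>A\<close> and the pairwise orthogonal
  \<open>Q\<^sub>s\<close> are Hermitian, then \<open>\<Sum>\<^sub>s (\<parallel>[A, Q\<^sub>s]\<parallel>\<^sup>2 / \<parallel>Q\<^sub>s\<parallel>\<^sup>2 - \<parallel>A\<parallel>\<^sup>2) \<le> 2 \<parallel>A\<parallel>\<^sup>2\<close>.  After diagonalising \<open>A\<close>
  the left-hand side is at most \<open>\<Sum>\<^sub>i\<^sub>j w\<^sub>i\<^sub>j ((l\<^sub>i - l\<^sub>j)\<^sup>2 - \<parallel>A\<parallel>\<^sup>2)\<close>, where \<open>0 \<le> w\<^sub>i\<^sub>j \<le> 1\<close> for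
  \<open>i \<noteq> j\<close> by Bessel's inequality, and the pairs with a positive contribution form a star.

  An element of \<open>O(m)\<close> diagonalising the Gram matrix makes the \<open>B\<^sub>r\<close> pairwise orthogonal.  The family
  bound together with \<open>\<parallel>[A, Q]\<parallel>\<^sup>2 \<le> 2 \<parallel>A\<parallel>\<^sup>2 \<parallel>Q\<parallel>\<^sup>2\<close> then reduces the claim to an inequality for the
  numbers \<open>\<parallel>B\<^sub>r\<parallel>\<^sup>2\<close>, in which equality leaves three equal values.  Equality in the bound on a
  single commutator forces \<open>A\<close> to have only two nonzero eigenvalues \<open>\<plusminus>l\<close> and \<open>Q\<close> to interchange
  their eigenvectors.
\<close>

section \<open>The spectral theorem\<close>

text \<open>Bounding every commutator separately by twice the product of the squared norms gives
  \<open>2 * (1 - 1 / m)\<close> times the squared total. This is \<open>4 / 3\<close> for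
  \<open>m = 3\<close> and too much for larger \<open>m\<close>. The constant stays independent of
  \<open>m\<close> because one matrix cannot have large commutators with many orthogonal partners:
  the excesses of the ratios over 1 add up to at most 2, as if only two partners reached the maximal
  ratio 2. Three equal norms with all six ordered pairs at ratio 2 give
  \<open>6 * 2 / 9 = 4 / 3\<close>.

  Orthogonality is essential for this, since a partner repeated many times would violate the family
  bound. It is reached by an element of \<open>O(m)\<close>, which preserves both sides of the
  inequality. As \<open>O(m)\<close> combines the matrices with real coefficients, the Gram matrix
  has to be diagonalised over the reals, whereas the matrices themselves are diagonalised over the
  complex numbers; hence a spectral theorem that covers both fields.\<close>

lemma dim_mat_adjoint [simp]:
  "dim_row (mat_adjoint A) = dim_col A" "dim_col (mat_adjoint A) = dim_row A"
  by (auto simp: mat_adjoint_def)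

lemma mat_adjoint_carrier [simp]: "A \<in> carrier_mat n m \<Longrightarrow> mat_adjoint A \<in> carrier_mat m n"
  by (auto intro: carrier_matI)

lemma index_mat_adjoint [simp]:
  "i < dim_col A \<Longrightarrow> j < dim_row A \<Longrightarrow> mat_adjoint A $$ (i, j) = conjugate (A $$ (j, i))"
  by (simp add: mat_adjoint_def mat_of_rows_index)

lemma mat_adjoint_adjoint [simp]: "mat_adjoint (mat_adjoint A) = A"
  by (rule eq_matI) auto

lemma conjugate_index_self_adjoint:
  assumes "A \<in> carrier_mat n n" "mat_adjoint A = A" "i < n" "j < n"
  shows "conjugate (A $$ (i, j)) = A $$ (j, i)"
proof -
  have "A $$ (j, i) = mat_adjoint A $$ (j, i)" by (simp only: assms(2))
  also have "\<dots> = conjugate (A $$ (i, j))" using assms by (intro index_mat_adjoint) auto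
  finally show ?thesis by simp
qed

lemma index_mult_mat_sum:
  assumes "A \<in> carrier_mat n k" "B \<in> carrier_mat k m" "i < n" "j < m"
  shows "(A * B) $$ (i, j) = (\<Sum>l<k. A $$ (i, l) * B $$ (l, j))"
  using assms by (auto simp: scalar_prod_def lessThan_atLeast0 intro!: sum.cong)

lemma mat_adjoint_mult:
  fixes A B :: "'a :: conjugatable_field mat"
  assumes "A \<in> carrier_mat n k" "B \<in> carrier_mat k m"
  shows "mat_adjoint (A * B) = mat_adjoint B * mat_adjoint A"
proof (rule eq_matI)
  fix i j assume "i < dim_row (mat_adjoint B * mat_adjoint A)" "j < dim_col (mat_adjoint B * mat_adjoint A)"
  then have ij: "i < m" "j < n" using assms by auto
  have "mat_adjoint (A * B) $$ (i, j) = conjugate ((A * B) $$ (j, i))"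
    using ij assms by simp
  also have "\<dots> = (\<Sum>l<k. conjugate (A $$ (j, l)) * conjugate (B $$ (l, i)))"
    using ij assms
    by (subst index_mult_mat_sum[OF assms]) (auto simp: sum_conjugate conjugate_dist_mul)
  also have "\<dots> = (mat_adjoint B * mat_adjoint A) $$ (i, j)"
    using ij assms
    by (subst index_mult_mat_sum[OF mat_adjoint_carrier[OF assms(2)] mat_adjoint_carrier[OF assms(1)]])
      (auto simp: mult.commute intro!: sum.cong)
  finally show "mat_adjoint (A * B) $$ (i, j) = (mat_adjoint B * mat_adjoint A) $$ (i, j)" .
qed (use assms in auto)

lemma mat_adjoint_congruence:
  fixes A U :: "'a :: conjugatable_field mat"
  assumes "A \<in> carrier_mat n n" "U \<in> carrier_mat n k" "mat_adjoint A = A"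
  shows "mat_adjoint (mat_adjoint U * A * U) = mat_adjoint U * A * U"
proof -
  have "mat_adjoint (mat_adjoint U * A * U) = mat_adjoint U * (mat_adjoint A * U)"
    using assms mat_adjoint_mult[of "mat_adjoint U * A" k n U k]
      mat_adjoint_mult[of "mat_adjoint U" k n A n]
    by (auto simp: mult_carrier_mat[of _ k n _ n])
  also have "\<dots> = mat_adjoint U * A * U"
    using assms by (simp add: assoc_mult_mat[of _ k n _ n _ k])
  finally show ?thesis .
qed

text \<open>Serves two successive changes of basis; with \<open>X\<close> the identity it also
  yields the unitarity of a product.\<close>

lemma mat_adjoint_congruence_mult:
  fixes X U W :: "'a :: conjugatable_field mat"
  assumes X: "X \<in> carrier_mat n n" and U: "U \<in> carrier_mat n k" and W: "W \<in> carrier_mat k l"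
  shows "mat_adjoint (U * W) * X * (U * W) = mat_adjoint W * (mat_adjoint U * X * U) * W"
proof -
  note U' = mat_adjoint_carrier[OF U] and W' = mat_adjoint_carrier[OF W]
  note U'X = mult_carrier_mat[OF U' X]
  show ?thesis
    unfolding mat_adjoint_mult[OF U W] assoc_mult_mat[OF W' U' X]
      assoc_mult_mat[OF mult_carrier_mat[OF W' U'X] U W, symmetric] assoc_mult_mat[OF W' U'X U] ..
qed

lemma mat_adjoint_four_block:
  fixes A :: "'a :: conjugatable_field mat"
  assumes "A \<in> carrier_mat a a" "D \<in> carrier_mat d d"
  shows "mat_adjoint (four_block_mat A (0\<^sub>m a d) (0\<^sub>m d a) D)
    = four_block_mat (mat_adjoint A) (0\<^sub>m a d) (0\<^sub>m d a) (mat_adjoint D)"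
  using assms by (intro eq_matI) (auto)

lemma mult_four_block_diag:
  fixes A A' :: "'a :: comm_ring_1 mat"
  assumes "A \<in> carrier_mat a a" "A' \<in> carrier_mat a a" "D \<in> carrier_mat d d" "D' \<in> carrier_mat d d"
  shows "four_block_mat A (0\<^sub>m a d) (0\<^sub>m d a) D * four_block_mat A' (0\<^sub>m a d) (0\<^sub>m d a) D'
    = four_block_mat (A * A') (0\<^sub>m a d) (0\<^sub>m d a) (D * D')"
proof -
  have "A * A' \<in> carrier_mat a a" "D * D' \<in> carrier_mat d d" using assms by auto
  then show ?thesis
    using assms mult_four_block_mat[OF assms(1) zero_carrier_mat zero_carrier_mat assms(3)
        assms(2) zero_carrier_mat zero_carrier_mat assms(4)]
    by simp
qed

lemma mat_adjoint_one [simp]: "mat_adjoint (1\<^sub>m n :: complex mat) = 1\<^sub>m n"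
  by (intro eq_matI) auto

text \<open>Normalisability and existence of eigenvalues are what distinguishes \<open>\<real>\<close> and \<open>\<complex>\<close>
  among the conjugatable ordered fields.\<close>

lemma spectral_theorem_generic:
  fixes A :: "'a :: conjugatable_ordered_field mat"
  assumes normalise: "\<And>k (v :: 'a vec). v \<in> carrier_vec k \<Longrightarrow> v \<noteq> 0\<^sub>v k \<Longrightarrow>
      \<exists>s. s * conjugate s * (v \<bullet>c v) = 1"
    and eigen: "\<And>k (A :: 'a mat). k \<noteq> 0 \<Longrightarrow> A \<in> carrier_mat k k \<Longrightarrow> mat_adjoint A = A \<Longrightarrow>
      \<exists>e. eigenvalue A e"
    and one: "conjugate (1 :: 'a) = 1"
    and "A \<in> carrier_mat n n" "mat_adjoint A = A"
  shows "\<exists>U \<in> carrier_mat n n. mat_adjoint U * U = 1\<^sub>m n \<and>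
    (\<forall>i<n. \<forall>j<n. i \<noteq> j \<longrightarrow> (mat_adjoint U * A * U) $$ (i, j) = 0)"
  using assms(4,5)
proof (induction n arbitrary: A)
  case 0
  then show ?case by (intro bexI[of _ "1\<^sub>m 0"]) (auto intro!: eq_matI)
next
  case (Suc n)
  let ?N = "Suc n"
  have A: "A \<in> carrier_mat ?N ?N" and sa: "mat_adjoint A = A" using Suc by auto
  obtain e where "eigenvalue A e" using eigen[OF _ A sa] by auto
  then obtain v where v: "v \<in> carrier_vec ?N" "v \<noteq> 0\<^sub>v ?N" "A *\<^sub>v v = e \<cdot>\<^sub>v v"
    using A by (auto simp: eigenvalue_def eigenvector_def)
  interpret cof_vec_space ?N "TYPE('a)" .
  \<comment> \<open>Gram-Schmidt keeps the head of the list, so the eigenvector remains the first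
    vector of the orthogonal basis.\<close>
  define b where "b = basis_completion v"
  define ws where "ws = gram_schmidt ?N b"
  from basis_completion[OF v(1,2), folded b_def]
  have dist_b: "distinct b" and indep: "\<not> lin_dep (set b)" and b: "set b \<subseteq> carrier_vec ?N"
    and hdb: "hd b = v" and len_b: "length b = ?N" by auto
  from hdb len_b obtain vs where bv: "b = v # vs" by (cases b, auto)
  from gram_schmidt_result[OF b dist_b indep refl, folded ws_def]
  have ws: "set ws \<subseteq> carrier_vec ?N" "corthogonal ws" "length ws = ?N" by (auto simp: len_b)
  have hdws: "ws ! 0 = v" 
    using gram_schmidt_hd[OF v(1), of vs, folded bv] ws(3) by (cases ws) (auto simp: ws_def)
  have wsc: "ws ! i \<in> carrier_vec ?N" if "i < ?N" for i using ws that by auto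
  have orth: "ws ! i \<bullet>c ws ! j = 0 \<longleftrightarrow> i \<noteq> j" if "i < ?N" "j < ?N" for i j
    using ws that by (auto simp: corthogonal_def)
  have "\<exists>s. s * conjugate s * (ws ! i \<bullet>c ws ! i) = 1" if "i < ?N" for i
  proof (rule normalise[OF wsc[OF that]])
    show "ws ! i \<noteq> 0\<^sub>v ?N" using orth[OF that that] by auto
  qed
  then obtain s where s: "\<And>i. i < ?N \<Longrightarrow> s i * conjugate (s i) * (ws ! i \<bullet>c ws ! i) = 1" by metis
  \<comment> \<open>\<open>gram_schmidt\<close> yields orthogonal vectors that need not have length
    1; the scalars \<open>s i\<close> rescale them.\<close>
  define U where "U = mat ?N ?N (\<lambda>(a, i). s i * (ws ! i) $ a)"
  have U: "U \<in> carrier_mat ?N ?N" by (simp add: U_def)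
  have UU: "mat_adjoint U * U = 1\<^sub>m ?N"
  proof (rule eq_matI)
    fix i j assume "i < dim_row (1\<^sub>m ?N)" "j < dim_col (1\<^sub>m ?N)"
    then have ij: "i < ?N" "j < ?N" by auto
    have "(mat_adjoint U * U) $$ (i, j) = (\<Sum>a<?N. conjugate (s i * (ws ! i) $ a) * (s j * (ws ! j) $ a))"
      using ij U by (subst index_mult_mat_sum[OF mat_adjoint_carrier[OF U] U]) (auto simp: U_def)
    also have "\<dots> = s j * conjugate (s i) * (ws ! j \<bullet>c ws ! i)"
      using wsc[OF ij(1)] wsc[OF ij(2)]
      by (auto simp: scalar_prod_def conjugate_dist_mul sum_distrib_left lessThan_atLeast0
          mult_ac simp del: sum.op_ivl_Suc intro!: sum.cong)
    also have "\<dots> = 1\<^sub>m ?N $$ (i, j)" using s[of j] orth[OF ij(2,1)] ij by auto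
    finally show "(mat_adjoint U * U) $$ (i, j) = 1\<^sub>m ?N $$ (i, j)" .
  qed (use U in auto)
  define D where "D = mat_adjoint U * A * U"
  have D: "D \<in> carrier_mat ?N ?N" using U A by (auto simp: D_def)
  have saD: "mat_adjoint D = D" unfolding D_def by (rule mat_adjoint_congruence[OF A U sa])
  have AU0: "(A * U) $$ (a, 0) = e * U $$ (a, 0)" if a: "a < ?N" for a
  proof -
    have "(A * U) $$ (a, 0) = (\<Sum>l<?N. A $$ (a, l) * (s 0 * v $ l))"
      using a by (subst index_mult_mat_sum[OF A U]) (auto simp: U_def hdws)
    also have "\<dots> = s 0 * (A *\<^sub>v v) $ a"
      using a A v(1) by (auto simp: scalar_prod_def sum_distrib_left lessThan_atLeast0 mult_ac
          simp del: sum.op_ivl_Suc intro!: sum.cong)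
    also have "\<dots> = e * U $$ (a, 0)" using a v by (simp add: U_def hdws)
    finally show ?thesis .
  qed
  have D0: "D $$ (i, 0) = 0" if i: "i < ?N" "i \<noteq> 0" for i
  proof -
    have "D $$ (i, 0) = (mat_adjoint U * (A * U)) $$ (i, 0)"
      using U A by (simp add: D_def assoc_mult_mat[of _ ?N ?N _ ?N _ ?N])
    also have "\<dots> = (\<Sum>a<?N. mat_adjoint U $$ (i, a) * (e * U $$ (a, 0)))"
      using i by (subst index_mult_mat_sum[OF mat_adjoint_carrier[OF U] mult_carrier_mat[OF A U]])
        (auto simp only: AU0 lessThan_iff intro!: sum.cong)
    also have "\<dots> = e * (\<Sum>a<?N. mat_adjoint U $$ (i, a) * U $$ (a, 0))"
      unfolding sum_distrib_left by (rule sum.cong) (auto simp only: mult_ac)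
    also have "\<dots> = e * (mat_adjoint U * U) $$ (i, 0)"
      using i by (subst index_mult_mat_sum[OF mat_adjoint_carrier[OF U] U]) auto
    finally show ?thesis using i by (simp add: UU)
  qed
  have D0': "D $$ (0, i) = 0" if i: "i < ?N" "i \<noteq> 0" for i
    using conjugate_index_self_adjoint[OF D saD i(1), of 0] D0[OF i] by simp
  \<comment> \<open>The first row and column of \<open>D\<close> vanish outside the corner, so the
    remaining block is again self-adjoint and the induction hypothesis applies to it.\<close>
  define D' where "D' = mat n n (\<lambda>(i, j). D $$ (Suc i, Suc j))"
  have D': "D' \<in> carrier_mat n n" by (simp add: D'_def)
  have saD': "mat_adjoint D' = D'"
    using conjugate_index_self_adjoint[OF D saD] by (intro eq_matI) (auto simp: D'_def)
  obtain V where V: "V \<in> carrier_mat n n" and VV: "mat_adjoint V * V = 1\<^sub>m n"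
    and diag: "\<And>i j. i < n \<Longrightarrow> j < n \<Longrightarrow> i \<noteq> j \<Longrightarrow> (mat_adjoint V * D' * V) $$ (i, j) = 0"
    using Suc.IH[OF D' saD'] by blast
  define E where "E = mat 1 1 (\<lambda>_. D $$ (0, 0))"
  have E: "E \<in> carrier_mat 1 1" by (simp add: E_def)
  define W where "W = four_block_mat (1\<^sub>m 1) (0\<^sub>m 1 n) (0\<^sub>m n 1) V"
  have W: "W \<in> carrier_mat ?N ?N" using V by (auto simp: W_def)
  have Wa: "mat_adjoint W = four_block_mat (1\<^sub>m 1) (0\<^sub>m 1 n) (0\<^sub>m n 1) (mat_adjoint V)"
  proof -
    have "mat_adjoint (1\<^sub>m 1 :: 'a mat) = 1\<^sub>m 1" by (intro eq_matI) (auto simp: one)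
    then show ?thesis unfolding W_def using mat_adjoint_four_block[OF one_carrier_mat V] by metis
  qed
  have Dblock: "D = four_block_mat E (0\<^sub>m 1 n) (0\<^sub>m n 1) D'"
    using D by (intro eq_matI) (auto simp: E_def D'_def D0 D0')
  have WW: "mat_adjoint W * W = 1\<^sub>m ?N"
    unfolding Wa unfolding W_def
    by (subst mult_four_block_diag[OF one_carrier_mat one_carrier_mat mat_adjoint_carrier[OF V] V])
      (auto simp: VV intro!: eq_matI)
  have VD: "mat_adjoint V * D' \<in> carrier_mat n n"
    using mult_carrier_mat[OF mat_adjoint_carrier[OF V] D'] .
  have WDW: "mat_adjoint W * D * W = four_block_mat E (0\<^sub>m 1 n) (0\<^sub>m n 1) (mat_adjoint V * D' * V)"
    unfolding Wa Dblock mult_four_block_diag[OF one_carrier_mat E mat_adjoint_carrier[OF V] D']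
    unfolding W_def left_mult_one_mat[OF E] mult_four_block_diag[OF E one_carrier_mat VD V]
      right_mult_one_mat[OF E] ..
  show ?case
  proof (intro bexI[of _ "U * W"] conjI allI impI)
    show UW: "U * W \<in> carrier_mat ?N ?N" using U W by auto
    note eq = mat_adjoint_congruence_mult[OF _ U W]
    show "mat_adjoint (U * W) * (U * W) = 1\<^sub>m ?N"
      using eq[of "1\<^sub>m ?N"] U W UU WW by (simp add: mat_adjoint_mult[OF U W])
    fix i j assume "i < ?N" "j < ?N" "i \<noteq> j"
    then show "(mat_adjoint (U * W) * A * (U * W)) $$ (i, j) = 0"
      unfolding eq[OF A] D_def[symmetric] WDW using E D' V diag
      by (cases i; cases j) (auto simp del: index_mult_mat(1))
  qed
qed

section \<open>Diagonalisation over the complex and over the real numbers\<close>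

lemma scalar_prod_conjugate_self:
  fixes v :: "complex vec"
  assumes "v \<in> carrier_vec k"
  shows "v \<bullet>c v = complex_of_real (\<Sum>i<k. (cmod (v $ i))\<^sup>2)"
  using assms by (auto simp: scalar_prod_def lessThan_atLeast0 complex_mult_cnj cmod_power2)

lemma eigenvalue_exists_complex:
  fixes A :: "complex mat"
  assumes "A \<in> carrier_mat k k" "k \<noteq> 0"
  shows "\<exists>e. eigenvalue A e"
proof -
  obtain as where as: "char_poly A = (\<Prod>a\<leftarrow>as. [:- a, 1:])" "length as = k"
    using char_poly_factorized[OF assms(1)] by auto
  then have "poly (char_poly A) (hd as) = 0" using assms(2) by (cases as) auto
  then show ?thesis using eigenvalue_root_char_poly[OF assms(1)] by blast
qed

theorem spectral_theorem_complex:
  fixes A :: "complex mat"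
  assumes "A \<in> carrier_mat n n" "mat_adjoint A = A"
  shows "\<exists>U \<in> carrier_mat n n. mat_adjoint U * U = 1\<^sub>m n \<and>
    (\<forall>i<n. \<forall>j<n. i \<noteq> j \<longrightarrow> (mat_adjoint U * A * U) $$ (i, j) = 0)"
proof (rule spectral_theorem_generic)
  fix k and v :: "complex vec" assume v: "v \<in> carrier_vec k" "v \<noteq> 0\<^sub>v k"
  define r where "r = (\<Sum>i<k. (cmod (v $ i))\<^sup>2)"
  have "r > 0"
  proof -
    obtain i where "i < k" "v $ i \<noteq> 0" using v by (auto simp: vec_eq_iff)
    then show ?thesis unfolding r_def by (intro sum_pos2[of _ i]) auto
  qed
  then have "complex_of_real (1 / sqrt r) * conjugate (complex_of_real (1 / sqrt r)) * complex_of_real r = 1"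
    by (simp flip: of_real_mult)
  then show "\<exists>s. s * conjugate s * (v \<bullet>c v) = 1"
    unfolding scalar_prod_conjugate_self[OF v(1)] r_def by blast
qed (use assms eigenvalue_exists_complex in auto)

text \<open>The quadratic form \<open>S\<close> of a Hermitian matrix is invariant under
  conjugation, and at an eigenvector it equals the eigenvalue times a positive squared
  length.\<close>

lemma hermitian_eigenvalue_real:
  fixes A :: "complex mat"
  assumes "A \<in> carrier_mat k k" "mat_adjoint A = A" "eigenvalue A e"
  shows "e \<in> \<real>"
proof -
  obtain v where v: "v \<in> carrier_vec k" "v \<noteq> 0\<^sub>v k" "A *\<^sub>v v = e \<cdot>\<^sub>v v"
    using assms by (auto simp: eigenvalue_def eigenvector_def)
  define S where "S = (\<Sum>i<k. \<Sum>j<k. A $$ (i, j) * v $ j * cnj (v $ i))"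
  define r where "r = (\<Sum>i<k. (cmod (v $ i))\<^sup>2)"
  have r: "r > 0"
  proof -
    obtain i where "i < k" "v $ i \<noteq> 0" using v by (auto simp: vec_eq_iff)
    then show ?thesis unfolding r_def by (intro sum_pos2[of _ i]) auto
  qed
  have "cnj S = (\<Sum>i<k. \<Sum>j<k. A $$ (j, i) * v $ i * cnj (v $ j))"
    using conjugate_index_self_adjoint[OF assms(1,2)] unfolding S_def
    by (auto simp: mult_ac intro!: sum.cong)
  also have "\<dots> = S" unfolding S_def by (rule sum.swap)
  finally have "cnj S = S" .
  moreover have "S = (\<Sum>i<k. (A *\<^sub>v v) $ i * cnj (v $ i))"
    using assms(1) v(1) unfolding S_def
    by (auto simp: scalar_prod_def lessThan_atLeast0 sum_distrib_right intro!: sum.cong)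
  moreover have "\<dots> = e * complex_of_real r"
    unfolding v(3) r_def using v(1)
    by (auto simp: complex_mult_cnj cmod_power2 sum_distrib_left sum.distrib ring_distribs
        mult.assoc intro!: sum.cong)
  ultimately have "cnj (e * complex_of_real r) = e * complex_of_real r" by metis
  then show ?thesis using r by (simp add: Reals_cnj_iff)
qed

theorem spectral_theorem_real:
  fixes A :: "real mat"
  assumes "A \<in> carrier_mat n n" "transpose_mat A = A"
  shows "\<exists>R \<in> carrier_mat n n. transpose_mat R * R = 1\<^sub>m n \<and>
    (\<forall>i<n. \<forall>j<n. i \<noteq> j \<longrightarrow> (transpose_mat R * A * R) $$ (i, j) = 0)"
proof -
  have adj: "mat_adjoint M = transpose_mat M" for M :: "real mat"
    by (intro eq_matI) auto
  show ?thesis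
  proof (rule spectral_theorem_generic[where 'a = real, unfolded adj])
    fix k and v :: "real vec" assume v: "v \<in> carrier_vec k" "v \<noteq> 0\<^sub>v k"
    then have "v \<bullet>c v > 0" using conjugate_square_greater_0_vec by blast
    then show "\<exists>s. s * conjugate s * (v \<bullet>c v) = 1"
      by (intro exI[of _ "1 / sqrt (v \<bullet>c v)"]) simp
  next
    fix k and A :: "real mat" assume A: "k \<noteq> 0" "A \<in> carrier_mat k k" "transpose_mat A = A"
    \<comment> \<open>The eigenvalue comes from the complexification. That matrix is Hermitian, so
      its eigenvalue is real, and its characteristic polynomial is the image of the real one, which
      therefore has the same root.\<close>
    let ?A = "map_mat complex_of_real A"
    have A': "?A \<in> carrier_mat k k" using A by auto
    have "A $$ (j, i) = A $$ (i, j)" if "i < k" "j < k" for i j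
      using conjugate_index_self_adjoint[of A k j i] that A by (simp add: adj)
    then have sa: "mat_adjoint ?A = ?A" using A(2) by (intro eq_matI) auto
    obtain e where e: "eigenvalue ?A e" using eigenvalue_exists_complex[OF A' A(1)] by auto
    then obtain r where r: "e = complex_of_real r"
      using hermitian_eigenvalue_real[OF A' sa] by (auto elim: Reals_cases)
    have "poly (map_poly complex_of_real (char_poly A)) (complex_of_real r) = 0"
      using e eigenvalue_root_char_poly[OF A'] of_real_hom.char_poly_hom[OF A(2)] r by metis
    then have "poly (char_poly A) r = 0" by simp
    then show "\<exists>e. eigenvalue A e" using eigenvalue_root_char_poly[OF A(2)] by blast
  qed (use assms in auto)
qed

section \<open>Inequalities for real numbers\<close>

lemma obtain_top_three:
  fixes x :: "nat \<Rightarrow> real"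
  assumes "m \<ge> 3"
  obtains a b c where "a < m" "b < m" "c < m" "a \<noteq> b" "a \<noteq> c" "b \<noteq> c" "x b \<le> x a" "x c \<le> x b"
    "\<And>k. k < m \<Longrightarrow> k \<noteq> a \<Longrightarrow> k \<noteq> b \<Longrightarrow> k \<noteq> c \<Longrightarrow> x k \<le> x c"
proof -
  have max: "\<exists>a\<in>S. \<forall>k\<in>S. x k \<le> x a" if "finite S" "S \<noteq> {}" for S
    using that Max_in[of "x ` S"] Max_ge[of "x ` S"] by fastforce
  obtain a where a: "a < m" "\<And>k. k < m \<Longrightarrow> x k \<le> x a"
    using max[of "{..<m}"] assms by force
  have "card ({..<m} - {a}) = m - 1" using a by simp
  then have "{..<m} - {a} \<noteq> {}" using assms by force
  then obtain b where b: "b < m" "b \<noteq> a" "\<And>k. k < m \<Longrightarrow> k \<noteq> a \<Longrightarrow> x k \<le> x b"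
    using max[of "{..<m} - {a}"] by auto
  have "card ({..<m} - {a, b}) = m - 2" using a b by (subst card_Diff_subset) auto
  then have "{..<m} - {a, b} \<noteq> {}" using assms by force
  then obtain c where c: "c < m" "c \<noteq> a" "c \<noteq> b" "\<And>k. k < m \<Longrightarrow> k \<noteq> a \<Longrightarrow> k \<noteq> b \<Longrightarrow> x k \<le> x c"
    using max[of "{..<m} - {a, b}"] by auto
  show thesis using that[of a b c] a b c by auto
qed

text \<open>A small linear program: weights between 0 and 1 of total at most 2 do best on the two
  largest values. Subtracting the level \<open>y\<close> makes every term except the one at
  \<open>p\<close> nonpositive.\<close>

lemma weighted_sum_le_top_two:
  fixes x u :: "nat \<Rightarrow> real"
  assumes fin: "finite S" and p: "p \<in> S" and u: "\<And>s. s \<in> S \<Longrightarrow> 0 \<le> u s \<and> u s \<le> 1"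
    and sum: "(\<Sum>s\<in>S. u s) \<le> 2"
    and x: "\<And>s. s \<in> S \<Longrightarrow> s \<noteq> p \<Longrightarrow> x s \<le> y" "y \<le> x p" "0 \<le> y"
  shows "(\<Sum>s\<in>S. u s * x s) \<le> x p + y"
proof -
  have "(\<Sum>s\<in>S. u s * x s) = (\<Sum>s\<in>S. u s * (x s - y)) + y * (\<Sum>s\<in>S. u s)"
    by (simp add: sum_distrib_left algebra_simps sum_subtractf)
  also have "(\<Sum>s\<in>S. u s * (x s - y)) = u p * (x p - y) + (\<Sum>s\<in>S - {p}. u s * (x s - y))"
    using fin p by (rule sum.remove)
  also have "(\<Sum>s\<in>S - {p}. u s * (x s - y)) \<le> 0"
    using u x by (intro sum_nonpos) (auto simp: mult_nonneg_nonpos)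
  also have "u p * (x p - y) \<le> 1 * (x p - y)"
    using u[OF p] x by (intro mult_right_mono) auto
  also have "y * (\<Sum>s\<in>S. u s) \<le> y * 2" using sum x by (intro mult_left_mono) auto
  finally show ?thesis by simp
qed

text \<open>In the application \<open>d\<close> is the slack between \<open>4 / 3\<close> of the
  squared total and the estimate for the pair sum, with \<open>y\<close> the sum of all values
  outside the top three. It depends only on \<open>y\<close> and on the distances \<open>a\<close>,
  \<open>b\<close> to the smallest of the three, and completing squares shows that it is
  nonnegative.\<close>

lemma three_values_quadratic:
  fixes x1 x2 x3 y :: real
  assumes "x3 \<le> x2" "x2 \<le> x1"
  defines "d \<equiv> 4 / 3 * (x1 + x2 + x3 + y)\<^sup>2 - ((x1 + x2 + x3 + y)\<^sup>2 - (x1\<^sup>2 + x2\<^sup>2 + x3\<^sup>2)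
     + (x1 * (x2 + x3) + x2 * (x1 + x3) + x3 * (x1 + x2) + y * (x1 + x2)))"
  shows "d \<ge> 0" "d = 0 \<Longrightarrow> x1 = x3 \<and> x2 = x3 \<and> y = 0"
proof -
  define a b where "a = x1 - x3" "b = x2 - x3"
  have ab: "a \<ge> 0" "b \<ge> 0" using assms by (auto simp: a_b_def)
  have "3 * d = 4 * (a\<^sup>2 + b\<^sup>2 - a * b) - y * (a + b) + y\<^sup>2"
    unfolding d_def a_b_def by (simp add: power2_eq_square algebra_simps)
  also have "\<dots> = (y - (a + b) / 2)\<^sup>2 + 3 * (a - b)\<^sup>2 + 3 / 4 * (a + b)\<^sup>2"
    by (simp add: power2_eq_square field_simps)
  finally have d: "3 * d = (y - (a + b) / 2)\<^sup>2 + 3 * (a - b)\<^sup>2 + 3 / 4 * (a + b)\<^sup>2" .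
  have nn: "0 \<le> (y - (a + b) / 2)\<^sup>2" "0 \<le> 3 * (a - b)\<^sup>2" "0 \<le> 3 / 4 * (a + b)\<^sup>2" by auto
  show "d \<ge> 0" using d nn by linarith
  show "x1 = x3 \<and> x2 = x3 \<and> y = 0" if "d = 0"
  proof -
    have "(y - (a + b) / 2)\<^sup>2 = 0" "3 * (a - b)\<^sup>2 = 0" "3 / 4 * (a + b)\<^sup>2 = 0" using d nn that by linarith+
    then have "y = (a + b) / 2" "a = b" "a + b = 0" by auto
    then show ?thesis using ab by (auto simp: a_b_def)
  qed
qed

text \<open>Here \<open>1 + u r s\<close> stands for the ratio of a squared commutator norm to the
  product of the squared norms. Every row is an instance of \<open>weighted_sum_le_top_two\<close>;
  afterwards only the three largest values and the sum of the others remain.\<close>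

lemma weighted_pairs_bound:
  fixes x :: "nat \<Rightarrow> real" and u :: "nat \<Rightarrow> nat \<Rightarrow> real"
  assumes m: "m \<ge> 3" and x: "\<And>r. r < m \<Longrightarrow> x r \<ge> 0"
    and u: "\<And>r s. r < m \<Longrightarrow> s < m \<Longrightarrow> r \<noteq> s \<Longrightarrow> 0 \<le> u r s \<and> u r s \<le> 1"
    and sum: "\<And>r. r < m \<Longrightarrow> (\<Sum>s\<in>{..<m} - {r}. u r s) \<le> 2"
  defines "T \<equiv> (\<Sum>r<m. \<Sum>s\<in>{..<m} - {r}. (1 + u r s) * x r * x s)"
  shows "T \<le> 4 / 3 * (\<Sum>r<m. x r)\<^sup>2"
    "T = 4 / 3 * (\<Sum>r<m. x r)\<^sup>2 \<Longrightarrow> \<exists>a<m. \<exists>b<m. \<exists>c<m. a \<noteq> b \<and> a \<noteq> c \<and> b \<noteq> c \<and>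
      x b = x a \<and> x c = x a \<and> (\<forall>k<m. k \<noteq> a \<and> k \<noteq> b \<and> k \<noteq> c \<longrightarrow> x k = 0)"
proof -
  obtain a b c where abc: "a < m" "b < m" "c < m" "a \<noteq> b" "a \<noteq> c" "b \<noteq> c" "x b \<le> x a" "x c \<le> x b"
    and top: "\<And>k. k < m \<Longrightarrow> k \<noteq> a \<Longrightarrow> k \<noteq> b \<Longrightarrow> k \<noteq> c \<Longrightarrow> x k \<le> x c"
    using obtain_top_three[OF m, of x] by blast
  define J where "J = {..<m} - {a, b, c}"
  have split: "(\<Sum>r<m. g r) = g a + g b + g c + (\<Sum>r\<in>J. g r)" for g :: "nat \<Rightarrow> real"
  proof -
    have "{..<m} = insert a (insert b (insert c J))" using abc by (auto simp: J_def)
    moreover have "finite J" "a \<notin> J" "b \<notin> J" "c \<notin> J" by (auto simp: J_def)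
    ultimately show ?thesis using abc by simp
  qed
  define y where "y = (\<Sum>r\<in>J. x r)"
  have xc: "0 \<le> x c" using x abc by auto
  define e where "e r = (\<Sum>s\<in>{..<m} - {r}. u r s * x s)" for r
  have top': "x s \<le> x b" if "s < m" "s \<noteq> a" for s
    using top[of s] abc that by (cases "s = b"; cases "s = c") auto
  have ea: "e a \<le> x b + x c" unfolding e_def
    by (rule weighted_sum_le_top_two[where p = b]) (use abc u sum top xc in auto)
  have eb: "e b \<le> x a + x c" unfolding e_def
    by (rule weighted_sum_le_top_two[where p = a]) (use abc u sum top xc in auto)
  have ec: "e c \<le> x a + x b" unfolding e_def
    by (rule weighted_sum_le_top_two[where p = a]) (use abc u sum top' order_trans[OF xc abc(8)] in auto)
  have ej: "e r \<le> x a + x b" if "r \<in> J" for r unfolding e_def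
    by (rule weighted_sum_le_top_two[where p = a])
      (use abc u sum top' order_trans[OF xc abc(8)] that in \<open>auto simp: J_def\<close>)
  have xJ: "x r \<ge> 0" if "r \<in> J" for r using that x by (auto simp: J_def)
  have "T = (\<Sum>r<m. x r * ((\<Sum>s<m. x s) - x r) + x r * e r)"
    unfolding T_def e_def
    by (intro sum.cong refl) (simp add: sum_diff1 algebra_simps sum.distrib sum_distrib_left)
  also have "\<dots> = (\<Sum>r<m. x r)\<^sup>2 - (\<Sum>r<m. (x r)\<^sup>2) + (\<Sum>r<m. x r * e r)"
    by (simp add: sum.distrib sum_subtractf power2_eq_square right_diff_distrib sum_distrib_right)
  finally have T: "T = (\<Sum>r<m. x r)\<^sup>2 - (\<Sum>r<m. (x r)\<^sup>2) + (\<Sum>r<m. x r * e r)" .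
  have "(\<Sum>r<m. x r * e r) = x a * e a + x b * e b + x c * e c + (\<Sum>r\<in>J. x r * e r)" by (rule split)
  also have "(\<Sum>r\<in>J. x r * e r) \<le> (\<Sum>r\<in>J. x r * (x a + x b))"
    by (intro sum_mono mult_left_mono ej xJ)
  also have "\<dots> = y * (x a + x b)" by (simp add: y_def sum_distrib_right)
  also have "x a * e a + x b * e b + x c * e c \<le> x a * (x b + x c) + x b * (x a + x c) + x c * (x a + x b)"
    using ea eb ec abc x by (intro add_mono mult_left_mono) auto
  finally have E: "(\<Sum>r<m. x r * e r)
    \<le> x a * (x b + x c) + x b * (x a + x c) + x c * (x a + x b) + y * (x a + x b)" by simp
  \<comment> \<open>Dropping the squares outside the top three costs nothing at equality, where
    those values vanish.\<close>
  have S2: "(\<Sum>r<m. (x r)\<^sup>2) \<ge> (x a)\<^sup>2 + (x b)\<^sup>2 + (x c)\<^sup>2" unfolding split by (simp add: sum_nonneg)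
  have S: "(\<Sum>r<m. x r) = x a + x b + x c + y" unfolding split y_def ..
  note Q = three_values_quadratic[OF abc(8,7), of y]
  show "T \<le> 4 / 3 * (\<Sum>r<m. x r)\<^sup>2" using Q(1) T E S2 unfolding S by linarith
  show "\<exists>a<m. \<exists>b<m. \<exists>c<m. a \<noteq> b \<and> a \<noteq> c \<and> b \<noteq> c \<and>
      x b = x a \<and> x c = x a \<and> (\<forall>k<m. k \<noteq> a \<and> k \<noteq> b \<and> k \<noteq> c \<longrightarrow> x k = 0)"
    if eq: "T = 4 / 3 * (\<Sum>r<m. x r)\<^sup>2"
  proof -
    have *: "x a = x c \<and> x b = x c \<and> y = 0"
      by (rule Q(2)) (use eq T E S2 Q(1) in \<open>unfold S, linarith\<close>)
    then have y0: "(\<Sum>r\<in>J. x r) = 0" by (simp only: y_def)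
    have "finite J" by (simp add: J_def)
    then have "x k = 0" if "k \<in> J" for k using xJ y0 that by (rule sum_nonneg_0)
    then have "\<forall>k<m. k \<noteq> a \<and> k \<noteq> b \<and> k \<noteq> c \<longrightarrow> x k = 0" by (simp add: J_def)
    moreover have "x b = x a" "x c = x a" using * by simp_all
    ultimately show ?thesis using abc by blast
  qed
qed

section \<open>Large gaps between eigenvalues\<close>

text \<open>Start from one pair \<open>(a, b)\<close>. A pair with another first entry must share
  \<open>b\<close>, and a further pair cannot match both first entries at once, so it has
  \<open>b\<close> as well.\<close>

lemma star_of_pairs:
  fixes E :: "(nat \<times> nat) set"
  assumes "E \<noteq> {}"
    and inter: "\<And>i j k l. (i, j) \<in> E \<Longrightarrow> (k, l) \<in> E \<Longrightarrow> i = k \<or> j = l"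
  shows "\<exists>c. (\<forall>i j. (i, j) \<in> E \<longrightarrow> i = c) \<or> (\<forall>i j. (i, j) \<in> E \<longrightarrow> j = c)"
proof -
  obtain a b where ab: "(a, b) \<in> E" using assms(1) by auto
  show ?thesis
  proof (cases "\<forall>i j. (i, j) \<in> E \<longrightarrow> i = a")
    case False
    then obtain i j where ij: "(i, j) \<in> E" "i \<noteq> a" by auto
    then have "j = b" using inter[OF ab ij(1)] by auto
    have "l = b" if "(k, l) \<in> E" for k l
      using inter[OF ab that] inter[OF ij(1) that] ij \<open>j = b\<close> by auto
    then show ?thesis by blast
  qed blast
qed

text \<open>Each mixed term is split by a weighted mean inequality that charges only the share
  \<open>1 / k\<close> of \<open>(l c)\<^sup>2\<close>, where \<open>k\<close> is the number of
  leaves. The whole sum is then at most \<open>(k + 1) * N - k * N\<close>.\<close>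

lemma star_bound:
  fixes l :: "nat \<Rightarrow> real"
  assumes "finite I" "c \<notin> I" "(l c)\<^sup>2 + (\<Sum>i\<in>I. (l i)\<^sup>2) \<le> N"
  shows "(\<Sum>i\<in>I. (l c - l i)\<^sup>2 - N) \<le> N"
proof (cases "I = {}")
  case False
  define k where "k = real (card I)"
  have k: "k \<ge> 1" using False assms(1) by (simp add: k_def Suc_le_eq card_gt_0_iff)
  define S where "S = (\<Sum>i\<in>I. l i)"
  define Q where "Q = (\<Sum>i\<in>I. (l i)\<^sup>2)"
  have "- 2 * l c * l i \<le> (l c)\<^sup>2 / k + k * (l i)\<^sup>2" for i
  proof -
    have "0 \<le> (l c + k * l i)\<^sup>2 / k" using k by simp
    also have "\<dots> = (l c)\<^sup>2 / k + 2 * l c * l i + k * (l i)\<^sup>2"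
      using k by (simp add: power2_eq_square field_simps)
    finally show ?thesis by simp
  qed
  then have "(\<Sum>i\<in>I. - 2 * l c * l i) \<le> (\<Sum>i\<in>I. (l c)\<^sup>2 / k + k * (l i)\<^sup>2)" by (rule sum_mono)
  then have "- 2 * l c * S \<le> (l c)\<^sup>2 + k * Q"
    using k by (simp add: sum.distrib S_def Q_def k_def sum_negf flip: sum_distrib_left)
  moreover have "(\<Sum>i\<in>I. (l c - l i)\<^sup>2 - N) = k * (l c)\<^sup>2 - 2 * l c * S + Q - k * N"
    by (simp add: power2_diff sum.distrib sum_subtractf S_def Q_def k_def sum_distrib_left)
  moreover have "k * N \<ge> k * ((l c)\<^sup>2 + Q)" using k assms(3) by (intro mult_left_mono) (auto simp: Q_def)
  ultimately show ?thesis using assms(3) unfolding Q_def by (simp add: algebra_simps)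
next
  case True
  have "0 \<le> (l c)\<^sup>2" by simp
  also have "\<dots> \<le> N" using True assms(3) by simp
  finally show ?thesis using True by simp
qed

text \<open>Take the pairs with \<open>l i - l j > sqrt N\<close>.  Two disjoint ones would need \<open>\<Sum> l\<^sup>2 > N\<close> and two
  chained ones a gap larger than \<open>2 sqrt N\<close>, so any two share their larger or their smaller entry.\<close>

lemma sum_gaps_le:
  fixes l :: "nat \<Rightarrow> real"
  assumes N: "(\<Sum>i<n. (l i)\<^sup>2) = N"
  shows "(\<Sum>i<n. \<Sum>j<n. max 0 ((l i - l j)\<^sup>2 - N)) \<le> 2 * N"
proof -
  \<comment> \<open>Only the ordering with the larger value first belongs to \<open>E\<close>. So an
    unordered pair is counted once there, and the factor 2 of the claim comes from the two
    orderings.\<close>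
  define E where "E = {(i, j) \<in> {..<n} \<times> {..<n}. l j < l i \<and> N < (l i - l j)\<^sup>2}"
  have fin: "finite E" by (rule finite_subset[of _ "{..<n} \<times> {..<n}"]) (auto simp: E_def)
  have sub: "(\<Sum>i\<in>I. (l i)\<^sup>2) \<le> N" if "I \<subseteq> {..<n}" for I
    unfolding N[symmetric] using that by (intro sum_mono2) auto
  have N0: "0 \<le> N" using sub[of "{}"] by simp
  have two: "(l i - l j)\<^sup>2 \<le> 2 * ((l i)\<^sup>2 + (l j)\<^sup>2)" for i j
    using zero_le_power2[of "l i + l j"] by (simp add: power2_eq_square algebra_simps)
  have inter: "i = k \<or> j = p" if ij: "(i, j) \<in> E" "(k, p) \<in> E" for i j k p
  proof (rule ccontr)
    assume neg: "\<not> (i = k \<or> j = p)"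
    have E: "i < n" "j < n" "k < n" "p < n" "l j < l i" "l p < l k"
      "N < (l i - l j)\<^sup>2" "N < (l k - l p)\<^sup>2" "i \<noteq> j" "k \<noteq> p" using ij by (auto simp: E_def)
    have far: "4 * N < ((l i - l j) + (l k - l p))\<^sup>2"
    proof -
      have s: "sqrt N < l i - l j" "sqrt N < l k - l p"
        using E by (auto intro!: real_less_lsqrt)
      have "(2 * sqrt N)\<^sup>2 < ((l i - l j) + (l k - l p))\<^sup>2"
        using s N0 by (intro power_strict_mono) auto
      then show ?thesis using N0 by (simp add: power_mult_distrib)
    qed
    \<comment> \<open>In the first two cases the pairs are chained, and the gap between the two
      outer entries is too large; in the last one all four indices are distinct.\<close>
    consider "j = k" | "i = p" "j \<noteq> k" | "j \<noteq> k" "i \<noteq> p" by blast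
    then show False
    proof cases
      case 1
      note far
      also have "((l i - l j) + (l k - l p))\<^sup>2 = (l i - l p)\<^sup>2" using 1 by simp
      also have "\<dots> \<le> 2 * ((l i)\<^sup>2 + (l p)\<^sup>2)" by (rule two)
      also have "(l i)\<^sup>2 + (l p)\<^sup>2 \<le> N"
        using sub[of "{i, p}"] E 1 by (cases "i = p") auto
      finally show False using N0 by simp
    next
      case 2
      note far
      also have "((l i - l j) + (l k - l p))\<^sup>2 = (l k - l j)\<^sup>2" using 2 by simp
      also have "\<dots> \<le> 2 * ((l k)\<^sup>2 + (l j)\<^sup>2)" by (rule two)
      also have "(l k)\<^sup>2 + (l j)\<^sup>2 \<le> N"
        using sub[of "{k, j}"] E 2 by auto
      finally show False using N0 by simp
    next
      case 3
      then show False using two[of i j] two[of k p] sub[of "{i, j, k, p}"] E neg by auto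
    qed
  qed
  have max: "max 0 ((l i - l j)\<^sup>2 - N) = (if (i, j) \<in> E then (l i - l j)\<^sup>2 - N else 0)
      + (if (j, i) \<in> E then (l i - l j)\<^sup>2 - N else 0)" if "i < n" "j < n" for i j
  proof (cases "l i = l j")
    case True
    then show ?thesis using N0 by (auto simp: E_def)
  next
    case False
    have "(l i - l j)\<^sup>2 = (l j - l i)\<^sup>2" by (rule power2_commute)
    then show ?thesis using False that by (cases "l j < l i") (auto simp: E_def)
  qed
  define g where "g i j = (if (i, j) \<in> E then (l i - l j)\<^sup>2 - N else 0)" for i j
  have "(\<Sum>i<n. \<Sum>j<n. max 0 ((l i - l j)\<^sup>2 - N)) = (\<Sum>i<n. \<Sum>j<n. g i j + g j i)"
    by (intro sum.cong refl) (auto simp: max g_def power2_commute)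
  also have "\<dots> = (\<Sum>i<n. \<Sum>j<n. g i j) + (\<Sum>i<n. \<Sum>j<n. g j i)" by (simp add: sum.distrib)
  also have "(\<Sum>i<n. \<Sum>j<n. g j i) = (\<Sum>i<n. \<Sum>j<n. g i j)" by (rule sum.swap)
  also have "(\<Sum>i<n. \<Sum>j<n. g i j) = (\<Sum>(i, j)\<in>E. (l i - l j)\<^sup>2 - N)"
    unfolding g_def sum.cartesian_product
    by (rule sum.mono_neutral_cong_right) (auto simp: E_def split: if_splits)
  also have "\<dots> \<le> N"
  proof (cases "E = {}")
    case False
    obtain c where "(\<forall>i j. (i, j) \<in> E \<longrightarrow> i = c) \<or> (\<forall>i j. (i, j) \<in> E \<longrightarrow> j = c)"
      using star_of_pairs[OF False] inter by blast
    then consider (left) "\<And>i j. (i, j) \<in> E \<Longrightarrow> i = c" | (right) "\<And>i j. (i, j) \<in> E \<Longrightarrow> j = c"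
      by blast
    then show ?thesis
    proof cases
      case left
      define I where "I = snd ` E"
      have E: "E = Pair c ` I" using left by (force simp: I_def)
      have I: "finite I" "c \<notin> I" "insert c I \<subseteq> {..<n}" using fin False by (auto simp: E_def I_def)
         (use E in \<open>auto simp: E_def I_def\<close>)
      have "(\<Sum>(i, j)\<in>E. (l i - l j)\<^sup>2 - N) = (\<Sum>j\<in>I. (l c - l j)\<^sup>2 - N)"
        unfolding E by (subst sum.reindex) (auto simp: inj_on_def)
      also have "\<dots> \<le> N" using I sub[OF I(3)] by (intro star_bound) auto
      finally show ?thesis .
    next
      case right
      define I where "I = fst ` E"
      have E: "E = (\<lambda>i. (i, c)) ` I" using right by (force simp: I_def)
      have I: "finite I" "c \<notin> I" "insert c I \<subseteq> {..<n}" using fin False by (auto simp: E_def I_def)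
         (use E in \<open>auto simp: E_def I_def\<close>)
      have "(\<Sum>(i, j)\<in>E. (l i - l j)\<^sup>2 - N) = (\<Sum>j\<in>I. (l j - l c)\<^sup>2 - N)"
        unfolding E by (subst sum.reindex) (auto simp: inj_on_def)
      also have "\<dots> = (\<Sum>j\<in>I. (l c - l j)\<^sup>2 - N)" by (simp add: power2_commute)
      also have "\<dots> \<le> N" using I sub[OF I(3)] by (intro star_bound) auto
      finally show ?thesis .
    qed
  qed (use N0 in auto)
  finally show ?thesis by simp
qed

section \<open>Commutators of Hermitian matrices\<close>

text \<open>The real part makes this a real inner product, as suits the real coefficients of
  \<open>O(m)\<close>: its Gram matrices are real and symmetric.\<close>

definition frobenius_inner :: "complex mat \<Rightarrow> complex mat \<Rightarrow> real" where
  "frobenius_inner A B = Re (mat_trace (A * mat_adjoint B))"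

lemma frobenius_sq_inner: "frobenius_sq A = frobenius_inner A A"
  by (simp add: frobenius_sq_def frobenius_inner_def)

lemma mat_trace_mult:
  assumes "A \<in> carrier_mat n m" "B \<in> carrier_mat m n"
  shows "mat_trace (A * B) = (\<Sum>i<n. \<Sum>j<m. A $$ (i, j) * B $$ (j, i))"
  using assms by (simp add: mat_trace_def index_mult_mat_sum[OF assms] del: index_mult_mat(1))

lemma mat_trace_mult_commute:
  assumes "A \<in> carrier_mat n m" "B \<in> carrier_mat m n"
  shows "mat_trace (A * B) = mat_trace (B * A)"
  unfolding mat_trace_mult[OF assms] mat_trace_mult[OF assms(2,1)]
  by (subst sum.swap) (simp add: mult.commute)

lemma frobenius_inner_sum:
  assumes "A \<in> carrier_mat n n" "B \<in> carrier_mat n n"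
  shows "frobenius_inner A B = (\<Sum>i<n. \<Sum>j<n. Re (A $$ (i, j) * cnj (B $$ (i, j))))"
  using assms by (simp add: frobenius_inner_def mat_trace_mult[OF assms(1) mat_adjoint_carrier[OF assms(2)]])

lemma frobenius_sq_sum:
  assumes "A \<in> carrier_mat n n"
  shows "frobenius_sq A = (\<Sum>i<n. \<Sum>j<n. (cmod (A $$ (i, j)))\<^sup>2)"
  unfolding frobenius_sq_inner frobenius_inner_sum[OF assms assms]
  by (intro sum.cong refl) (simp add: cmod_power2 flip: power2_eq_square)

lemma frobenius_sq_nonneg:
  assumes "A \<in> carrier_mat n n"
  shows "frobenius_sq A \<ge> 0"
  unfolding frobenius_sq_sum[OF assms] by (simp add: sum_nonneg)

lemma frobenius_sq_eq_0_iff: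
  assumes "A \<in> carrier_mat n n"
  shows "frobenius_sq A = 0 \<longleftrightarrow> A = 0\<^sub>m n n"
proof
  assume "frobenius_sq A = 0"
  then have "\<forall>i<n. \<forall>j<n. (cmod (A $$ (i, j)))\<^sup>2 = 0"
    unfolding frobenius_sq_sum[OF assms] by (simp add: sum_nonneg_eq_0_iff sum_nonneg)
  then show "A = 0\<^sub>m n n" using assms by (intro eq_matI) auto
qed (simp add: frobenius_sq_sum[OF zero_carrier_mat])

lemma frobenius_inner_commute:
  assumes "A \<in> carrier_mat n n" "B \<in> carrier_mat n n"
  shows "frobenius_inner A B = frobenius_inner B A"
  unfolding frobenius_inner_sum[OF assms] frobenius_inner_sum[OF assms(2,1)]
  by (simp add: mult.commute)

section \<open>Invariance under unitary conjugation\<close>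

lemma unitary_groupD:
  assumes "P \<in> unitary_group n"
  shows "P \<in> carrier_mat n n" "mat_adjoint P \<in> carrier_mat n n"
    "P * mat_adjoint P = 1\<^sub>m n" "mat_adjoint P * P = 1\<^sub>m n"
  using assms by (auto simp: unitary_group_def)

lemma unitary_groupI:
  assumes "P \<in> carrier_mat n n" "mat_adjoint P * P = 1\<^sub>m n"
  shows "P \<in> unitary_group n"
  using assms mat_mult_left_right_inverse[OF mat_adjoint_carrier[OF assms(1)] assms(1)]
  by (auto simp: unitary_group_def)

lemma unitary_group_mult:
  assumes "P \<in> unitary_group n" "Q \<in> unitary_group n"
  shows "P * Q \<in> unitary_group n"
proof (rule unitary_groupI)
  note P = unitary_groupD[OF assms(1)] and Q = unitary_groupD[OF assms(2)]
  show "P * Q \<in> carrier_mat n n" using P Q by auto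
  show "mat_adjoint (P * Q) * (P * Q) = 1\<^sub>m n"
    using mat_adjoint_congruence_mult[OF one_carrier_mat P(1) Q(1)] P Q
    by (simp add: mat_adjoint_mult[OF P(1) Q(1)])
qed

lemma congruence_mult:
  assumes P: "P \<in> unitary_group n" and A: "A \<in> carrier_mat n n" and B: "B \<in> carrier_mat n n"
  shows "(mat_adjoint P * A * P) * (mat_adjoint P * B * P) = mat_adjoint P * (A * B) * P"
proof -
  note P = unitary_groupD[OF P]
  note P'A = mult_carrier_mat[OF P(2) A]
  have "(mat_adjoint P * A * P) * (mat_adjoint P * B * P)
      = mat_adjoint P * A * (P * mat_adjoint P) * B * P"
    unfolding assoc_mult_mat[OF P'A P(1) P(2), symmetric]
      assoc_mult_mat[OF mult_carrier_mat[OF P'A P(1)] P(2) B]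
    using assoc_mult_mat[OF mult_carrier_mat[OF P'A P(1)] mult_carrier_mat[OF P(2) B] P(1)] by simp
  also have "\<dots> = mat_adjoint P * (A * B) * P"
    unfolding P(3) right_mult_one_mat[OF P'A] assoc_mult_mat[OF P(2) A B] ..
  finally show ?thesis .
qed

lemma congruence_carrier:
  assumes "P \<in> unitary_group n" "A \<in> carrier_mat n n"
  shows "mat_adjoint P * A * P \<in> carrier_mat n n"
  using unitary_groupD[OF assms(1)] assms(2) by auto

lemma mat_adjoint_congruence':
  assumes "P \<in> unitary_group n" and A: "A \<in> carrier_mat n n"
  shows "mat_adjoint (mat_adjoint P * A * P) = mat_adjoint P * mat_adjoint A * P"
proof -
  note P = unitary_groupD[OF assms(1)]
  show ?thesis
    unfolding mat_adjoint_mult[OF mult_carrier_mat[OF P(2) A] P(1)] mat_adjoint_mult[OF P(2) A]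
      mat_adjoint_adjoint assoc_mult_mat[OF P(2) mat_adjoint_carrier[OF A] P(1)] ..
qed

lemma mat_commutator_carrier [simp]:
  "A \<in> carrier_mat n n \<Longrightarrow> B \<in> carrier_mat n n \<Longrightarrow> mat_commutator A B \<in> carrier_mat n n"
  by (auto simp: mat_commutator_def)

lemma congruence_commutator:
  assumes P: "P \<in> unitary_group n" and A: "A \<in> carrier_mat n n" and B: "B \<in> carrier_mat n n"
  shows "mat_commutator (mat_adjoint P * A * P) (mat_adjoint P * B * P)
    = mat_adjoint P * mat_commutator A B * P"
proof -
  note P' = unitary_groupD[OF P]
  note AB = mult_carrier_mat[OF A B] and BA = mult_carrier_mat[OF B A]
  show ?thesis
    unfolding mat_commutator_def congruence_mult[OF P A B] congruence_mult[OF P B A]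
      mult_minus_distrib_mat[OF P'(2) AB BA]
      minus_mult_distrib_mat[OF mult_carrier_mat[OF P'(2) AB] mult_carrier_mat[OF P'(2) BA] P'(1)] ..
qed

lemma mat_trace_congruence:
  assumes P: "P \<in> unitary_group n" and A: "A \<in> carrier_mat n n"
  shows "mat_trace (mat_adjoint P * A * P) = mat_trace A"
proof -
  note P' = unitary_groupD[OF P]
  have "mat_trace (mat_adjoint P * A * P) = mat_trace (P * (mat_adjoint P * A))"
    using P' A by (intro mat_trace_mult_commute[of _ n n]) auto
  also have "P * (mat_adjoint P * A) = A"
    using P' A by (simp flip: assoc_mult_mat[OF P'(1) P'(2) A])
  finally show ?thesis .
qed

lemma frobenius_inner_congruence:
  assumes P: "P \<in> unitary_group n" and A: "A \<in> carrier_mat n n" and B: "B \<in> carrier_mat n n"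
  shows "frobenius_inner (mat_adjoint P * A * P) (mat_adjoint P * B * P) = frobenius_inner A B"
  unfolding frobenius_inner_def mat_adjoint_congruence'[OF P B]
    congruence_mult[OF P A mat_adjoint_carrier[OF B]]
    mat_trace_congruence[OF P mult_carrier_mat[OF A mat_adjoint_carrier[OF B]]] ..

lemma frobenius_sq_congruence:
  assumes "P \<in> unitary_group n" "A \<in> carrier_mat n n"
  shows "frobenius_sq (mat_adjoint P * A * P) = frobenius_sq A"
  unfolding frobenius_sq_inner using frobenius_inner_congruence assms by auto

lemma hermitian_index:
  assumes "hermitian_mat A" "A \<in> carrier_mat n n" "i < n" "j < n"
  shows "cnj (A $$ (i, j)) = A $$ (j, i)"
  using conjugate_index_self_adjoint[of A n i j] assms by (simp add: hermitian_mat_def)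

lemma hermitian_congruence:
  assumes "P \<in> unitary_group n" "A \<in> carrier_mat n n" "hermitian_mat A"
  shows "hermitian_mat (mat_adjoint P * A * P)"
  using mat_adjoint_congruence'[OF assms(1,2)] assms(3) by (simp add: hermitian_mat_def)

section \<open>Commutators with a real diagonal matrix\<close>

definition real_diag :: "nat \<Rightarrow> (nat \<Rightarrow> real) \<Rightarrow> complex mat" where
  "real_diag n l = mat n n (\<lambda>(i, j). if i = j then complex_of_real (l i) else 0)"

lemma real_diag_carrier [simp]: "real_diag n l \<in> carrier_mat n n"
  by (simp add: real_diag_def)

lemma dim_real_diag [simp]: "dim_row (real_diag n l) = n" "dim_col (real_diag n l) = n"
  by (simp_all add: real_diag_def)

lemma index_real_diag [simp]:
  "i < n \<Longrightarrow> j < n \<Longrightarrow> real_diag n l $$ (i, j) = (if i = j then complex_of_real (l i) else 0)"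
  by (simp add: real_diag_def)

lemma hermitian_diagonalisable:
  assumes A: "A \<in> carrier_mat n n" and h: "hermitian_mat A"
  obtains P l where "P \<in> unitary_group n" "mat_adjoint P * A * P = real_diag n l"
proof -
  obtain P where P: "P \<in> carrier_mat n n" "mat_adjoint P * P = 1\<^sub>m n"
    and diag: "\<And>i j. i < n \<Longrightarrow> j < n \<Longrightarrow> i \<noteq> j \<Longrightarrow> (mat_adjoint P * A * P) $$ (i, j) = 0"
    using spectral_theorem_complex[OF A] h unfolding hermitian_mat_def by blast
  note U = unitary_groupI[OF P]
  let ?D = "mat_adjoint P * A * P"
  have D: "?D \<in> carrier_mat n n" by (rule congruence_carrier[OF U A])
  have "?D $$ (i, i) = complex_of_real (Re (?D $$ (i, i)))" if "i < n" for i
    using hermitian_index[OF hermitian_congruence[OF U A h] D that that]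
    by (simp add: complex_eq_iff del: index_mult_mat)
  then have "?D = real_diag n (\<lambda>i. Re (?D $$ (i, i)))"
    using D diag by (intro eq_matI) (auto simp del: index_mult_mat)
  then show thesis using U that by blast
qed

lemma frobenius_sq_real_diag: "frobenius_sq (real_diag n l) = (\<Sum>i<n. (l i)\<^sup>2)"
proof -
  have "frobenius_sq (real_diag n l) = (\<Sum>i<n. \<Sum>j<n. if i = j then (l i)\<^sup>2 else 0)"
    unfolding frobenius_sq_sum[OF real_diag_carrier] by (intro sum.cong refl) auto
  then show ?thesis by simp
qed

lemma index_commutator_real_diag:
  assumes "Q \<in> carrier_mat n n" "i < n" "j < n"
  shows "mat_commutator (real_diag n l) Q $$ (i, j) = complex_of_real (l i - l j) * Q $$ (i, j)"
proof -
  have "(real_diag n l * Q) $$ (i, j) = (\<Sum>k<n. if i = k then complex_of_real (l i) * Q $$ (i, j) else 0)"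
    unfolding index_mult_mat_sum[OF real_diag_carrier assms]
    using assms by (intro sum.cong refl) auto
  moreover have "(Q * real_diag n l) $$ (i, j) = (\<Sum>k<n. if k = j then complex_of_real (l j) * Q $$ (i, j) else 0)"
    unfolding index_mult_mat_sum[OF assms(1) real_diag_carrier assms(2,3)]
    using assms by (intro sum.cong refl) auto
  ultimately show ?thesis
    using assms by (simp add: mat_commutator_def algebra_simps del: index_mult_mat(1))
qed

lemma frobenius_sq_commutator_real_diag:
  assumes "Q \<in> carrier_mat n n"
  shows "frobenius_sq (mat_commutator (real_diag n l) Q)
    = (\<Sum>i<n. \<Sum>j<n. (l i - l j)\<^sup>2 * (cmod (Q $$ (i, j)))\<^sup>2)"
  unfolding frobenius_sq_sum[OF mat_commutator_carrier[OF real_diag_carrier assms]]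
  by (intro sum.cong refl)
    (simp add: index_commutator_real_diag[OF assms] norm_mult power_mult_distrib del: of_real_diff)

lemma sum_two_squares_le:
  fixes l :: "nat \<Rightarrow> real"
  assumes "i < n" "j < n" "i \<noteq> j"
  shows "(l i)\<^sup>2 + (l j)\<^sup>2 \<le> (\<Sum>k<n. (l k)\<^sup>2)"
  using sum_mono2[of "{..<n}" "{i, j}" "\<lambda>k. (l k)\<^sup>2"] assms by auto

lemma gap_squared_le:
  fixes l :: "nat \<Rightarrow> real"
  assumes "i < n" "j < n"
  shows "(l i - l j)\<^sup>2 \<le> 2 * (\<Sum>k<n. (l k)\<^sup>2)"
proof (cases "i = j")
  case False
  have "(l i - l j)\<^sup>2 \<le> 2 * ((l i)\<^sup>2 + (l j)\<^sup>2)"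
    using zero_le_power2[of "l i + l j"] by (simp add: power2_eq_square algebra_simps)
  also have "\<dots> \<le> 2 * (\<Sum>k<n. (l k)\<^sup>2)"
    using sum_two_squares_le[OF assms False, of l] by simp
  finally show ?thesis .
qed (simp add: sum_nonneg)

text \<open>As \<open>(l i - l j)\<^sup>2 + (l i + l j)\<^sup>2\<close> is twice the sum of the two
  squares, equality leaves no room for \<open>l i + l j\<close> nor for any third entry.\<close>

lemma gap_squared_eq:
  fixes l :: "nat \<Rightarrow> real"
  assumes "i < n" "j < n" "(l i - l j)\<^sup>2 = 2 * (\<Sum>k<n. (l k)\<^sup>2)" "(\<Sum>k<n. (l k)\<^sup>2) > 0"
  shows "i \<noteq> j" "l j = - l i" "l i \<noteq> 0" "\<And>k. k < n \<Longrightarrow> k \<noteq> i \<Longrightarrow> k \<noteq> j \<Longrightarrow> l k = 0"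
proof -
  show ij: "i \<noteq> j" using assms by auto
  have eq: "2 * ((l i)\<^sup>2 + (l j)\<^sup>2) = (l i - l j)\<^sup>2 + (l i + l j)\<^sup>2"
    by (simp add: power2_eq_square algebra_simps)
  have le: "(l i)\<^sup>2 + (l j)\<^sup>2 \<le> (\<Sum>k<n. (l k)\<^sup>2)" by (rule sum_two_squares_le[OF assms(1,2) ij])
  then have "2 * ((l i)\<^sup>2 + (l j)\<^sup>2) \<le> (l i - l j)\<^sup>2" unfolding assms(3) by simp
  then have "(l i + l j)\<^sup>2 \<le> 0" unfolding eq by simp
  then show neg: "l j = - l i" by simp
  then show "l i \<noteq> 0" using assms(3,4) by auto
  fix k assume k: "k < n" "k \<noteq> i" "k \<noteq> j"
  have "(l i)\<^sup>2 + (l j)\<^sup>2 + (l k)\<^sup>2 \<le> (\<Sum>k<n. (l k)\<^sup>2)"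
    using sum_mono2[of "{..<n}" "{i, j, k}" "\<lambda>k. (l k)\<^sup>2"] assms k ij by auto
  moreover have "(\<Sum>k<n. (l k)\<^sup>2) = (l i)\<^sup>2 + (l j)\<^sup>2"
    using assms(3) eq neg by simp
  ultimately show "l k = 0" by simp
qed

lemma commutator_norm_le_diag:
  assumes "Q \<in> carrier_mat n n"
  shows "frobenius_sq (mat_commutator (real_diag n l) Q) \<le> 2 * frobenius_sq (real_diag n l) * frobenius_sq Q"
  unfolding frobenius_sq_commutator_real_diag[OF assms] frobenius_sq_real_diag
    frobenius_sq_sum[OF assms] sum_distrib_left
  by (intro sum_mono mult_right_mono) (auto simp: gap_squared_le simp flip: sum_distrib_left)

text \<open>The deficit in the norm bound is a sum of nonnegative terms, one for each entry of
  \<open>Q\<close>. At equality each of them vanishes, so a nonzero entry can only sit where the gap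
  is maximal.\<close>

lemma commutator_norm_eq_diag:
  assumes Q: "Q \<in> carrier_mat n n"
    and eq: "frobenius_sq (mat_commutator (real_diag n l) Q) = 2 * frobenius_sq (real_diag n l) * frobenius_sq Q"
    and ij: "i < n" "j < n" "Q $$ (i, j) \<noteq> 0"
  shows "(l i - l j)\<^sup>2 = 2 * (\<Sum>k<n. (l k)\<^sup>2)"
proof -
  let ?N = "\<Sum>k<n. (l k)\<^sup>2"
  let ?d = "\<lambda>i j. (2 * ?N - (l i - l j)\<^sup>2) * (cmod (Q $$ (i, j)))\<^sup>2"
  have d: "?d i j \<ge> 0" if "i < n" "j < n" for i j
    using gap_squared_le[OF that, of l] by simp
  have "(\<Sum>i<n. \<Sum>j<n. ?d i j) = 0"
    using eq unfolding frobenius_sq_commutator_real_diag[OF Q] frobenius_sq_real_diag frobenius_sq_sum[OF Q]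
    by (simp add: left_diff_distrib sum_subtractf sum_distrib_left)
  then have "\<forall>i<n. (\<Sum>j<n. ?d i j) = 0"
    by (subst (asm) sum_nonneg_eq_0_iff) (auto intro!: sum_nonneg d)
  then have "(\<Sum>j<n. ?d i j) = 0" using ij by blast
  then have "\<forall>j<n. ?d i j = 0"
    by (subst (asm) sum_nonneg_eq_0_iff) (use d ij in auto)
  then show ?thesis using ij by auto
qed

text \<open>The Boettcher-Wenzel inequality with one Hermitian factor: in an eigenbasis of
  \<open>A\<close> the commutator multiplies every entry of \<open>Q\<close> by a difference of
  eigenvalues, whose square is at most \<open>2 * frobenius_sq A\<close>.\<close>

lemma commutator_norm_le:
  assumes A: "A \<in> carrier_mat n n" "hermitian_mat A" and Q: "Q \<in> carrier_mat n n"
  shows "frobenius_sq (mat_commutator A Q) \<le> 2 * frobenius_sq A * frobenius_sq Q"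
proof -
  obtain P l where P: "P \<in> unitary_group n" "mat_adjoint P * A * P = real_diag n l"
    using hermitian_diagonalisable[OF A] .
  show ?thesis
    using commutator_norm_le_diag[OF congruence_carrier[OF P(1) Q], of l] A Q P(1)
    unfolding P(2)[symmetric] by (simp add: congruence_commutator frobenius_sq_congruence)
qed

section \<open>Bessel's inequality for matrix entries\<close>

lemma cmod_sum_squared:
  fixes d :: "'i \<Rightarrow> real" and v :: "'i \<Rightarrow> complex"
  shows "(cmod (\<Sum>s\<in>S. complex_of_real (d s) * v s))\<^sup>2
    = (\<Sum>s\<in>S. \<Sum>t\<in>S. d s * d t * Re (v s * cnj (v t)))"
proof -
  let ?z = "\<Sum>s\<in>S. complex_of_real (d s) * v s"
  have "(cmod z)\<^sup>2 = Re (z * cnj z)" for z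
    by (simp add: cmod_power2 flip: power2_eq_square)
  then have "(cmod ?z)\<^sup>2 = Re (?z * cnj ?z)" .
  also have "?z * cnj ?z = (\<Sum>s\<in>S. \<Sum>t\<in>S. complex_of_real (d s * d t) * (v s * cnj (v t)))"
    by (simp add: sum_product mult_ac)
  also have "Re \<dots> = (\<Sum>s\<in>S. \<Sum>t\<in>S. d s * d t * Re (v s * cnj (v t)))"
    unfolding Re_sum by (intro sum.cong refl) simp
  finally show ?thesis .
qed

text \<open>Pythagoras for a pairwise orthogonal family: the left-hand side is the squared Frobenius
  norm of the combination with coefficients \<open>d s\<close>.\<close>

lemma sum_norm_linear_combination:
  fixes d :: "'i \<Rightarrow> real"
  assumes fin: "finite S" and Q: "\<And>s. s \<in> S \<Longrightarrow> Q s \<in> carrier_mat n n"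
    and orth: "\<And>s t. s \<in> S \<Longrightarrow> t \<in> S \<Longrightarrow> s \<noteq> t \<Longrightarrow> frobenius_inner (Q s) (Q t) = 0"
  shows "(\<Sum>i<n. \<Sum>j<n. (cmod (\<Sum>s\<in>S. complex_of_real (d s) * Q s $$ (i, j)))\<^sup>2)
    = (\<Sum>s\<in>S. (d s)\<^sup>2 * frobenius_sq (Q s))"
proof -
  have "(\<Sum>i<n. \<Sum>j<n. (cmod (\<Sum>s\<in>S. complex_of_real (d s) * Q s $$ (i, j)))\<^sup>2)
      = (\<Sum>i<n. \<Sum>j<n. \<Sum>s\<in>S. \<Sum>t\<in>S. d s * d t * Re (Q s $$ (i, j) * cnj (Q t $$ (i, j))))"
    by (simp only: cmod_sum_squared)
  also have "\<dots> = (\<Sum>i<n. \<Sum>s\<in>S. \<Sum>j<n. \<Sum>t\<in>S. d s * d t * Re (Q s $$ (i, j) * cnj (Q t $$ (i, j))))"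
    by (rule sum.cong[OF refl], rule sum.swap)
  also have "\<dots> = (\<Sum>s\<in>S. \<Sum>i<n. \<Sum>j<n. \<Sum>t\<in>S. d s * d t * Re (Q s $$ (i, j) * cnj (Q t $$ (i, j))))"
    by (rule sum.swap)
  also have "\<dots> = (\<Sum>s\<in>S. \<Sum>i<n. \<Sum>t\<in>S. \<Sum>j<n. d s * d t * Re (Q s $$ (i, j) * cnj (Q t $$ (i, j))))"
    by (rule sum.cong[OF refl], rule sum.cong[OF refl], rule sum.swap)
  also have "\<dots> = (\<Sum>s\<in>S. \<Sum>t\<in>S. \<Sum>i<n. \<Sum>j<n. d s * d t * Re (Q s $$ (i, j) * cnj (Q t $$ (i, j))))"
    by (rule sum.cong[OF refl], rule sum.swap)
  also have "\<dots> = (\<Sum>s\<in>S. \<Sum>t\<in>S. d s * d t * frobenius_inner (Q s) (Q t))"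
    by (intro sum.cong refl) (simp only: frobenius_inner_sum[OF Q Q] sum_distrib_left)
  also have "\<dots> = (\<Sum>s\<in>S. \<Sum>t\<in>S. if s = t then (d s)\<^sup>2 * frobenius_sq (Q s) else 0)"
    by (intro sum.cong refl) (auto simp: orth frobenius_sq_inner power2_eq_square)
  also have "\<dots> = (\<Sum>s\<in>S. (d s)\<^sup>2 * frobenius_sq (Q s))" using fin by simp
  finally show ?thesis .
qed

text \<open>On Hermitian matrices, \<open>f\<close> of an off-diagonal entry is a real linear
  functional of squared norm \<open>1 / 2\<close>, because the mirrored entry has the same modulus.
  The functional is tested on the combination \<open>Y\<close> that represents it on the span of the
  family: \<open>f (Y i j)\<close> and the squared norm of \<open>Y\<close> are both
  \<open>c\<close>, whence \<open>2 * c\<^sup>2 \<le> c\<close>.\<close>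

lemma bessel_functional:
  fixes f :: "complex \<Rightarrow> real"
  assumes fin: "finite S" and Q: "\<And>s. s \<in> S \<Longrightarrow> Q s \<in> carrier_mat n n"
    and herm: "\<And>s. s \<in> S \<Longrightarrow> hermitian_mat (Q s)"
    and orth: "\<And>s t. s \<in> S \<Longrightarrow> t \<in> S \<Longrightarrow> s \<noteq> t \<Longrightarrow> frobenius_inner (Q s) (Q t) = 0"
    and ij: "i < n" "j < n" "i \<noteq> j"
    and f: "f = Re \<or> f = Im"
  shows "(\<Sum>s\<in>S. (f (Q s $$ (i, j)))\<^sup>2 / frobenius_sq (Q s)) \<le> 1 / 2"
proof -
  define c where "c = (\<Sum>s\<in>S. (f (Q s $$ (i, j)))\<^sup>2 / frobenius_sq (Q s))"
  \<comment> \<open>For a zero matrix \<open>Q s\<close> division by zero makes this coefficient 0,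
    so such members contribute nothing on either side.\<close>
  define d where "d s = f (Q s $$ (i, j)) / frobenius_sq (Q s)" for s
  define Y where "Y a b = (\<Sum>s\<in>S. complex_of_real (d s) * Q s $$ (a, b))" for a b
  have "f (Y i j) = (\<Sum>s\<in>S. d s * f (Q s $$ (i, j)))"
    using f unfolding Y_def by auto
  also have "\<dots> = c" by (simp add: c_def d_def power2_eq_square)
  finally have fY: "f (Y i j) = c" .
  have sym: "Y j i = cnj (Y i j)"
    unfolding Y_def using hermitian_index[OF herm Q ij(1,2)] by (simp cong: sum.cong)
  have "c\<^sup>2 \<le> (cmod (Y i j))\<^sup>2" using f unfolding fY[symmetric]
    by (auto simp: abs_Re_le_cmod abs_Im_le_cmod simp flip: abs_le_square_iff)
  then have "2 * c\<^sup>2 \<le> (cmod (Y i j))\<^sup>2 + (cmod (Y j i))\<^sup>2" by (simp add: sym)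
  also have "\<dots> = (\<Sum>(a, b)\<in>{(i, j), (j, i)}. (cmod (Y a b))\<^sup>2)" using ij by simp
  also have "\<dots> \<le> (\<Sum>(a, b)\<in>{..<n} \<times> {..<n}. (cmod (Y a b))\<^sup>2)"
    by (rule sum_mono2) (use ij in auto)
  also have "\<dots> = (\<Sum>s\<in>S. (d s)\<^sup>2 * frobenius_sq (Q s))"
    unfolding sum.cartesian_product[symmetric] Y_def
    by (rule sum_norm_linear_combination[OF fin Q orth])
  also have "\<dots> = c" unfolding c_def d_def
    by (intro sum.cong refl) (simp add: power2_eq_square)
  finally have "2 * c\<^sup>2 \<le> c" .
  have "c \<le> 1 / 2"
  proof (rule ccontr)
    assume "\<not> c \<le> 1 / 2"
    then have "1 * c < (2 * c) * c" by (intro mult_strict_right_mono) auto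
    then show False using \<open>2 * c\<^sup>2 \<le> c\<close> by (simp add: power2_eq_square)
  qed
  then show ?thesis by (simp add: c_def)
qed

text \<open>Real and imaginary part contribute at most \<open>1 / 2\<close> each. Without the
  Hermitian symmetry both functionals would have norm 1, and the bound would be 2.\<close>

lemma bessel_entry:
  assumes "finite S" "\<And>s. s \<in> S \<Longrightarrow> Q s \<in> carrier_mat n n"
    and "\<And>s. s \<in> S \<Longrightarrow> hermitian_mat (Q s)"
    and "\<And>s t. s \<in> S \<Longrightarrow> t \<in> S \<Longrightarrow> s \<noteq> t \<Longrightarrow> frobenius_inner (Q s) (Q t) = 0"
    and "i < n" "j < n" "i \<noteq> j"
  shows "(\<Sum>s\<in>S. (cmod (Q s $$ (i, j)))\<^sup>2 / frobenius_sq (Q s)) \<le> 1"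
proof -
  have "(\<Sum>s\<in>S. (f (Q s $$ (i, j)))\<^sup>2 / frobenius_sq (Q s)) \<le> 1 / 2" if "f = Re \<or> f = Im" for f
    by (rule bessel_functional) (use assms that in auto)
  from this[of Re] this[of Im] show ?thesis
    by (simp add: cmod_power2 add_divide_distrib sum.distrib)
qed

section \<open>One matrix against an orthogonal family\<close>

lemma commutator_family_bound_diag:
  fixes Q :: "'i \<Rightarrow> complex mat" and l :: "nat \<Rightarrow> real"
  assumes fin: "finite S" and Q: "\<And>s. s \<in> S \<Longrightarrow> Q s \<in> carrier_mat n n"
    and herm: "\<And>s. s \<in> S \<Longrightarrow> hermitian_mat (Q s)"
    and orth: "\<And>s t. s \<in> S \<Longrightarrow> t \<in> S \<Longrightarrow> s \<noteq> t \<Longrightarrow> frobenius_inner (Q s) (Q t) = 0"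
  defines "N \<equiv> frobenius_sq (real_diag n l)"
  shows "(\<Sum>s\<in>S. frobenius_sq (mat_commutator (real_diag n l) (Q s)) / frobenius_sq (Q s) - N) \<le> 2 * N"
proof -
  have N: "N = (\<Sum>i<n. (l i)\<^sup>2)" by (simp add: N_def frobenius_sq_real_diag)
  have N0: "N \<ge> 0" by (simp add: N sum_nonneg)
  define w where "w s i j = (cmod (Q s $$ (i, j)))\<^sup>2 / frobenius_sq (Q s)" for s i j
  have w0: "0 \<le> w s i j" if "s \<in> S" for s i j
    using frobenius_sq_nonneg[OF Q[OF that]] by (simp add: w_def)
  have "frobenius_sq (mat_commutator (real_diag n l) (Q s)) / frobenius_sq (Q s) - N
      \<le> (\<Sum>i<n. \<Sum>j<n. ((l i - l j)\<^sup>2 - N) * w s i j)" if s: "s \<in> S" for s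
  proof -
    \<comment> \<open>The weights of \<open>Q s\<close> add up to 1, or to 0 if \<open>Q s\<close>
      is zero. As \<open>N\<close> is nonnegative, \<open>- N\<close> can therefore be distributed
      over the entries according to these weights.\<close>
    have "(\<Sum>i<n. \<Sum>j<n. w s i j) = frobenius_sq (Q s) / frobenius_sq (Q s)"
      unfolding w_def by (simp only: frobenius_sq_sum[OF Q[OF s]] sum_divide_distrib)
    also have "\<dots> \<le> 1" by simp
    finally have "N * (\<Sum>i<n. \<Sum>j<n. w s i j) \<le> N * 1" using N0 by (rule mult_left_mono)
    then show ?thesis
      unfolding frobenius_sq_commutator_real_diag[OF Q[OF s]]
      by (simp add: w_def left_diff_distrib diff_divide_distrib sum_subtractf sum_distrib_left sum_divide_distrib)
  qed
  then have "(\<Sum>s\<in>S. frobenius_sq (mat_commutator (real_diag n l) (Q s)) / frobenius_sq (Q s) - N)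
      \<le> (\<Sum>s\<in>S. \<Sum>i<n. \<Sum>j<n. ((l i - l j)\<^sup>2 - N) * w s i j)"
    by (rule sum_mono)
  also have "\<dots> = (\<Sum>i<n. \<Sum>s\<in>S. \<Sum>j<n. ((l i - l j)\<^sup>2 - N) * w s i j)" by (rule sum.swap)
  also have "\<dots> = (\<Sum>i<n. \<Sum>j<n. \<Sum>s\<in>S. ((l i - l j)\<^sup>2 - N) * w s i j)"
    by (rule sum.cong[OF refl], rule sum.swap)
  also have "\<dots> = (\<Sum>i<n. \<Sum>j<n. ((l i - l j)\<^sup>2 - N) * (\<Sum>s\<in>S. w s i j))"
    by (simp only: sum_distrib_left)
  also have "\<dots> \<le> (\<Sum>i<n. \<Sum>j<n. max 0 ((l i - l j)\<^sup>2 - N))"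
  proof (intro sum_mono)
    fix i j assume ij: "i \<in> {..<n}" "j \<in> {..<n}"
    have W0: "0 \<le> (\<Sum>s\<in>S. w s i j)" by (rule sum_nonneg) (rule w0)
    show "((l i - l j)\<^sup>2 - N) * (\<Sum>s\<in>S. w s i j) \<le> max 0 ((l i - l j)\<^sup>2 - N)"
    \<comment> \<open>Bessel's inequality is available off the diagonal only. Diagonal pairs have
      gap 0 and fall into the first case, where nonnegative weights are enough.\<close>
    proof (cases "(l i - l j)\<^sup>2 - N \<le> 0")
      case True
      then show ?thesis using W0 by (simp add: mult_nonpos_nonneg max_def)
    next
      case False
      then have "i \<noteq> j" using N0 by auto
      then have "(\<Sum>s\<in>S. w s i j) \<le> 1"
        unfolding w_def using bessel_entry[OF fin Q herm orth] ij by auto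
      then show ?thesis using False mult_left_mono[of "\<Sum>s\<in>S. w s i j" 1 "(l i - l j)\<^sup>2 - N"] by simp
    qed
  qed
  also have "\<dots> \<le> 2 * N" by (rule sum_gaps_le) (simp add: N)
  finally show ?thesis .
qed

text \<open>Conjugation by an eigenbasis of \<open>A\<close> changes no norm, inner product or
  commutator norm. Since \<open>S\<close> is arbitrary, the bound can later be applied to just those
  members whose term is positive.\<close>

lemma commutator_family_bound:
  fixes Q :: "'i \<Rightarrow> complex mat"
  assumes A: "A \<in> carrier_mat n n" "hermitian_mat A"
    and fin: "finite S" and Q: "\<And>s. s \<in> S \<Longrightarrow> Q s \<in> carrier_mat n n"
    and herm: "\<And>s. s \<in> S \<Longrightarrow> hermitian_mat (Q s)"
    and orth: "\<And>s t. s \<in> S \<Longrightarrow> t \<in> S \<Longrightarrow> s \<noteq> t \<Longrightarrow> frobenius_inner (Q s) (Q t) = 0"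
  shows "(\<Sum>s\<in>S. frobenius_sq (mat_commutator A (Q s)) / frobenius_sq (Q s) - frobenius_sq A)
    \<le> 2 * frobenius_sq A"
proof -
  obtain P l where P: "P \<in> unitary_group n" "mat_adjoint P * A * P = real_diag n l"
    using hermitian_diagonalisable[OF A] .
  have "(\<Sum>s\<in>S. frobenius_sq (mat_commutator (real_diag n l) (mat_adjoint P * Q s * P))
        / frobenius_sq (mat_adjoint P * Q s * P) - frobenius_sq (real_diag n l))
      \<le> 2 * frobenius_sq (real_diag n l)"
    by (rule commutator_family_bound_diag[OF fin])
      (use P Q herm orth in \<open>auto simp: congruence_carrier hermitian_congruence frobenius_inner_congruence\<close>)
  then show ?thesis
    unfolding P(2)[symmetric] using Q A(1) P(1)
    by (simp add: congruence_commutator frobenius_sq_congruence)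
qed

section \<open>The group action\<close>

text \<open>The action of the factor \<open>O(m)\<close> alone. It works on each matrix entry
  separately, so its invariants reduce to statements about scalars.\<close>

definition mix :: "nat \<Rightarrow> nat \<Rightarrow> real mat \<Rightarrow> (nat \<Rightarrow> complex mat) \<Rightarrow> nat \<Rightarrow> complex mat" where
  "mix n m R B k = mat n n (\<lambda>(a, b). \<Sum>j<m. complex_of_real (R $$ (j, k)) * B j $$ (a, b))"

lemma mix_carrier [simp]: "mix n m R B k \<in> carrier_mat n n"
  by (simp add: mix_def)

lemma index_mix [simp]:
  "a < n \<Longrightarrow> b < n \<Longrightarrow> mix n m R B k $$ (a, b) = (\<Sum>j<m. complex_of_real (R $$ (j, k)) * B j $$ (a, b))"
  by (simp add: mix_def)

lemma index_congruence:
  assumes P: "P \<in> carrier_mat n n" and X: "X \<in> carrier_mat n n" and "a < n" "b < n"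
  shows "(mat_adjoint P * X * P) $$ (a, b)
    = (\<Sum>c<n. \<Sum>d<n. cnj (P $$ (d, a)) * X $$ (d, c) * P $$ (c, b))"
proof -
  note P' = mat_adjoint_carrier[OF P]
  have "(mat_adjoint P * X * P) $$ (a, b) = (\<Sum>c<n. (mat_adjoint P * X) $$ (a, c) * P $$ (c, b))"
    by (rule index_mult_mat_sum[OF mult_carrier_mat[OF P' X] P assms(3,4)])
  also have "\<dots> = (\<Sum>c<n. (\<Sum>d<n. cnj (P $$ (d, a)) * X $$ (d, c)) * P $$ (c, b))"
    using assms by (intro sum.cong refl) (simp add: index_mult_mat_sum[OF P' X] del: index_mult_mat(1))
  finally show ?thesis by (simp only: sum_distrib_right)
qed

text \<open>Conjugation is linear, so the combination with the coefficients of \<open>R\<close> may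
  be formed before it.\<close>

lemma K_act_mix:
  assumes P: "P \<in> carrier_mat n n" and B: "\<And>j. j < m \<Longrightarrow> B j \<in> carrier_mat n n"
  shows "K_act n m (P, R) B k = mat_adjoint P * mix n m R B k * P"
proof (rule eq_matI)
  fix a b assume "a < dim_row (mat_adjoint P * mix n m R B k * P)" "b < dim_col (mat_adjoint P * mix n m R B k * P)"
  then have ab: "a < n" "b < n" using P by auto
  let ?r = "\<lambda>j. complex_of_real (R $$ (j, k))"
  have "K_act n m (P, R) B k $$ (a, b) = (\<Sum>j<m. ?r j * (mat_adjoint P * B j * P) $$ (a, b))"
    using ab P B by (auto simp: K_act_def simp del: index_mult_mat(1) intro!: sum.cong)
  also have "\<dots> = (\<Sum>j<m. \<Sum>c<n. \<Sum>d<n. ?r j * (cnj (P $$ (d, a)) * B j $$ (d, c) * P $$ (c, b)))"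
    using ab by (intro sum.cong refl) (simp only: index_congruence[OF P B] lessThan_iff sum_distrib_left)
  also have "\<dots> = (\<Sum>c<n. \<Sum>j<m. \<Sum>d<n. ?r j * (cnj (P $$ (d, a)) * B j $$ (d, c) * P $$ (c, b)))"
    by (rule sum.swap)
  also have "\<dots> = (\<Sum>c<n. \<Sum>d<n. \<Sum>j<m. ?r j * (cnj (P $$ (d, a)) * B j $$ (d, c) * P $$ (c, b)))"
    by (rule sum.cong[OF refl], rule sum.swap)
  also have "\<dots> = (\<Sum>c<n. \<Sum>d<n. cnj (P $$ (d, a)) * mix n m R B k $$ (d, c) * P $$ (c, b))"
    by (intro sum.cong refl) (auto simp: sum_distrib_left sum_distrib_right mult_ac intro!: sum.cong)
  also have "\<dots> = (mat_adjoint P * mix n m R B k * P) $$ (a, b)"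
    using ab by (simp only: index_congruence[OF P mix_carrier])
  finally show "K_act n m (P, R) B k $$ (a, b) = (mat_adjoint P * mix n m R B k * P) $$ (a, b)" .
qed (use P in \<open>auto simp: K_act_def\<close>)

section \<open>Invariance under orthogonal mixing\<close>

lemma orthogonal_group_rows:
  assumes "R \<in> orthogonal_group m" "i < m" "j < m"
  shows "(\<Sum>k<m. R $$ (i, k) * R $$ (j, k)) = (if i = j then 1 else 0)"
proof -
  have R: "R \<in> carrier_mat m m" "R * transpose_mat R = 1\<^sub>m m"
    using assms(1) by (auto simp: orthogonal_group_def)
  have "(\<Sum>k<m. R $$ (i, k) * R $$ (j, k)) = (R * transpose_mat R) $$ (i, j)"
    using assms R(1) by (subst index_mult_mat_sum[of _ m m _ m]) (auto intro!: sum.cong)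
  then show ?thesis using assms by (simp add: R(2))
qed

lemma orthogonal_groupI:
  assumes "R \<in> carrier_mat m m"
    and "\<And>i j. i < m \<Longrightarrow> j < m \<Longrightarrow> (\<Sum>k<m. R $$ (k, i) * R $$ (k, j)) = (if i = j then 1 else 0)"
  shows "R \<in> orthogonal_group m"
proof -
  have "transpose_mat R * R = 1\<^sub>m m"
  proof (rule eq_matI)
    fix i j assume "i < dim_row (1\<^sub>m m :: real mat)" "j < dim_col (1\<^sub>m m :: real mat)"
    then have ij: "i < m" "j < m" by auto
    then have "(transpose_mat R * R) $$ (i, j) = (\<Sum>k<m. R $$ (k, i) * R $$ (k, j))"
      using assms(1) by (subst index_mult_mat_sum[of _ m m _ m]) (auto intro!: sum.cong)
    then show "(transpose_mat R * R) $$ (i, j) = 1\<^sub>m m $$ (i, j)"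
      using assms(2)[OF ij] ij by simp
  qed (use assms in auto)
  then show ?thesis
    using assms(1) mat_mult_left_right_inverse[of "transpose_mat R" m R] by (auto simp: orthogonal_group_def)
qed

lemma orthogonal_group_cols:
  assumes "R \<in> orthogonal_group m" "i < m" "j < m"
  shows "(\<Sum>k<m. R $$ (k, i) * R $$ (k, j)) = (if i = j then 1 else 0)"
proof -
  have R: "R \<in> carrier_mat m m" "transpose_mat R * R = 1\<^sub>m m"
    using assms(1) by (auto simp: orthogonal_group_def)
  have "(\<Sum>k<m. R $$ (k, i) * R $$ (k, j)) = (transpose_mat R * R) $$ (i, j)"
    using assms R(1) by (subst index_mult_mat_sum[of _ m m _ m]) (auto intro!: sum.cong)
  then show ?thesis using assms by (simp add: R(2))
qed

text \<open>Expanding the squares leaves the inner products of the rows of \<open>R\<close>. In the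
  applications \<open>v j\<close> is a fixed entry of the \<open>j\<close>-th matrix, or of a
  commutator with one index free.\<close>

lemma orthogonal_group_isometry:
  assumes R: "R \<in> orthogonal_group m"
  shows "(\<Sum>k<m. (cmod (\<Sum>j<m. complex_of_real (R $$ (j, k)) * v j))\<^sup>2) = (\<Sum>j<m. (cmod (v j))\<^sup>2)"
proof -
  have "(\<Sum>k<m. (cmod (\<Sum>j<m. complex_of_real (R $$ (j, k)) * v j))\<^sup>2)
      = (\<Sum>k<m. \<Sum>i<m. \<Sum>j<m. R $$ (i, k) * R $$ (j, k) * Re (v i * cnj (v j)))"
    by (simp only: cmod_sum_squared)
  also have "\<dots> = (\<Sum>i<m. \<Sum>k<m. \<Sum>j<m. R $$ (i, k) * R $$ (j, k) * Re (v i * cnj (v j)))"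
    by (rule sum.swap)
  also have "\<dots> = (\<Sum>i<m. \<Sum>j<m. \<Sum>k<m. R $$ (i, k) * R $$ (j, k) * Re (v i * cnj (v j)))"
    by (rule sum.cong[OF refl], rule sum.swap)
  also have "\<dots> = (\<Sum>i<m. \<Sum>j<m. if i = j then (cmod (v i))\<^sup>2 else 0)"
  proof (intro sum.cong refl)
    fix i j assume "i \<in> {..<m}" "j \<in> {..<m}"
    then have "(\<Sum>k<m. R $$ (i, k) * R $$ (j, k) * Re (v i * cnj (v j)))
        = (if i = j then 1 else 0) * Re (v i * cnj (v j))"
      using orthogonal_group_rows[OF R, of i j] by (simp only: lessThan_iff flip: sum_distrib_right)
    then show "(\<Sum>k<m. R $$ (i, k) * R $$ (j, k) * Re (v i * cnj (v j)))
        = (if i = j then (cmod (v i))\<^sup>2 else 0)"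
      by (simp add: cmod_power2 flip: power2_eq_square)
  qed
  also have "\<dots> = (\<Sum>j<m. (cmod (v j))\<^sup>2)" by simp
  finally show ?thesis .
qed

lemma sum_frobenius_sq_mix:
  assumes R: "R \<in> orthogonal_group m" and B: "\<And>j. j < m \<Longrightarrow> B j \<in> carrier_mat n n"
  shows "(\<Sum>k<m. frobenius_sq (mix n m R B k)) = (\<Sum>j<m. frobenius_sq (B j))"
proof -
  have "(\<Sum>k<m. frobenius_sq (mix n m R B k))
      = (\<Sum>k<m. \<Sum>a<n. \<Sum>b<n. (cmod (\<Sum>j<m. complex_of_real (R $$ (j, k)) * B j $$ (a, b)))\<^sup>2)"
    by (simp add: frobenius_sq_sum[OF mix_carrier])
  also have "\<dots> = (\<Sum>a<n. \<Sum>k<m. \<Sum>b<n. (cmod (\<Sum>j<m. complex_of_real (R $$ (j, k)) * B j $$ (a, b)))\<^sup>2)"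
    by (rule sum.swap)
  also have "\<dots> = (\<Sum>a<n. \<Sum>b<n. \<Sum>k<m. (cmod (\<Sum>j<m. complex_of_real (R $$ (j, k)) * B j $$ (a, b)))\<^sup>2)"
    by (rule sum.cong[OF refl], rule sum.swap)
  also have "\<dots> = (\<Sum>a<n. \<Sum>b<n. \<Sum>j<m. (cmod (B j $$ (a, b)))\<^sup>2)"
    by (simp only: orthogonal_group_isometry[OF R])
  also have "\<dots> = (\<Sum>a<n. \<Sum>j<m. \<Sum>b<n. (cmod (B j $$ (a, b)))\<^sup>2)"
    by (rule sum.cong[OF refl], rule sum.swap)
  also have "\<dots> = (\<Sum>j<m. \<Sum>a<n. \<Sum>b<n. (cmod (B j $$ (a, b)))\<^sup>2)"
    by (rule sum.swap)
  also have "\<dots> = (\<Sum>j<m. frobenius_sq (B j))"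
    by (intro sum.cong refl) (simp only: frobenius_sq_sum[OF B] lessThan_iff)
  finally show ?thesis .
qed

lemma index_commutator:
  assumes "A \<in> carrier_mat n n" "B \<in> carrier_mat n n" "a < n" "b < n"
  shows "mat_commutator A B $$ (a, b) = (\<Sum>c<n. A $$ (a, c) * B $$ (c, b) - B $$ (a, c) * A $$ (c, b))"
proof -
  have "mat_commutator A B $$ (a, b) = (A * B) $$ (a, b) - (B * A) $$ (a, b)"
    using assms by (auto simp: mat_commutator_def simp del: index_mult_mat(1))
  then show ?thesis
    by (simp only: index_mult_mat_sum[OF assms(1-4)] index_mult_mat_sum[OF assms(2,1,3,4)] sum_subtractf)
qed

text \<open>Bilinearity of the commutator. The sums are nested so that the isometry of
  \<open>R\<close> can be applied to one index after the other.\<close>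

lemma index_commutator_mix:
  assumes B: "\<And>j. j < m \<Longrightarrow> B j \<in> carrier_mat n n" and ab: "a < n" "b < n"
  shows "mat_commutator (mix n m R B r) (mix n m R B s) $$ (a, b)
    = (\<Sum>j<m. complex_of_real (R $$ (j, r)) *
        (\<Sum>k<m. complex_of_real (R $$ (k, s)) * mat_commutator (B j) (B k) $$ (a, b)))"
proof -
  let ?r = "\<lambda>j. complex_of_real (R $$ (j, r))" and ?s = "\<lambda>k. complex_of_real (R $$ (k, s))"
  let ?c = "\<lambda>j k c. B j $$ (a, c) * B k $$ (c, b) - B k $$ (a, c) * B j $$ (c, b)"
  have "mat_commutator (mix n m R B r) (mix n m R B s) $$ (a, b)
      = (\<Sum>c<n. (\<Sum>j<m. ?r j * B j $$ (a, c)) * (\<Sum>k<m. ?s k * B k $$ (c, b))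
          - (\<Sum>k<m. ?s k * B k $$ (a, c)) * (\<Sum>j<m. ?r j * B j $$ (c, b)))"
    unfolding index_commutator[OF mix_carrier mix_carrier ab]
    using ab by (intro sum.cong refl) (simp only: index_mix lessThan_iff)
  also have "\<dots> = (\<Sum>c<n. \<Sum>j<m. \<Sum>k<m. ?r j * (?s k * ?c j k c))"
  proof (intro sum.cong refl)
    fix c
    have "(\<Sum>k<m. ?s k * B k $$ (a, c)) * (\<Sum>j<m. ?r j * B j $$ (c, b))
        = (\<Sum>j<m. ?r j * B j $$ (c, b)) * (\<Sum>k<m. ?s k * B k $$ (a, c))"
      by (rule mult.commute)
    also have "\<dots> = (\<Sum>j<m. \<Sum>k<m. ?r j * (?s k * (B k $$ (a, c) * B j $$ (c, b))))"
      unfolding sum_product by (intro sum.cong refl) (simp only: mult_ac)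
    finally have "(\<Sum>k<m. ?s k * B k $$ (a, c)) * (\<Sum>j<m. ?r j * B j $$ (c, b))
        = (\<Sum>j<m. \<Sum>k<m. ?r j * (?s k * (B k $$ (a, c) * B j $$ (c, b))))" .
    moreover have "(\<Sum>j<m. ?r j * B j $$ (a, c)) * (\<Sum>k<m. ?s k * B k $$ (c, b))
        = (\<Sum>j<m. \<Sum>k<m. ?r j * (?s k * (B j $$ (a, c) * B k $$ (c, b))))"
      unfolding sum_product by (intro sum.cong refl) (simp only: mult_ac)
    ultimately show "(\<Sum>j<m. ?r j * B j $$ (a, c)) * (\<Sum>k<m. ?s k * B k $$ (c, b))
          - (\<Sum>k<m. ?s k * B k $$ (a, c)) * (\<Sum>j<m. ?r j * B j $$ (c, b))
        = (\<Sum>j<m. \<Sum>k<m. ?r j * (?s k * ?c j k c))"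
      by (simp only: right_diff_distrib sum_subtractf)
  qed
  also have "\<dots> = (\<Sum>j<m. \<Sum>c<n. \<Sum>k<m. ?r j * (?s k * ?c j k c))" by (rule sum.swap)
  also have "\<dots> = (\<Sum>j<m. \<Sum>k<m. \<Sum>c<n. ?r j * (?s k * ?c j k c))"
    by (rule sum.cong[OF refl], rule sum.swap)
  also have "\<dots> = (\<Sum>j<m. ?r j * (\<Sum>k<m. ?s k * mat_commutator (B j) (B k) $$ (a, b)))"
    unfolding sum_distrib_left
    by (rule sum.cong[OF refl], rule sum.cong[OF refl])
      (simp only: index_commutator[OF B B ab] lessThan_iff sum_distrib_left)
  finally show ?thesis .
qed

text \<open>At a fixed matrix entry the table of all commutators is transformed by \<open>R\<close>
  in each of its two indices, and each transformation is an isometry.\<close>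

lemma sum_commutators_mix:
  assumes R: "R \<in> orthogonal_group m" and B: "\<And>j. j < m \<Longrightarrow> B j \<in> carrier_mat n n"
  shows "(\<Sum>r<m. \<Sum>s<m. frobenius_sq (mat_commutator (mix n m R B r) (mix n m R B s)))
    = (\<Sum>r<m. \<Sum>s<m. frobenius_sq (mat_commutator (B r) (B s)))"
proof -
  have entry: "(\<Sum>r<m. \<Sum>s<m. (cmod (mat_commutator (mix n m R B r) (mix n m R B s) $$ (a, b)))\<^sup>2)
      = (\<Sum>r<m. \<Sum>s<m. (cmod (mat_commutator (B r) (B s) $$ (a, b)))\<^sup>2)" if ab: "a < n" "b < n" for a b
  proof -
    \<comment> \<open>The half-transformed table: mixed in its second index, not yet in its
      first.\<close>
    let ?t = "\<lambda>j s. \<Sum>k<m. complex_of_real (R $$ (k, s)) * mat_commutator (B j) (B k) $$ (a, b)"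
    have "mat_commutator (mix n m R B r) (mix n m R B s) $$ (a, b)
        = (\<Sum>j<m. complex_of_real (R $$ (j, r)) * ?t j s)" for r s
      by (rule index_commutator_mix) (use B ab in auto)
    then have "(\<Sum>r<m. \<Sum>s<m. (cmod (mat_commutator (mix n m R B r) (mix n m R B s) $$ (a, b)))\<^sup>2)
        = (\<Sum>r<m. \<Sum>s<m. (cmod (\<Sum>j<m. complex_of_real (R $$ (j, r)) * ?t j s))\<^sup>2)"
      by (simp only:)
    also have "\<dots> = (\<Sum>s<m. \<Sum>r<m. (cmod (\<Sum>j<m. complex_of_real (R $$ (j, r)) * ?t j s))\<^sup>2)"
      by (rule sum.swap)
    also have "\<dots> = (\<Sum>s<m. \<Sum>j<m. (cmod (?t j s))\<^sup>2)" by (simp only: orthogonal_group_isometry[OF R])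
    also have "\<dots> = (\<Sum>j<m. \<Sum>s<m. (cmod (?t j s))\<^sup>2)" by (rule sum.swap)
    also have "\<dots> = (\<Sum>j<m. \<Sum>s<m. (cmod (mat_commutator (B j) (B s) $$ (a, b)))\<^sup>2)"
      by (simp only: orthogonal_group_isometry[OF R])
    finally show ?thesis .
  qed
  have swap: "(\<Sum>r<m. \<Sum>s<m. \<Sum>a<n. \<Sum>b<n. g r s a b) = (\<Sum>a<n. \<Sum>b<n. \<Sum>r<m. \<Sum>s<m. g r s a b)"
    for g :: "nat \<Rightarrow> nat \<Rightarrow> nat \<Rightarrow> nat \<Rightarrow> real"
  proof -
    have "(\<Sum>r<m. \<Sum>s<m. \<Sum>a<n. \<Sum>b<n. g r s a b) = (\<Sum>r<m. \<Sum>a<n. \<Sum>s<m. \<Sum>b<n. g r s a b)"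
      by (rule sum.cong[OF refl], rule sum.swap)
    also have "\<dots> = (\<Sum>a<n. \<Sum>r<m. \<Sum>s<m. \<Sum>b<n. g r s a b)" by (rule sum.swap)
    also have "\<dots> = (\<Sum>a<n. \<Sum>r<m. \<Sum>b<n. \<Sum>s<m. g r s a b)"
      by (rule sum.cong[OF refl], rule sum.cong[OF refl], rule sum.swap)
    also have "\<dots> = (\<Sum>a<n. \<Sum>b<n. \<Sum>r<m. \<Sum>s<m. g r s a b)"
      by (rule sum.cong[OF refl], rule sum.swap)
    finally show ?thesis .
  qed
  have "(\<Sum>r<m. \<Sum>s<m. frobenius_sq (mat_commutator (mix n m R B r) (mix n m R B s)))
      = (\<Sum>a<n. \<Sum>b<n. \<Sum>r<m. \<Sum>s<m. (cmod (mat_commutator (mix n m R B r) (mix n m R B s) $$ (a, b)))\<^sup>2)"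
    by (simp only: frobenius_sq_sum[OF mat_commutator_carrier[OF mix_carrier mix_carrier]] swap)
  also have "\<dots> = (\<Sum>a<n. \<Sum>b<n. \<Sum>r<m. \<Sum>s<m. (cmod (mat_commutator (B r) (B s) $$ (a, b)))\<^sup>2)"
    by (rule sum.cong[OF refl], rule sum.cong[OF refl]) (simp only: entry lessThan_iff)
  also have "\<dots> = (\<Sum>r<m. \<Sum>s<m. frobenius_sq (mat_commutator (B r) (B s)))"
    unfolding swap[symmetric]
    by (intro sum.cong refl) (simp only: frobenius_sq_sum[OF mat_commutator_carrier[OF B B]] lessThan_iff)
  finally show ?thesis .
qed

lemma K_group_cases:
  assumes "g \<in> K_group n m"
  obtains P R where "g = (P, R)" "P \<in> unitary_group n" "R \<in> orthogonal_group m"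
  using assms by (auto simp: K_group_def)

lemma K_act_carrier [simp]: "K_act n m g B k \<in> carrier_mat n n"
  by (simp add: K_act_def split: prod.split)

lemma sum_frobenius_sq_K_act:
  assumes g: "g \<in> K_group n m" and B: "\<And>j. j < m \<Longrightarrow> B j \<in> carrier_mat n n"
  shows "(\<Sum>k<m. frobenius_sq (K_act n m g B k)) = (\<Sum>k<m. frobenius_sq (B k))"
proof -
  obtain P R where P: "g = (P, R)" "P \<in> unitary_group n" "R \<in> orthogonal_group m"
    using K_group_cases[OF g] .
  have K: "K_act n m (P, R) B k = mat_adjoint P * mix n m R B k * P" for k
    by (rule K_act_mix) (use P B in \<open>auto dest: unitary_groupD\<close>)
  show ?thesis
    unfolding P(1) K
      frobenius_sq_congruence[OF P(2) mix_carrier]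
    by (rule sum_frobenius_sq_mix[OF P(3) B])
qed

lemma sum_commutators_K_act:
  assumes g: "g \<in> K_group n m" and B: "\<And>j. j < m \<Longrightarrow> B j \<in> carrier_mat n n"
  shows "(\<Sum>r<m. \<Sum>s<m. frobenius_sq (mat_commutator (K_act n m g B r) (K_act n m g B s)))
    = (\<Sum>r<m. \<Sum>s<m. frobenius_sq (mat_commutator (B r) (B s)))"
proof -
  obtain P R where P: "g = (P, R)" "P \<in> unitary_group n" "R \<in> orthogonal_group m"
    using K_group_cases[OF g] .
  have K: "K_act n m (P, R) B k = mat_adjoint P * mix n m R B k * P" for k
    by (rule K_act_mix) (use P B in \<open>auto dest: unitary_groupD\<close>)
  show ?thesis
    unfolding P(1) K
      congruence_commutator[OF P(2) mix_carrier mix_carrier]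
      frobenius_sq_congruence[OF P(2) mat_commutator_carrier[OF mix_carrier mix_carrier]]
    by (rule sum_commutators_mix[OF P(3) B])
qed

section \<open>Making a tuple pairwise orthogonal\<close>

lemma Re_of_real_mult: "Re (complex_of_real r * z) = r * Re z"
  by simp

text \<open>With \<open>G\<close> the Gram matrix of the tuple, the right-hand side is the entry
  \<open>(r, s)\<close> of \<open>transpose_mat R * G * R\<close>: mixing acts on Gram matrices by
  congruence.\<close>

lemma frobenius_inner_mix:
  assumes B: "\<And>j. j < m \<Longrightarrow> B j \<in> carrier_mat n n"
  shows "frobenius_inner (mix n m R B r) (mix n m R B s)
    = (\<Sum>j<m. \<Sum>k<m. R $$ (j, r) * R $$ (k, s) * frobenius_inner (B j) (B k))"
proof -
  let ?f = "\<lambda>j k a b. R $$ (j, r) * R $$ (k, s) * Re (B j $$ (a, b) * cnj (B k $$ (a, b)))"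
  have "frobenius_inner (mix n m R B r) (mix n m R B s) = (\<Sum>a<n. \<Sum>b<n. \<Sum>j<m. \<Sum>k<m. ?f j k a b)"
    unfolding frobenius_inner_sum[OF mix_carrier mix_carrier]
  proof (intro sum.cong refl)
    fix a b assume "a \<in> {..<n}" "b \<in> {..<n}"
    then have "mix n m R B r $$ (a, b) * cnj (mix n m R B s $$ (a, b))
      = (\<Sum>j<m. \<Sum>k<m. complex_of_real (R $$ (j, r) * R $$ (k, s)) * (B j $$ (a, b) * cnj (B k $$ (a, b))))"
      by (simp add: sum_product mult_ac)
    then have "Re (mix n m R B r $$ (a, b) * cnj (mix n m R B s $$ (a, b)))
      = Re (\<Sum>j<m. \<Sum>k<m. complex_of_real (R $$ (j, r) * R $$ (k, s)) * (B j $$ (a, b) * cnj (B k $$ (a, b))))"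
      by (simp only:)
    then show "Re (mix n m R B r $$ (a, b) * cnj (mix n m R B s $$ (a, b))) = (\<Sum>j<m. \<Sum>k<m. ?f j k a b)"
      by (simp only: Re_sum Re_of_real_mult)
  qed
  also have "\<dots> = (\<Sum>a<n. \<Sum>j<m. \<Sum>b<n. \<Sum>k<m. ?f j k a b)"
    by (rule sum.cong[OF refl], rule sum.swap)
  also have "\<dots> = (\<Sum>j<m. \<Sum>a<n. \<Sum>b<n. \<Sum>k<m. ?f j k a b)" by (rule sum.swap)
  also have "\<dots> = (\<Sum>j<m. \<Sum>a<n. \<Sum>k<m. \<Sum>b<n. ?f j k a b)"
    by (rule sum.cong[OF refl], rule sum.cong[OF refl], rule sum.swap)
  also have "\<dots> = (\<Sum>j<m. \<Sum>k<m. \<Sum>a<n. \<Sum>b<n. ?f j k a b)"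
    by (rule sum.cong[OF refl], rule sum.swap)
  also have "\<dots> = (\<Sum>j<m. \<Sum>k<m. R $$ (j, r) * R $$ (k, s) * frobenius_inner (B j) (B k))"
    by (intro sum.cong refl) (simp only: frobenius_inner_sum[OF B B] lessThan_iff sum_distrib_left)
  finally show ?thesis .
qed

lemma orthogonal_mix_exists:
  assumes B: "\<And>j. j < m \<Longrightarrow> B j \<in> carrier_mat n n"
  obtains R where "R \<in> orthogonal_group m"
    "pairwise (\<lambda>r s. frobenius_inner (mix n m R B r) (mix n m R B s) = 0) {..<m}"
proof -
  define G where "G = mat m m (\<lambda>(j, k). frobenius_inner (B j) (B k))"
  have G: "G \<in> carrier_mat m m" by (simp add: G_def)
  have "transpose_mat G = G"
    using frobenius_inner_commute[OF B B] by (intro eq_matI) (auto simp: G_def)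
  then obtain R where R: "R \<in> carrier_mat m m" and RR: "transpose_mat R * R = 1\<^sub>m m"
    and diag: "\<And>r s. r < m \<Longrightarrow> s < m \<Longrightarrow> r \<noteq> s \<Longrightarrow> (transpose_mat R * G * R) $$ (r, s) = 0"
    using spectral_theorem_real[OF G] by blast
  have "R \<in> orthogonal_group m"
    using R RR mat_mult_left_right_inverse[of "transpose_mat R" m R] by (auto simp: orthogonal_group_def)
  moreover have "frobenius_inner (mix n m R B r) (mix n m R B s) = 0" if rs: "r < m" "s < m" "r \<noteq> s" for r s
  proof -
    have RT: "transpose_mat R \<in> carrier_mat m m" using R by simp
    have "(transpose_mat R * G * R) $$ (r, s) = (\<Sum>k<m. (transpose_mat R * G) $$ (r, k) * R $$ (k, s))"
      by (rule index_mult_mat_sum[OF mult_carrier_mat[OF RT G] R rs(1,2)])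
    also have "\<dots> = (\<Sum>k<m. (\<Sum>j<m. R $$ (j, r) * frobenius_inner (B j) (B k)) * R $$ (k, s))"
    proof (rule sum.cong[OF refl])
      fix k assume "k \<in> {..<m}"
      then have "(transpose_mat R * G) $$ (r, k) = (\<Sum>j<m. R $$ (j, r) * frobenius_inner (B j) (B k))"
        using rs R by (subst index_mult_mat_sum[OF RT G]) (auto simp: G_def intro!: sum.cong)
      then show "(transpose_mat R * G) $$ (r, k) * R $$ (k, s)
          = (\<Sum>j<m. R $$ (j, r) * frobenius_inner (B j) (B k)) * R $$ (k, s)" by simp
    qed
    also have "\<dots> = (\<Sum>k<m. \<Sum>j<m. R $$ (j, r) * R $$ (k, s) * frobenius_inner (B j) (B k))"
      unfolding sum_distrib_right by (intro sum.cong refl) (simp only: mult_ac)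
    also have "\<dots> = (\<Sum>j<m. \<Sum>k<m. R $$ (j, r) * R $$ (k, s) * frobenius_inner (B j) (B k))"
      by (rule sum.swap)
    finally show ?thesis using diag[OF rs] frobenius_inner_mix[of m B n R r s] B by simp
  qed
  ultimately show thesis using that unfolding pairwise_def by blast
qed

lemma hermitian_mix:
  assumes B: "\<And>j. j < m \<Longrightarrow> B j \<in> carrier_mat n n" and h: "\<And>j. j < m \<Longrightarrow> hermitian_mat (B j)"
  shows "hermitian_mat (mix n m R B k)"
  unfolding hermitian_mat_def
proof (rule eq_matI)
  fix a b assume "a < dim_row (mix n m R B k)" "b < dim_col (mix n m R B k)"
  then have ab: "a < n" "b < n" by (auto simp: mix_def)
  have "cnj (B j $$ (b, a)) = B j $$ (a, b)" if "j < m" for j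
    by (rule hermitian_index[OF h[OF that] B[OF that] ab(2,1)])
  then show "mat_adjoint (mix n m R B k) $$ (a, b) = mix n m R B k $$ (a, b)"
    using ab by (simp add: carrier_matD[OF mix_carrier])
qed (auto simp: mix_def)

text \<open>Single members of the mixed tuple may change sign within \<open>O(m)\<close>. This
  settles the sign left undetermined in the third matrix of an extremal triple.\<close>

lemma flip_sign_orthogonal_group:
  assumes R: "R \<in> orthogonal_group m" and \<sigma>: "\<And>k. \<sigma> k = 1 \<or> \<sigma> k = (-1 :: real)"
  shows "mat m m (\<lambda>(j, k). \<sigma> k * R $$ (j, k)) \<in> orthogonal_group m"
proof (rule orthogonal_groupI)
  fix i j assume ij: "i < m" "j < m"
  then have "(\<Sum>k<m. mat m m (\<lambda>(j, k). \<sigma> k * R $$ (j, k)) $$ (k, i) * mat m m (\<lambda>(j, k). \<sigma> k * R $$ (j, k)) $$ (k, j))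
      = \<sigma> i * \<sigma> j * (\<Sum>k<m. R $$ (k, i) * R $$ (k, j))"
    by (simp add: sum_distrib_left mult_ac)
  also have "\<dots> = (if i = j then 1 else 0)"
    using orthogonal_group_cols[OF R ij] \<sigma>[of i] by auto
  finally show "(\<Sum>k<m. mat m m (\<lambda>(j, k). \<sigma> k * R $$ (j, k)) $$ (k, i) * mat m m (\<lambda>(j, k). \<sigma> k * R $$ (j, k)) $$ (k, j))
    = (if i = j then 1 else 0)" .
qed simp

lemma mix_flip_sign:
  assumes "k < m"
  shows "mix n m (mat m m (\<lambda>(j, k). \<sigma> k * R $$ (j, k))) B k = complex_of_real (\<sigma> k) \<cdot>\<^sub>m mix n m R B k"
  using assms by (intro eq_matI) (auto simp: mix_def sum_distrib_left mult_ac intro!: sum.cong)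

section \<open>Orthogonal tuples\<close>

lemma mat_commutator_self [simp]: "A \<in> carrier_mat n n \<Longrightarrow> mat_commutator A A = 0\<^sub>m n n"
  unfolding mat_commutator_def by (intro eq_matI) (auto simp del: index_mult_mat(1))

lemma frobenius_sq_zero [simp]: "frobenius_sq (0\<^sub>m n n) = 0"
  using frobenius_sq_eq_0_iff[OF zero_carrier_mat] by blast

lemma sum_offdiag:
  fixes f :: "nat \<Rightarrow> nat \<Rightarrow> real"
  assumes "\<And>r. r < m \<Longrightarrow> f r r = 0"
  shows "(\<Sum>r<m. \<Sum>s<m. f r s) = (\<Sum>r<m. \<Sum>s\<in>{..<m} - {r}. f r s)"
proof (rule sum.cong[OF refl])
  fix r assume "r \<in> {..<m}"
  then show "(\<Sum>s<m. f r s) = (\<Sum>s\<in>{..<m} - {r}. f r s)"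
    using assms by (subst sum.remove[of _ r]) auto
qed

lemma orthogonal_tuple_bound:
  fixes m :: nat
  assumes m: "m \<ge> 3" and C: "\<And>r. r < m \<Longrightarrow> C r \<in> carrier_mat n n"
    and h: "\<And>r. r < m \<Longrightarrow> hermitian_mat (C r)"
    and orth: "pairwise (\<lambda>r s. frobenius_inner (C r) (C s) = 0) {..<m}"
  defines "F \<equiv> (\<Sum>r<m. \<Sum>s<m. frobenius_sq (mat_commutator (C r) (C s)))"
    and "N \<equiv> (\<Sum>r<m. frobenius_sq (C r))"
  shows "F \<le> 4 / 3 * N\<^sup>2"
    "F = 4 / 3 * N\<^sup>2 \<Longrightarrow> \<exists>a<m. \<exists>b<m. \<exists>c<m. a \<noteq> b \<and> a \<noteq> c \<and> b \<noteq> c \<and>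
      frobenius_sq (C b) = frobenius_sq (C a) \<and> frobenius_sq (C c) = frobenius_sq (C a) \<and>
      (\<forall>k<m. k \<noteq> a \<and> k \<noteq> b \<and> k \<noteq> c \<longrightarrow> C k = 0\<^sub>m n n) \<and>
      (\<forall>r<m. \<forall>s<m. r \<noteq> s \<longrightarrow>
        frobenius_sq (mat_commutator (C r) (C s)) = 2 * frobenius_sq (C r) * frobenius_sq (C s))"
proof -
  define x where "x r = frobenius_sq (C r)" for r
  define f where "f r s = frobenius_sq (mat_commutator (C r) (C s))" for r s
  \<comment> \<open>The excess of the ratio over 1, cut off at 0 because the weights in
    \<open>weighted_pairs_bound\<close> are nonnegative. If \<open>x r * x s = 0\<close>, the
    quotient is 0 and so is the weight.\<close>
  define u where "u r s = max 0 (f r s / (x r * x s) - 1)" for r s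
  have x0: "x r \<ge> 0" if "r < m" for r unfolding x_def by (rule frobenius_sq_nonneg[OF C[OF that]])
  have f0: "f r s \<ge> 0" if "r < m" "s < m" for r s
    unfolding f_def by (rule frobenius_sq_nonneg[OF mat_commutator_carrier[OF C[OF that(1)] C[OF that(2)]]])
  have f2: "f r s \<le> 2 * (x r * x s)" if "r < m" "s < m" for r s
    using commutator_norm_le[OF C[OF that(1)] h[OF that(1)] C[OF that(2)]] by (simp add: f_def x_def mult.assoc)
  have fdiag: "f r r = 0" if "r < m" for r using C[OF that] by (simp add: f_def)
  have F: "F = (\<Sum>r<m. \<Sum>s\<in>{..<m} - {r}. f r s)"
    unfolding F_def f_def[symmetric] using sum_offdiag[of m f] fdiag by blast
  have u01: "0 \<le> u r s \<and> u r s \<le> 1" if "r < m" "s < m" for r s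
  proof -
    have "f r s / (x r * x s) \<le> 2"
      using f2[OF that] x0[OF that(1)] x0[OF that(2)]
      by (cases "x r * x s = 0") (auto simp: divide_le_eq zero_less_mult_iff less_le)
    then show ?thesis by (simp add: u_def)
  qed
  have fu: "f r s \<le> (1 + u r s) * x r * x s" if "r < m" "s < m" for r s
  proof (cases "x r * x s = 0")
    case True
    then show ?thesis using f2[OF that] by auto
  next
    case False
    then have pos: "x r * x s > 0" using x0[OF that(1)] x0[OF that(2)] by (simp add: less_le)
    have "f r s = (f r s / (x r * x s)) * (x r * x s)" using False by simp
    also have "\<dots> \<le> (1 + u r s) * (x r * x s)"
      using pos by (intro mult_right_mono) (auto simp: u_def)
    finally show ?thesis by (simp add: mult.assoc)
  qed
  have usum: "(\<Sum>s\<in>{..<m} - {r}. u r s) \<le> 2" if r: "r < m" for r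
  proof (cases "x r = 0")
    case False
    then have xr: "x r > 0" using x0[OF r] by simp
    \<comment> \<open>On the terms with positive excess the cut-off disappears, and the family bound
      applies to exactly these.\<close>
    define S where "S = {s \<in> {..<m} - {r}. f r s / (x r * x s) - 1 > 0}"
    have S: "finite S" "S \<subseteq> {..<m} - {r}" by (auto simp: S_def)
    have "(\<Sum>s\<in>S. frobenius_sq (mat_commutator (C r) (C s)) / frobenius_sq (C s) - frobenius_sq (C r))
      \<le> 2 * frobenius_sq (C r)"
    proof (rule commutator_family_bound)
      show "frobenius_inner (C s) (C t) = 0" if "s \<in> S" "t \<in> S" "s \<noteq> t" for s t
        using pairwiseD[OF orth, of s t] that S by auto
    qed (use S r C h in auto)
    then have le: "(\<Sum>s\<in>S. f r s / x s - x r) \<le> 2 * x r" by (simp add: f_def x_def)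
    have "(\<Sum>s\<in>{..<m} - {r}. u r s) = (\<Sum>s\<in>S. f r s / (x r * x s) - 1)"
      by (rule sum.mono_neutral_cong_right) (auto simp: S_def u_def)
    also have "\<dots> = (\<Sum>s\<in>S. (f r s / x s - x r) / x r)"
      by (intro sum.cong refl) (use xr in \<open>simp add: diff_divide_distrib mult.commute\<close>)
    also have "\<dots> = (\<Sum>s\<in>S. f r s / x s - x r) / x r" by (simp only: sum_divide_distrib)
    also have "\<dots> \<le> 2" using le xr by (simp add: divide_le_eq)
    finally show ?thesis .
  qed (simp add: u_def)
  define T where "T = (\<Sum>r<m. \<Sum>s\<in>{..<m} - {r}. (1 + u r s) * x r * x s)"
  have FT: "F \<le> T" unfolding F T_def by (intro sum_mono fu) auto
  have T: "T \<le> 4 / 3 * (\<Sum>r<m. x r)\<^sup>2"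
    "T = 4 / 3 * (\<Sum>r<m. x r)\<^sup>2 \<Longrightarrow> \<exists>a<m. \<exists>b<m. \<exists>c<m. a \<noteq> b \<and> a \<noteq> c \<and> b \<noteq> c \<and>
      x b = x a \<and> x c = x a \<and> (\<forall>k<m. k \<noteq> a \<and> k \<noteq> b \<and> k \<noteq> c \<longrightarrow> x k = 0)"
    unfolding T_def using weighted_pairs_bound[of m x u] m x0 u01 usum by auto
  have N: "N = (\<Sum>r<m. x r)" by (simp add: N_def x_def)
  show "F \<le> 4 / 3 * N\<^sup>2" using FT T(1) by (simp add: N)
  assume eq: "F = 4 / 3 * N\<^sup>2"
  then have "T = 4 / 3 * (\<Sum>r<m. x r)\<^sup>2" using FT T(1) by (simp add: N)
  then obtain a b c where abc: "a < m" "b < m" "c < m" "a \<noteq> b" "a \<noteq> c" "b \<noteq> c"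
    and xabc: "x b = x a" "x c = x a" and rest: "\<And>k. k < m \<Longrightarrow> k \<noteq> a \<Longrightarrow> k \<noteq> b \<Longrightarrow> k \<noteq> c \<Longrightarrow> x k = 0"
    using T(2) by blast
  have sum3: "(\<Sum>r<m. g r) = g a + g b + g c"
    if "\<And>k. k < m \<Longrightarrow> k \<noteq> a \<Longrightarrow> k \<noteq> b \<Longrightarrow> k \<noteq> c \<Longrightarrow> g k = 0" for g :: "nat \<Rightarrow> real"
  proof -
    have "(\<Sum>r<m. g r) = (\<Sum>r\<in>{a, b, c}. g r)"
      by (rule sum.mono_neutral_right) (use abc that in auto)
    then show ?thesis using abc by simp
  qed
  \<comment> \<open>For three equal values the upper bounds \<open>2 * (x r * x s)\<close> of the
    six ordered pairs sum to \<open>12 * (x a)\<^sup>2\<close>, which is also \<open>4 / 3\<close>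
    of the squared total. Hence no pair has any slack.\<close>
  have "(\<Sum>r<m. \<Sum>s\<in>{..<m} - {r}. 2 * (x r * x s)) = (\<Sum>r<m. 2 * x r * ((\<Sum>s<m. x s) - x r))"
    by (intro sum.cong refl) (simp add: sum_diff1 algebra_simps sum_distrib_left)
  also have "\<dots> = 12 * (x a)\<^sup>2"
    by (subst sum3, (simp add: rest), subst (1 2 3) sum3, simp_all add: rest xabc power2_eq_square)
  also have "\<dots> = F" unfolding eq N by (subst sum3) (simp_all add: rest xabc power2_eq_square)
  finally have "(\<Sum>r<m. \<Sum>s\<in>{..<m} - {r}. 2 * (x r * x s) - f r s) = 0"
    by (simp add: F sum_subtractf)
  moreover have nn: "2 * (x r * x s) - f r s \<ge> 0" if "r < m" "s < m" for r s using f2[OF that] by simp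
  ultimately have "\<forall>r\<in>{..<m}. (\<Sum>s\<in>{..<m} - {r}. 2 * (x r * x s) - f r s) = 0"
    by (subst (asm) sum_nonneg_eq_0_iff) (auto intro!: sum_nonneg)
  then have all: "f r s = 2 * x r * x s" if "r < m" "s < m" "r \<noteq> s" for r s
    using sum_nonneg_0[of "{..<m} - {r}" "\<lambda>s. 2 * (x r * x s) - f r s" s] nn that by force
  have "C k = 0\<^sub>m n n" if "k < m" "k \<noteq> a" "k \<noteq> b" "k \<noteq> c" for k
    using rest[OF that] frobenius_sq_eq_0_iff[OF C[OF that(1)]] by (simp add: x_def)
  then show "\<exists>a<m. \<exists>b<m. \<exists>c<m. a \<noteq> b \<and> a \<noteq> c \<and> b \<noteq> c \<and>
      frobenius_sq (C b) = frobenius_sq (C a) \<and> frobenius_sq (C c) = frobenius_sq (C a) \<and>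
      (\<forall>k<m. k \<noteq> a \<and> k \<noteq> b \<and> k \<noteq> c \<longrightarrow> C k = 0\<^sub>m n n) \<and>
      (\<forall>r<m. \<forall>s<m. r \<noteq> s \<longrightarrow>
        frobenius_sq (mat_commutator (C r) (C s)) = 2 * frobenius_sq (C r) * frobenius_sq (C s))"
    using abc xabc all unfolding x_def f_def by blast
qed

lemma frobenius_sq_commutator_commute:
  assumes "A \<in> carrier_mat n n" "B \<in> carrier_mat n n"
  shows "frobenius_sq (mat_commutator A B) = frobenius_sq (mat_commutator B A)"
proof -
  have "mat_commutator A B $$ (i, j) = - mat_commutator B A $$ (i, j)" if "i < n" "j < n" for i j
    unfolding index_commutator[OF assms that] index_commutator[OF assms(2,1) that]
    by (simp flip: sum_negf)
  then show ?thesis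
    unfolding frobenius_sq_sum[OF mat_commutator_carrier[OF assms]]
      frobenius_sq_sum[OF mat_commutator_carrier[OF assms(2,1)]]
    by (intro sum.cong refl) simp
qed

text \<open>The commutator bound followed by \<open>4 * a * b \<le> (a + b)\<^sup>2\<close>, so two
  matrices are treated without orthogonalisation. The factor 2 counts the two ordered pairs.\<close>

lemma pair_bound:
  assumes A: "A \<in> carrier_mat n n" "hermitian_mat A" and B: "B \<in> carrier_mat n n"
  shows "2 * frobenius_sq (mat_commutator A B) \<le> (frobenius_sq A + frobenius_sq B)\<^sup>2"
    "2 * frobenius_sq (mat_commutator A B) = (frobenius_sq A + frobenius_sq B)\<^sup>2 \<Longrightarrow>
      frobenius_sq B = frobenius_sq A \<and>
      frobenius_sq (mat_commutator A B) = 2 * frobenius_sq A * frobenius_sq B"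
proof -
  let ?a = "frobenius_sq A" and ?b = "frobenius_sq B"
  have le: "2 * frobenius_sq (mat_commutator A B) \<le> 4 * ?a * ?b"
    using commutator_norm_le[OF A B] by simp
  have sq: "(?a + ?b)\<^sup>2 = 4 * ?a * ?b + (?a - ?b)\<^sup>2" by (simp add: power2_eq_square algebra_simps)
  have nn: "0 \<le> (?a - ?b)\<^sup>2" by simp
  show "2 * frobenius_sq (mat_commutator A B) \<le> (?a + ?b)\<^sup>2" using le sq nn by linarith
  assume eq: "2 * frobenius_sq (mat_commutator A B) = (?a + ?b)\<^sup>2"
  then have "(?a - ?b)\<^sup>2 = 0" using le sq nn by linarith
  then show "?b = ?a \<and> frobenius_sq (mat_commutator A B) = 2 * ?a * ?b" using eq sq by simp
qed

section \<open>The normal form of extremal tuples\<close>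

text \<open>A complex coordinate for the Hermitian matrices of size 2 with zero diagonal:
  \<open>H2\<close> lies on the real axis, \<open>H3\<close> on the imaginary axis, and the
  combinations with \<open>cos\<close> and \<open>sin\<close> on a circle.\<close>

definition hollow :: "complex \<Rightarrow> complex mat" where
  "hollow z = mat_of_rows_list 2 [[0, z], [cnj z, 0]]"

lemma mat2_carrier [simp]:
  "H1 l \<in> carrier_mat 2 2" "H2 l \<in> carrier_mat 2 2" "H3 l \<in> carrier_mat 2 2" "hollow z \<in> carrier_mat 2 2"
  by (auto simp: H1_def H2_def H3_def hollow_def mat_of_rows_list_def)

lemma index_mat2:
  "i < 2 \<Longrightarrow> j < 2 \<Longrightarrow> H1 l $$ (i, j) = (if i = j then (if i = 0 then complex_of_real l else - complex_of_real l) else 0)"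
  "i < 2 \<Longrightarrow> j < 2 \<Longrightarrow> H2 l $$ (i, j) = (if i = j then 0 else complex_of_real l)"
  "i < 2 \<Longrightarrow> j < 2 \<Longrightarrow> H3 l $$ (i, j) = (if i = j then 0 else if i = 0 then - complex_of_real l * \<i> else complex_of_real l * \<i>)"
  "i < 2 \<Longrightarrow> j < 2 \<Longrightarrow> hollow z $$ (i, j) = (if i = j then 0 else if i = 0 then z else cnj z)"
  by (auto simp: H1_def H2_def H3_def hollow_def mat_of_rows_list_def less_2_cases_iff)

lemma hollow_H2: "hollow (complex_of_real l) = H2 l"
  by (intro eq_matI) (auto simp: carrier_matD[OF mat2_carrier(2)] carrier_matD[OF mat2_carrier(4)] index_mat2)

lemma hollow_H3: "hollow (- complex_of_real l * \<i>) = H3 l"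
  by (intro eq_matI) (auto simp: carrier_matD[OF mat2_carrier(3)] carrier_matD[OF mat2_carrier(4)] index_mat2)

lemma diag_zero_carrier [simp]:
  "n \<ge> 2 \<Longrightarrow> H \<in> carrier_mat 2 2 \<Longrightarrow> diag_zero n H \<in> carrier_mat n n"
  unfolding diag_zero_def by (intro carrier_matI) auto

lemma index_diag_zero:
  assumes "n \<ge> 2" "H \<in> carrier_mat 2 2" "i < n" "j < n"
  shows "diag_zero n H $$ (i, j) = (if i < 2 \<and> j < 2 then H $$ (i, j) else 0)"
  using assms by (auto simp: diag_zero_def)

lemma eq_diag_zeroI:
  assumes "n \<ge> 2" "H \<in> carrier_mat 2 2" "A \<in> carrier_mat n n"
    and "\<And>i j. i < n \<Longrightarrow> j < n \<Longrightarrow> A $$ (i, j) = (if i < 2 \<and> j < 2 then H $$ (i, j) else 0)"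
  shows "A = diag_zero n H"
  using assms carrier_matD[OF diag_zero_carrier[OF assms(1,2)]]
  by (intro eq_matI) (auto simp: index_diag_zero)

lemma frobenius_inner_diag_zero:
  assumes "n \<ge> 2" "H \<in> carrier_mat 2 2" "H' \<in> carrier_mat 2 2"
  shows "frobenius_inner (diag_zero n H) (diag_zero n H') = frobenius_inner H H'"
proof -
  have cut: "(\<Sum>j<n. g j) = (\<Sum>j<2. g j)" if "\<And>j. 2 \<le> j \<Longrightarrow> g j = 0" for g :: "nat \<Rightarrow> real"
    by (rule sum.mono_neutral_right) (use assms(1) that in auto)
  have "frobenius_inner (diag_zero n H) (diag_zero n H')
      = (\<Sum>i<n. \<Sum>j<n. if i < 2 \<and> j < 2 then Re (H $$ (i, j) * cnj (H' $$ (i, j))) else 0)"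
    unfolding frobenius_inner_sum[OF diag_zero_carrier[OF assms(1,2)] diag_zero_carrier[OF assms(1,3)]]
    by (intro sum.cong refl) (auto simp: index_diag_zero[OF assms(1,2)] index_diag_zero[OF assms(1,3)])
  also have "\<dots> = (\<Sum>i<2. \<Sum>j<2. if i < 2 \<and> j < 2 then Re (H $$ (i, j) * cnj (H' $$ (i, j))) else 0)"
    by (subst (1 2) cut) auto
  also have "\<dots> = frobenius_inner H H'"
    unfolding frobenius_inner_sum[OF assms(2,3)] by (intro sum.cong refl) auto
  finally show ?thesis .
qed

lemma frobenius_sq_diag_zero:
  assumes "n \<ge> 2" "H \<in> carrier_mat 2 2"
  shows "frobenius_sq (diag_zero n H) = frobenius_sq H"
  unfolding frobenius_sq_inner by (rule frobenius_inner_diag_zero[OF assms assms(2)])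

lemma diag_zero_commutator:
  assumes "n \<ge> 2" "H \<in> carrier_mat 2 2" "H' \<in> carrier_mat 2 2"
  shows "mat_commutator (diag_zero n H) (diag_zero n H') = diag_zero n (mat_commutator H H')"
proof (rule eq_diag_zeroI[OF assms(1)])
  show "mat_commutator H H' \<in> carrier_mat 2 2" using assms by simp
  show "mat_commutator (diag_zero n H) (diag_zero n H') \<in> carrier_mat n n" using assms by simp
  fix i j assume ij: "i < n" "j < n"
  let ?D = "diag_zero n H" and ?D' = "diag_zero n H'"
  have "mat_commutator ?D ?D' $$ (i, j) = (\<Sum>c<n. ?D $$ (i, c) * ?D' $$ (c, j) - ?D' $$ (i, c) * ?D $$ (c, j))"
    using assms ij by (simp add: index_commutator)
  also have "\<dots> = (\<Sum>c<2. ?D $$ (i, c) * ?D' $$ (c, j) - ?D' $$ (i, c) * ?D $$ (c, j))"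
    by (rule sum.mono_neutral_right) (use assms ij in \<open>auto simp: index_diag_zero\<close>)
  also have "\<dots> = (if i < 2 \<and> j < 2 then mat_commutator H H' $$ (i, j) else 0)"
    using assms ij by (auto simp: index_diag_zero index_commutator[OF assms(2,3)] intro!: sum.cong)
  finally show "mat_commutator ?D ?D' $$ (i, j) = (if i < 2 \<and> j < 2 then mat_commutator H H' $$ (i, j) else 0)" .
qed

lemma sum_lessThan_2: "(\<Sum>i<2. g i) = g 0 + g (1 :: nat)"
  for g :: "nat \<Rightarrow> 'a :: comm_monoid_add"
  by (simp add: numeral_2_eq_2)

lemma frobenius_sq_mat2:
  "frobenius_sq (H1 l) = 2 * l\<^sup>2" "frobenius_sq (H2 l) = 2 * l\<^sup>2" "frobenius_sq (H3 l) = 2 * l\<^sup>2"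
  "frobenius_sq (hollow z) = 2 * (cmod z)\<^sup>2"
  by (simp_all add: frobenius_sq_sum[OF mat2_carrier(1)] frobenius_sq_sum[OF mat2_carrier(2)]
      frobenius_sq_sum[OF mat2_carrier(3)] frobenius_sq_sum[OF mat2_carrier(4)] sum_lessThan_2 index_mat2
      norm_mult)

text \<open>The first commutator has zero diagonal and off-diagonal entries \<open>2 * l * z\<close>
  up to sign and conjugation; the second is diagonal with purely imaginary entries of opposite
  sign.\<close>

lemma frobenius_sq_commutator_hollow:
  "frobenius_sq (mat_commutator (H1 l) (hollow z)) = 8 * l\<^sup>2 * (cmod z)\<^sup>2"
  "frobenius_sq (mat_commutator (hollow z) (hollow w)) = 8 * (Im (z * cnj w))\<^sup>2"
proof -
  have "frobenius_sq (mat_commutator (H1 l) (hollow z)) = (cmod (2 * complex_of_real l * z))\<^sup>2 + (cmod (2 * complex_of_real l * cnj z))\<^sup>2"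
    unfolding frobenius_sq_sum[OF mat_commutator_carrier[OF mat2_carrier(1,4)]]
    by (simp add: sum_lessThan_2 index_commutator[OF mat2_carrier(1,4)] index_mat2 norm_mult power_mult_distrib flip: mult_2)
  then show "frobenius_sq (mat_commutator (H1 l) (hollow z)) = 8 * l\<^sup>2 * (cmod z)\<^sup>2"
    by (simp add: norm_mult power_mult_distrib)
  have "z * cnj w - w * cnj z = complex_of_real (2 * Im (z * cnj w)) * \<i>" "cnj z * w - cnj w * z = - complex_of_real (2 * Im (z * cnj w)) * \<i>"
    by (auto simp: complex_eq_iff)
  moreover have "frobenius_sq (mat_commutator (hollow z) (hollow w)) = (cmod (z * cnj w - w * cnj z))\<^sup>2 + (cmod (cnj z * w - cnj w * z))\<^sup>2"
    unfolding frobenius_sq_sum[OF mat_commutator_carrier[OF mat2_carrier(4,4)]]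
    by (simp add: sum_lessThan_2 index_commutator[OF mat2_carrier(4,4)] index_mat2)
  ultimately have "frobenius_sq (mat_commutator (hollow z) (hollow w))
      = (cmod (complex_of_real (2 * Im (z * cnj w)) * \<i>))\<^sup>2 + (cmod (- complex_of_real (2 * Im (z * cnj w)) * \<i>))\<^sup>2"
    by (simp only:)
  then show "frobenius_sq (mat_commutator (hollow z) (hollow w)) = 8 * (Im (z * cnj w))\<^sup>2"
    by (simp only: norm_mult norm_minus_cancel norm_of_real norm_ii mult_1_right power2_abs power_mult_distrib)
       simp
qed

text \<open>A permutation matrix with phases. The permutation will move two eigenvectors to the
  front, and a phase will make one off-diagonal entry a positive real number.\<close>

lemma monomial_unitary:
  fixes \<pi> :: "nat \<Rightarrow> nat" and ph :: "nat \<Rightarrow> complex"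
  assumes \<pi>: "bij_betw \<pi> {..<n} {..<n}" and ph: "\<And>b. b < n \<Longrightarrow> cmod (ph b) = 1"
  defines "M \<equiv> mat n n (\<lambda>(a, b). if a = \<pi> b then ph b else 0)"
  shows "M \<in> unitary_group n"
    "\<And>X a b. X \<in> carrier_mat n n \<Longrightarrow> a < n \<Longrightarrow> b < n \<Longrightarrow>
      (mat_adjoint M * X * M) $$ (a, b) = cnj (ph a) * X $$ (\<pi> a, \<pi> b) * ph b"
proof -
  have M: "M \<in> carrier_mat n n" by (simp add: M_def)
  have \<pi>n: "\<pi> a < n" if "a < n" for a using \<pi> that by (auto simp: bij_betw_def)
  show entry: "(mat_adjoint M * X * M) $$ (a, b) = cnj (ph a) * X $$ (\<pi> a, \<pi> b) * ph b"
    if X: "X \<in> carrier_mat n n" and ab: "a < n" "b < n" for X a b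
  proof -
    have "(mat_adjoint M * X * M) $$ (a, b)
        = (\<Sum>c<n. \<Sum>d<n. cnj (M $$ (d, a)) * X $$ (d, c) * M $$ (c, b))"
      by (rule index_congruence[OF M X ab])
    also have "\<dots> = (\<Sum>c<n. \<Sum>d<n. if d = \<pi> a then (if c = \<pi> b then cnj (ph a) * X $$ (\<pi> a, \<pi> b) * ph b else 0) else 0)"
      using ab by (intro sum.cong refl) (auto simp: M_def)
    also have "\<dots> = cnj (ph a) * X $$ (\<pi> a, \<pi> b) * ph b"
      using \<pi>n ab by simp
    finally show ?thesis .
  qed
  show "M \<in> unitary_group n"
  proof (rule unitary_groupI[OF M], rule eq_matI)
    fix a b assume "a < dim_row (1\<^sub>m n :: complex mat)" "b < dim_col (1\<^sub>m n :: complex mat)"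
    then have ab: "a < n" "b < n" by auto
    have "mat_adjoint M * M = mat_adjoint M * 1\<^sub>m n * M"
      using M by (simp add: right_mult_one_mat[OF mat_adjoint_carrier[OF M]])
    then have "(mat_adjoint M * M) $$ (a, b) = cnj (ph a) * 1\<^sub>m n $$ (\<pi> a, \<pi> b) * ph b"
      using entry[OF one_carrier_mat ab] by simp
    also have "\<dots> = 1\<^sub>m n $$ (a, b)"
    proof (cases "a = b")
      case True
      then show ?thesis using ab \<pi>n ph[of a] by (simp add: mult.commute complex_norm_square[symmetric])
    next
      case False
      then have "\<pi> a \<noteq> \<pi> b" using \<pi> ab by (auto simp: bij_betw_def inj_on_def)
      then show ?thesis using False ab \<pi>n by simp
    qed
    finally show "(mat_adjoint M * M) $$ (a, b) = 1\<^sub>m n $$ (a, b)" .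
  qed (use M in auto)
qed

lemma bij_betw_moving_pair:
  assumes "i < n" "j < n" "i \<noteq> (j :: nat)"
  obtains \<pi> where "bij_betw \<pi> {..<n} {..<n}" "\<pi> 0 = i" "\<pi> 1 = j"
proof
  \<comment> \<open>The first transposition may displace \<open>j\<close>, so the other one
    exchanges 1 with \<open>transpose 0 i j\<close>, which is sent back to \<open>j\<close>. Index 0
    is unaffected because \<open>i \<noteq> j\<close>.\<close>
  let ?t = "transpose 0 i" and ?u = "transpose 1 (transpose 0 i j)"
  have n: "1 < n" using assms by linarith
  have k: "?t j < n" using assms by (auto simp: transpose_def)
  have k0: "?t j \<noteq> 0" using assms by (auto simp: transpose_def)
  have "bij_betw ?t {..<n} {..<n}" "bij_betw ?u {..<n} {..<n}"
    using assms n k by (auto intro!: bij_betw_transpose_iff simp: transpose_def)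
  then show "bij_betw (?t \<circ> ?u) {..<n} {..<n}" by (rule bij_betw_trans[rotated])
  show "(?t \<circ> ?u) 0 = i" using k0 by (simp add: transpose_def)
  show "(?t \<circ> ?u) 1 = j" by simp
qed

text \<open>All members are extremal against the same \<open>A\<close>, so a single pair of
  eigenvectors carries the whole family at once. The freedom of phase makes only the coefficient of
  \<open>s0\<close> positive; the others stay complex.\<close>

lemma extremal_normal_form:
  fixes Q :: "'i \<Rightarrow> complex mat"
  assumes n: "n \<ge> 2" and A: "A \<in> carrier_mat n n" "hermitian_mat A" "frobenius_sq A > 0"
    and Q: "\<And>s. s \<in> S \<Longrightarrow> Q s \<in> carrier_mat n n" and h: "\<And>s. s \<in> S \<Longrightarrow> hermitian_mat (Q s)"
    and eq: "\<And>s. s \<in> S \<Longrightarrow> frobenius_sq (mat_commutator A (Q s)) = 2 * frobenius_sq A * frobenius_sq (Q s)"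
    and s0: "s0 \<in> S" "frobenius_sq (Q s0) > 0"
  obtains V l r z where "V \<in> unitary_group n" "l > 0" "r > 0" "z s0 = complex_of_real r"
    "mat_adjoint V * A * V = diag_zero n (H1 l)"
    "\<And>s. s \<in> S \<Longrightarrow> mat_adjoint V * Q s * V = diag_zero n (hollow (z s))"
proof -
  obtain P e where P: "P \<in> unitary_group n" and D: "mat_adjoint P * A * P = real_diag n e"
    using hermitian_diagonalisable[OF A(1,2)] .
  define X where "X s = mat_adjoint P * Q s * P" for s
  have X: "X s \<in> carrier_mat n n" if "s \<in> S" for s
    unfolding X_def by (rule congruence_carrier[OF P Q[OF that]])
  have hX: "hermitian_mat (X s)" if "s \<in> S" for s
    unfolding X_def by (rule hermitian_congruence[OF P Q[OF that] h[OF that]])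
  have fX: "frobenius_sq (X s) = frobenius_sq (Q s)" if "s \<in> S" for s
    unfolding X_def by (rule frobenius_sq_congruence[OF P Q[OF that]])
  have N: "frobenius_sq A = (\<Sum>k<n. (e k)\<^sup>2)"
    using frobenius_sq_congruence[OF P A(1)] by (simp add: D frobenius_sq_real_diag)
  have eqX: "frobenius_sq (mat_commutator (real_diag n e) (X s)) = 2 * frobenius_sq (real_diag n e) * frobenius_sq (X s)"
    if "s \<in> S" for s
    unfolding D[symmetric] X_def congruence_commutator[OF P A(1) Q[OF that]]
    using eq[OF that] A(1) Q[OF that] P by (simp add: frobenius_sq_congruence)
  have gap: "(e a - e b)\<^sup>2 = 2 * (\<Sum>k<n. (e k)\<^sup>2)" if "s \<in> S" "a < n" "b < n" "X s $$ (a, b) \<noteq> 0" for s a b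
    by (rule commutator_norm_eq_diag[OF X[OF that(1)] eqX[OF that(1)] that(2-4)])
  note gapD = gap_squared_eq[OF _ _ gap A(3)[unfolded N]]
  have "X s0 \<noteq> 0\<^sub>m n n"
    using s0 fX[OF s0(1)] frobenius_sq_eq_0_iff[OF X[OF s0(1)]] by simp
  then obtain i' j' where ij': "i' < n" "j' < n" "X s0 $$ (i', j') \<noteq> 0"
    using X[OF s0(1)] by (metis carrier_matD eq_matI index_zero_mat)
  \<comment> \<open>The two eigenvalues in question are nonzero and opposite. Exchanging the indices
    if necessary puts the positive one first, and the mirrored entry is nonzero too.\<close>
  have "\<exists>i j. i < n \<and> j < n \<and> X s0 $$ (i, j) \<noteq> 0 \<and> e i > 0"
  proof (cases "e i' > 0")
    case False
    then have "e j' > 0"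
      using gapD(2,3)[OF ij'(1,2) s0(1) ij'] by auto
    moreover have "X s0 $$ (j', i') \<noteq> 0"
      using hermitian_index[OF hX[OF s0(1)] X[OF s0(1)] ij'(1,2)] ij'(3) by auto
    ultimately show ?thesis using ij' by blast
  qed (use ij' in blast)
  then obtain i j where ij: "i < n" "j < n" "X s0 $$ (i, j) \<noteq> 0" and ei: "e i > 0" by blast
  note ijD = gapD[OF ij(1,2) s0(1) ij]
  \<comment> \<open>A nonzero entry requires two different indices with nonzero eigenvalues, and
    only \<open>i\<close> and \<open>j\<close> have such eigenvalues.\<close>
  have supp: "X s $$ (a, b) = 0" if "s \<in> S" "a < n" "b < n" "\<not> (a = i \<and> b = j)" "\<not> (a = j \<and> b = i)" for s a b
  proof (rule ccontr)
    assume nz: "X s $$ (a, b) \<noteq> 0"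
    note abD = gapD[OF that(2,3) that(1-3) nz]
    have "e a \<noteq> 0" "e b \<noteq> 0" using abD(2,3) by auto
    then have "a \<in> {i, j}" "b \<in> {i, j}" using ijD(4) that by blast+
    then show False using abD(1) that by auto
  qed
  obtain \<pi> where \<pi>: "bij_betw \<pi> {..<n} {..<n}" "\<pi> 0 = i" "\<pi> 1 = j"
    using bij_betw_moving_pair[OF ij(1,2) ijD(1)] .
  have \<pi>n: "\<pi> a < n" if "a < n" for a using \<pi>(1) that by (auto simp: bij_betw_def)
  have \<pi>eq: "\<pi> a = \<pi> b \<longleftrightarrow> a = b" if "a < n" "b < n" for a b
    using \<pi>(1) that by (auto simp: bij_betw_def inj_on_def)
  have \<pi>i: "\<pi> a = i \<longleftrightarrow> a = 0" and \<pi>j: "\<pi> a = j \<longleftrightarrow> a = 1" if "a < n" for a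
    using \<pi>eq[OF that, of 0] \<pi>eq[OF that, of 1] \<pi>(2,3) n by auto
  define w where "w = X s0 $$ (i, j)"
  \<comment> \<open>Multiplication by this phase turns \<open>w\<close> into its modulus;
    \<open>w\<close> is nonzero by the choice of \<open>i\<close> and \<open>j\<close>.\<close>
  define ph where "ph b = (if b = 1 then cnj w / complex_of_real (cmod w) else 1)" for b :: nat
  have ph: "cmod (ph b) = 1" for b using ij(3) by (simp add: ph_def w_def norm_divide)
  define M where "M = mat n n (\<lambda>(a, b). if a = \<pi> b then ph b else 0)"
  note M = monomial_unitary[OF \<pi>(1), of ph, OF ph, folded M_def]
  define V where "V = P * M"
  have V: "V \<in> unitary_group n" unfolding V_def by (rule unitary_group_mult[OF P M(1)])
  have conj: "mat_adjoint V * Y * V = mat_adjoint M * (mat_adjoint P * Y * P) * M"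
    if "Y \<in> carrier_mat n n" for Y
    unfolding V_def
    by (rule mat_adjoint_congruence_mult[OF that unitary_groupD(1)[OF P] unitary_groupD(1)[OF M(1)]])
  define z where "z s = X s $$ (i, j) * ph 1" for s
  have "z s0 = complex_of_real (cmod w)"
  proof -
    have "w * cnj w = complex_of_real ((cmod w)\<^sup>2)" by (simp only: complex_norm_square)
    then show ?thesis using ij(3) by (simp add: z_def ph_def w_def[symmetric] power2_eq_square)
  qed
  moreover have "mat_adjoint V * A * V = diag_zero n (H1 (e i))"
  proof (rule eq_diag_zeroI[OF n mat2_carrier(1) congruence_carrier[OF V A(1)]])
    fix a b assume ab: "a < n" "b < n"
    have "(mat_adjoint V * A * V) $$ (a, b) = cnj (ph a) * real_diag n e $$ (\<pi> a, \<pi> b) * ph b"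
      unfolding conj[OF A(1)] D by (rule M(2)[OF real_diag_carrier ab])
    also have "\<dots> = (if a = b then complex_of_real (e (\<pi> a)) * (cnj (ph a) * ph a) else 0)"
      using ab \<pi>n \<pi>eq[OF ab] by simp
    also have "cnj (ph a) * ph a = 1"
      using ph[of a] by (simp add: mult.commute complex_norm_square[symmetric])
    also have "(if a = b then complex_of_real (e (\<pi> a)) * 1 else 0) = (if a < 2 \<and> b < 2 then H1 (e i) $$ (a, b) else 0)"
    proof (cases "a < 2")
      case True
      then show ?thesis using \<pi> ijD(2) by (auto simp: index_mat2 less_2_cases_iff)
    next
      case False
      then have "e (\<pi> a) = 0" using ijD(4)[OF \<pi>n[OF ab(1)]] \<pi>i[OF ab(1)] \<pi>j[OF ab(1)] by auto
      then show ?thesis using False by auto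
    qed
    finally show "(mat_adjoint V * A * V) $$ (a, b) = (if a < 2 \<and> b < 2 then H1 (e i) $$ (a, b) else 0)" .
  qed
  moreover have "mat_adjoint V * Q s * V = diag_zero n (hollow (z s))" if s: "s \<in> S" for s
  proof (rule eq_diag_zeroI[OF n mat2_carrier(4) congruence_carrier[OF V Q[OF s]]])
    fix a b assume ab: "a < n" "b < n"
    have e: "(mat_adjoint V * Q s * V) $$ (a, b) = cnj (ph a) * X s $$ (\<pi> a, \<pi> b) * ph b"
      unfolding conj[OF Q[OF s]] X_def[symmetric] by (rule M(2)[OF X[OF s] ab])
    consider "a = 0" "b = 1" | "a = 1" "b = 0" | "\<not> (a = 0 \<and> b = 1)" "\<not> (a = 1 \<and> b = 0)" by blast
    then show "(mat_adjoint V * Q s * V) $$ (a, b) = (if a < 2 \<and> b < 2 then hollow (z s) $$ (a, b) else 0)"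
    proof cases
      case 1
      then show ?thesis unfolding e using \<pi> by (simp add: index_mat2 z_def ph_def)
    next
      case 2
      have "X s $$ (j, i) = cnj (X s $$ (i, j))"
        using hermitian_index[OF hX[OF s] X[OF s] ij(1,2)] by simp
      then show ?thesis unfolding e using 2 \<pi> by (simp add: index_mat2 z_def ph_def)
    next
      case 3
      then have "X s $$ (\<pi> a, \<pi> b) = 0"
        using supp[OF s \<pi>n[OF ab(1)] \<pi>n[OF ab(2)]] \<pi>i[OF ab(1)] \<pi>j[OF ab(1)] \<pi>i[OF ab(2)] \<pi>j[OF ab(2)] by auto
      then show ?thesis unfolding e using 3 by (auto simp: index_mat2 less_2_cases_iff)
    qed
  qed
  ultimately show thesis using that[OF V ei, of "cmod w" z] ij(3) by (simp add: w_def)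
qed

lemma congruence_smult:
  assumes "P \<in> carrier_mat n n" "X \<in> carrier_mat n n"
  shows "mat_adjoint P * (c \<cdot>\<^sub>m X) * P = c \<cdot>\<^sub>m (mat_adjoint P * X * P)"
proof -
  note P' = mat_adjoint_carrier[OF assms(1)]
  show ?thesis
    unfolding mult_smult_distrib[OF P' assms(2)]
      mult_smult_assoc_mat[OF mult_carrier_mat[OF P' assms(2)] assms(1)] ..
qed

lemma K_act_flip_sign:
  assumes "P \<in> carrier_mat n n" "\<And>j. j < m \<Longrightarrow> B j \<in> carrier_mat n n" "k < m"
  shows "K_act n m (P, mat m m (\<lambda>(j, k). \<sigma> k * R $$ (j, k))) B k
    = complex_of_real (\<sigma> k) \<cdot>\<^sub>m (mat_adjoint P * mix n m R B k * P)"
  using K_act_mix[of P n m B] assms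
  by (simp add: mix_flip_sign congruence_smult[OF assms(1) mix_carrier])

lemma smult_diag_zero:
  assumes "n \<ge> 2" "H \<in> carrier_mat 2 2"
  shows "c \<cdot>\<^sub>m diag_zero n H = diag_zero n (c \<cdot>\<^sub>m H)"
  by (rule eq_diag_zeroI) (use assms in \<open>auto simp: index_diag_zero carrier_matD[OF diag_zero_carrier]\<close>)

lemma smult_hollow: "complex_of_real r \<cdot>\<^sub>m hollow z = hollow (complex_of_real r * z)"
  by (intro eq_matI) (auto simp: carrier_matD[OF mat2_carrier(4)] index_mat2)

lemma diag_zero_H_0:
  assumes "n \<ge> 2"
  shows "diag_zero n (H1 0) = 0\<^sub>m n n" "diag_zero n (H2 0) = 0\<^sub>m n n" "diag_zero n (H3 0) = 0\<^sub>m n n"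
proof -
  have "frobenius_sq (diag_zero n (H1 0)) = 0" "frobenius_sq (diag_zero n (H2 0)) = 0"
    "frobenius_sq (diag_zero n (H3 0)) = 0"
    using assms by (simp_all add: frobenius_sq_diag_zero frobenius_sq_mat2)
  then show "diag_zero n (H1 0) = 0\<^sub>m n n" "diag_zero n (H2 0) = 0\<^sub>m n n" "diag_zero n (H3 0) = 0\<^sub>m n n"
    using frobenius_sq_eq_0_iff[OF diag_zero_carrier[OF assms mat2_carrier(1)]]
      frobenius_sq_eq_0_iff[OF diag_zero_carrier[OF assms mat2_carrier(2)]]
      frobenius_sq_eq_0_iff[OF diag_zero_carrier[OF assms mat2_carrier(3)]] by blast+
qed

lemma one_unitary_group: "1\<^sub>m n \<in> unitary_group n"
  by (auto simp: unitary_group_def)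

lemma mat_commutator_zero [simp]:
  assumes "X \<in> carrier_mat n n"
  shows "mat_commutator X (0\<^sub>m n n) = 0\<^sub>m n n" "mat_commutator (0\<^sub>m n n) X = 0\<^sub>m n n"
  using assms by (simp_all add: mat_commutator_def)

lemma frobenius_inner_hollow: "frobenius_inner (hollow z) (hollow w) = 2 * Re (z * cnj w)"
  unfolding frobenius_inner_sum[OF mat2_carrier(4,4)]
  by (simp add: sum_lessThan_2 index_mat2)

lemma rotated_H2:
  "complex_of_real (cos t) \<cdot>\<^sub>m H2 l + complex_of_real (sin t) \<cdot>\<^sub>m H3 l
    = hollow (complex_of_real l * cnj (cis t))"
  by (intro eq_matI)
    (auto simp: carrier_matD[OF mat2_carrier(2)] carrier_matD[OF mat2_carrier(3)]
      carrier_matD[OF mat2_carrier(4)] index_mat2 complex_eq_iff)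

lemma frobenius_sq_commutator_diag_zero:
  assumes "n \<ge> 2" "H \<in> carrier_mat 2 2" "H' \<in> carrier_mat 2 2"
  shows "frobenius_sq (mat_commutator (diag_zero n H) (diag_zero n H')) = frobenius_sq (mat_commutator H H')"
  using assms by (simp add: diag_zero_commutator frobenius_sq_diag_zero)

section \<open>Hermitian tuples\<close>

lemma hermitian_case_ge_3:
  fixes n m :: nat and B :: "nat \<Rightarrow> complex mat"
  assumes n: "n \<ge> 2" and m: "m \<ge> 3" and B: "\<And>r. r < m \<Longrightarrow> B r \<in> carrier_mat n n"
    and h: "\<And>r. r < m \<Longrightarrow> hermitian_mat (B r)"
  defines "F \<equiv> (\<Sum>r<m. \<Sum>s<m. frobenius_sq (mat_commutator (B r) (B s)))"
    and "N \<equiv> (\<Sum>r<m. frobenius_sq (B r))"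
  shows "F \<le> 4 / 3 * N\<^sup>2"
    "F = 4 / 3 * N\<^sup>2 \<longleftrightarrow>
       (\<exists>g \<in> K_group n m. \<exists>l\<ge>0. \<exists>a<m. \<exists>b<m. \<exists>c<m. a \<noteq> b \<and> a \<noteq> c \<and> b \<noteq> c \<and>
          K_act n m g B a = diag_zero n (H1 l) \<and>
          K_act n m g B b = diag_zero n (H2 l) \<and>
          K_act n m g B c = diag_zero n (H3 l) \<and>
          (\<forall>k<m. k \<noteq> a \<and> k \<noteq> b \<and> k \<noteq> c \<longrightarrow> K_act n m g B k = 0\<^sub>m n n))"
proof -
  obtain R where R: "R \<in> orthogonal_group m"
    and orth: "pairwise (\<lambda>r s. frobenius_inner (mix n m R B r) (mix n m R B s) = 0) {..<m}"
    by (rule orthogonal_mix_exists[of m B n]) (use B in auto)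
  define C where "C k = mix n m R B k" for k
  have C: "C k \<in> carrier_mat n n" for k by (simp add: C_def)
  have hC: "hermitian_mat (C k)" for k unfolding C_def by (rule hermitian_mix) (use B h in auto)
  have N: "(\<Sum>r<m. frobenius_sq (C r)) = N"
    unfolding N_def C_def by (rule sum_frobenius_sq_mix[OF R]) (rule B)
  have F: "(\<Sum>r<m. \<Sum>s<m. frobenius_sq (mat_commutator (C r) (C s))) = F"
    unfolding F_def C_def by (rule sum_commutators_mix[OF R]) (rule B)
  note bound = orthogonal_tuple_bound[of m C n, OF m C hC orth[folded C_def], unfolded N F]
  show "F \<le> 4 / 3 * N\<^sup>2" by (rule bound(1))
  let ?normal = "\<exists>g \<in> K_group n m. \<exists>l\<ge>0. \<exists>a<m. \<exists>b<m. \<exists>c<m. a \<noteq> b \<and> a \<noteq> c \<and> b \<noteq> c \<and>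
          K_act n m g B a = diag_zero n (H1 l) \<and>
          K_act n m g B b = diag_zero n (H2 l) \<and>
          K_act n m g B c = diag_zero n (H3 l) \<and>
          (\<forall>k<m. k \<noteq> a \<and> k \<noteq> b \<and> k \<noteq> c \<longrightarrow> K_act n m g B k = 0\<^sub>m n n)"
  show "F = 4 / 3 * N\<^sup>2 \<longleftrightarrow> ?normal"
  proof
    assume "F = 4 / 3 * N\<^sup>2"
    then obtain a b c where abc: "a < m" "b < m" "c < m" "a \<noteq> b" "a \<noteq> c" "b \<noteq> c"
      and nrm: "frobenius_sq (C b) = frobenius_sq (C a)" "frobenius_sq (C c) = frobenius_sq (C a)"
      and rest': "\<forall>k<m. k \<noteq> a \<and> k \<noteq> b \<and> k \<noteq> c \<longrightarrow> C k = 0\<^sub>m n n"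
      and comm': "\<forall>r<m. \<forall>s<m. r \<noteq> s \<longrightarrow>
        frobenius_sq (mat_commutator (C r) (C s)) = 2 * frobenius_sq (C r) * frobenius_sq (C s)"
      by (elim bound(2)[THEN exE] exE conjE) (rule that)
    have rest: "C k = 0\<^sub>m n n" if "k < m" "k \<noteq> a" "k \<noteq> b" "k \<noteq> c" for k
      using rest' that by simp
    have comm: "frobenius_sq (mat_commutator (C r) (C s)) = 2 * frobenius_sq (C r) * frobenius_sq (C s)"
      if "r < m" "s < m" "r \<noteq> s" for r s
      using comm' that by simp
    have act: "K_act n m (P, R) B k = mat_adjoint P * C k * P" if "P \<in> unitary_group n" for P k
      unfolding C_def by (rule K_act_mix) (use B unitary_groupD[OF that] in auto)
    show ?normal
    \<comment> \<open>If \<open>C a\<close> vanishes, so does the entire tuple, and the normal form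
      holds with \<open>l = 0\<close>.\<close>
    proof (cases "frobenius_sq (C a) = 0")
      case True
      then have "C k = 0\<^sub>m n n" if "k < m" for k
        using rest[OF that] nrm frobenius_sq_eq_0_iff[OF C] by metis
      then have "K_act n m (1\<^sub>m n, R) B k = 0\<^sub>m n n" if "k < m" for k
        using act[OF one_unitary_group] that by simp
      moreover have "(1\<^sub>m n, R) \<in> K_group n m" using R one_unitary_group by (simp add: K_group_def)
      ultimately show ?thesis
        using abc by (intro bexI[of _ "(1\<^sub>m n, R)"] exI[of _ 0] exI[of _ a] exI[of _ b] exI[of _ c] conjI)
          (simp_all add: diag_zero_H_0[OF n])
    next
      case False
      then have pos: "frobenius_sq (C a) > 0" using frobenius_sq_nonneg[OF C, of a] by simp
      obtain V l r z where V: "V \<in> unitary_group n" and l: "l > 0" and r: "r > 0"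
        and zb: "z b = complex_of_real r"
        and Va: "mat_adjoint V * C a * V = diag_zero n (H1 l)"
        and Vs: "\<And>s. s \<in> {b, c} \<Longrightarrow> mat_adjoint V * C s * V = diag_zero n (hollow (z s))"
      proof (rule extremal_normal_form[OF n C hC pos, of "{b, c}" C b])
        show "frobenius_sq (mat_commutator (C a) (C s)) = 2 * frobenius_sq (C a) * frobenius_sq (C s)"
          if "s \<in> {b, c}" for s using comm[of a s] abc that by auto
      qed (use C hC pos nrm in auto)
      have fa: "frobenius_sq (C a) = 2 * l\<^sup>2"
        using frobenius_sq_congruence[OF V C, of a] n by (simp add: Va frobenius_sq_diag_zero frobenius_sq_mat2)
      have fs: "frobenius_sq (C s) = 2 * (cmod (z s))\<^sup>2" if "s \<in> {b, c}" for s
        using frobenius_sq_congruence[OF V C, of s] n Vs[OF that]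
        by (simp add: frobenius_sq_diag_zero frobenius_sq_mat2)
      have "r\<^sup>2 = l\<^sup>2" using fa fs[of b] nrm by (simp add: zb)
      then have rl: "r = l" using r l by simp
      have "(cmod (z c))\<^sup>2 = l\<^sup>2" using fa fs[of c] nrm by simp
      then have zc: "(Re (z c))\<^sup>2 + (Im (z c))\<^sup>2 = l\<^sup>2" by (simp add: cmod_power2)
      \<comment> \<open>Equal norms have given \<open>z b = l\<close> and modulus \<open>l\<close>
        for \<open>z c\<close>. Orthogonality of \<open>C b\<close> and \<open>C c\<close> makes
        \<open>z c\<close> purely imaginary, so only its sign stays open.\<close>
      have "frobenius_inner (mat_adjoint V * C b * V) (mat_adjoint V * C c * V) = 0"
        using pairwiseD[OF orth, of b c] abc
        by (simp add: frobenius_inner_congruence[OF V C C]) (simp add: C_def)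
      then have "frobenius_inner (hollow (complex_of_real l)) (hollow (z c)) = 0"
        using n by (simp add: Vs frobenius_inner_diag_zero zb rl)
      then have Re0: "Re (z c) = 0" using l by (simp add: frobenius_inner_hollow)
      then have Im: "Im (z c) = l \<or> Im (z c) = - l" using zc power2_eq_iff[of "Im (z c)" l] by simp
      \<comment> \<open>\<open>H3 l\<close> corresponds to the coordinate \<open>- l * \<i>\<close>,
        so the sign is flipped exactly when \<open>z c\<close> is \<open>l * \<i>\<close>.\<close>
      define \<sigma> where "\<sigma> k = (if k = c \<and> Im (z c) = l then -1 else 1 :: real)" for k
      define R' where "R' = mat m m (\<lambda>(j, k). \<sigma> k * R $$ (j, k))"
      have R': "R' \<in> orthogonal_group m"
        unfolding R'_def by (rule flip_sign_orthogonal_group[OF R]) (simp add: \<sigma>_def)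
      have act': "K_act n m (V, R') B k = complex_of_real (\<sigma> k) \<cdot>\<^sub>m (mat_adjoint V * C k * V)" if "k < m" for k
        unfolding R'_def C_def by (rule K_act_flip_sign) (use B unitary_groupD[OF V] that in auto)
      have one: "1 \<cdot>\<^sub>m X = X" for X :: "complex mat" by (intro eq_matI) auto
      have "complex_of_real (\<sigma> c) * z c = - complex_of_real l * \<i>"
        using Re0 Im l by (auto simp: \<sigma>_def complex_eq_iff)
      then have "K_act n m (V, R') B c = diag_zero n (H3 l)"
        using act'[OF abc(3)] Vs[of c] n by (simp add: smult_diag_zero smult_hollow flip: hollow_H3)
      moreover have "K_act n m (V, R') B a = diag_zero n (H1 l)"
        using act'[OF abc(1)] Va abc by (simp add: \<sigma>_def one)
      moreover have "K_act n m (V, R') B b = diag_zero n (H2 l)"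
        using act'[OF abc(2)] Vs[of b] abc by (simp add: \<sigma>_def one zb rl hollow_H2)
      moreover have "K_act n m (V, R') B k = 0\<^sub>m n n" if "k < m" "k \<noteq> a" "k \<noteq> b" "k \<noteq> c" for k
        using act'[OF that(1)] rest[OF that] that unitary_groupD[OF V] by (simp add: \<sigma>_def one)
      moreover have "(V, R') \<in> K_group n m" using R' V by (simp add: K_group_def)
      ultimately show ?thesis
        using abc l by (intro bexI[of _ "(V, R')"] exI[of _ l] exI[of _ a] exI[of _ b] exI[of _ c] conjI) simp_all
    qed
  next
    assume ?normal
    then obtain g l a b c where g: "g \<in> K_group n m" and abc: "a < m" "b < m" "c < m" "a \<noteq> b" "a \<noteq> c" "b \<noteq> c"
      and a: "K_act n m g B a = diag_zero n (H1 l)"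
      and b: "K_act n m g B b = diag_zero n (H2 l)"
      and c: "K_act n m g B c = diag_zero n (H3 l)"
      and rest: "\<And>k. k < m \<Longrightarrow> k \<noteq> a \<Longrightarrow> k \<noteq> b \<Longrightarrow> k \<noteq> c \<Longrightarrow> K_act n m g B k = 0\<^sub>m n n"
      by blast
    define f where "f r s = frobenius_sq (mat_commutator (K_act n m g B r) (K_act n m g B s))" for r s
    have sum3: "(\<Sum>r<m. q r) = q a + q b + q c"
      if "\<And>k. k < m \<Longrightarrow> k \<noteq> a \<Longrightarrow> k \<noteq> b \<Longrightarrow> k \<noteq> c \<Longrightarrow> q k = 0" for q :: "nat \<Rightarrow> real"
    proof -
      have "(\<Sum>r<m. q r) = (\<Sum>r\<in>{a, b, c}. q r)"
        by (rule sum.mono_neutral_right) (use abc that in auto)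
      then show ?thesis using abc by simp
    qed
    have "N = (\<Sum>k<m. frobenius_sq (K_act n m g B k))"
      unfolding N_def by (rule sum_frobenius_sq_K_act[OF g, symmetric]) (rule B)
    also have "\<dots> = 6 * l\<^sup>2"
      by (subst sum3) (use n in \<open>simp_all add: rest a b c frobenius_sq_diag_zero frobenius_sq_mat2\<close>)
    finally have N6: "N = 6 * l\<^sup>2" .
    have self: "f r r = 0" for r
      unfolding f_def mat_commutator_self[of "K_act n m g B r" n, OF K_act_carrier] by simp
    have f0: "f r s = 0" if "r < m" "s < m" "r \<notin> {a, b, c} \<or> s \<notin> {a, b, c} \<or> r = s" for r s
    proof (cases "r = s")
      case False
      then have "K_act n m g B r = 0\<^sub>m n n \<or> K_act n m g B s = 0\<^sub>m n n" using that rest by blast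
      then show ?thesis
        unfolding f_def
        by (elim disjE) (simp_all only: mat_commutator_zero[OF K_act_carrier] frobenius_sq_zero)
    qed (simp add: self)
    have fsym: "f r s = f s r" for r s
      unfolding f_def by (rule frobenius_sq_commutator_commute[OF K_act_carrier K_act_carrier])
    \<comment> \<open>Three pairs in both orders give \<open>48 * l^4\<close>, which is
      \<open>4 / 3\<close> of the square of \<open>6 * l\<^sup>2\<close>.\<close>
    have fab: "f a b = 8 * l^4" "f a c = 8 * l^4" "f b c = 8 * l^4"
      unfolding f_def a b c
      by (simp_all add: frobenius_sq_commutator_diag_zero[OF n] frobenius_sq_commutator_hollow norm_mult
          power2_eq_square power4_eq_xxxx flip: hollow_H2 hollow_H3)
    have "F = (\<Sum>r<m. \<Sum>s<m. f r s)"
      unfolding F_def f_def by (rule sum_commutators_K_act[OF g, symmetric]) (rule B)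
    also have "\<dots> = (\<Sum>s<m. f a s) + (\<Sum>s<m. f b s) + (\<Sum>s<m. f c s)"
      by (rule sum3) (simp add: f0)
    also have "\<dots> = 48 * l^4"
      using abc by (subst (1 2 3) sum3) (simp_all add: f0 fab fsym[of b a] fsym[of c a] fsym[of c b])
    finally show "F = 4 / 3 * N\<^sup>2" by (simp add: N6 power2_eq_square power4_eq_xxxx)
  qed
qed

lemma hermitian_case_2:
  fixes n :: nat and B :: "nat \<Rightarrow> complex mat"
  assumes n: "n \<ge> 2" and B: "\<And>r. r < 2 \<Longrightarrow> B r \<in> carrier_mat n n"
    and h: "\<And>r. r < 2 \<Longrightarrow> hermitian_mat (B r)"
  defines "F \<equiv> (\<Sum>r<2. \<Sum>s<2. frobenius_sq (mat_commutator (B r) (B s)))"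
    and "N \<equiv> (\<Sum>r<2. frobenius_sq (B r))"
  shows "F \<le> N\<^sup>2"
    "F = N\<^sup>2 \<longleftrightarrow>
       (\<exists>g \<in> K_group n 2. \<exists>l\<ge>0. \<exists>\<theta>::real.
          K_act n 2 g B 0 = diag_zero n (H1 l) \<and>
          K_act n 2 g B 1 = diag_zero n
            (complex_of_real (cos \<theta>) \<cdot>\<^sub>m H2 l + complex_of_real (sin \<theta>) \<cdot>\<^sub>m H3 l))"
proof -
  \<comment> \<open>Nothing has to be orthogonalised, so the identity serves as \<open>R\<close>.
    Passing through \<open>mix\<close> makes \<open>C k\<close> a Hermitian matrix of size
    \<open>n\<close> at every index, also from 2 on.\<close>
  define R :: "real mat" where "R = 1\<^sub>m 2"
  have R: "R \<in> orthogonal_group 2" by (simp add: R_def orthogonal_group_def)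
  define C where "C k = mix n 2 R B k" for k
  have C: "C k \<in> carrier_mat n n" for k by (simp add: C_def)
  have hC: "hermitian_mat (C k)" for k unfolding C_def by (rule hermitian_mix) (use B h in auto)
  have F2: "(\<Sum>r<2. \<Sum>s<2. frobenius_sq (mat_commutator (D r) (D s))) = 2 * frobenius_sq (mat_commutator (D 0) (D 1))"
    if "\<And>k. D k \<in> carrier_mat n n" for D :: "nat \<Rightarrow> complex mat"
    using frobenius_sq_commutator_commute[OF that that, of 1 0]
    by (simp add: sum_lessThan_2 mat_commutator_self[OF that])
  have N: "frobenius_sq (C 0) + frobenius_sq (C 1) = N"
  proof -
    have "frobenius_sq (C 0) + frobenius_sq (C 1) = (\<Sum>r<2. frobenius_sq (C r))"
      by (simp add: sum_lessThan_2)
    also have "\<dots> = N" unfolding N_def C_def by (rule sum_frobenius_sq_mix[OF R]) (rule B)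
    finally show ?thesis .
  qed
  have F: "2 * frobenius_sq (mat_commutator (C 0) (C 1)) = F"
  proof -
    have "2 * frobenius_sq (mat_commutator (C 0) (C 1)) = (\<Sum>r<2. \<Sum>s<2. frobenius_sq (mat_commutator (C r) (C s)))"
      by (rule F2[of C, symmetric]) (rule C)
    also have "\<dots> = F" unfolding F_def C_def by (rule sum_commutators_mix[OF R]) (rule B)
    finally show ?thesis .
  qed
  note bound = pair_bound[OF C hC C, of 0 1, unfolded N F]
  show "F \<le> N\<^sup>2" by (rule bound(1))
  let ?normal = "\<exists>g \<in> K_group n 2. \<exists>l\<ge>0. \<exists>\<theta>::real.
          K_act n 2 g B 0 = diag_zero n (H1 l) \<and>
          K_act n 2 g B 1 = diag_zero n
            (complex_of_real (cos \<theta>) \<cdot>\<^sub>m H2 l + complex_of_real (sin \<theta>) \<cdot>\<^sub>m H3 l)"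
  show "F = N\<^sup>2 \<longleftrightarrow> ?normal"
  proof
    assume "F = N\<^sup>2"
    then have nrm: "frobenius_sq (C 1) = frobenius_sq (C 0)"
      and comm: "frobenius_sq (mat_commutator (C 0) (C 1)) = 2 * frobenius_sq (C 0) * frobenius_sq (C 1)"
      using bound(2) by blast+
    have act: "K_act n 2 (P, R) B k = mat_adjoint P * C k * P" if "P \<in> unitary_group n" for P k
      unfolding C_def by (rule K_act_mix) (use B unitary_groupD[OF that] in auto)
    show ?normal
    proof (cases "frobenius_sq (C 0) = 0")
      case True
      then have "C 0 = 0\<^sub>m n n" "C 1 = 0\<^sub>m n n" using nrm frobenius_sq_eq_0_iff[OF C] by metis+
      then have "K_act n 2 (1\<^sub>m n, R) B 0 = 0\<^sub>m n n" "K_act n 2 (1\<^sub>m n, R) B 1 = 0\<^sub>m n n"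
        using act[OF one_unitary_group] by simp_all
      moreover have "(1\<^sub>m n, R) \<in> K_group n 2" using R one_unitary_group by (simp add: K_group_def)
      moreover have "hollow 0 = H2 0" using hollow_H2[of 0] by simp
      ultimately show ?thesis
        by (intro bexI[of _ "(1\<^sub>m n, R)"] exI[of _ 0] conjI)
          (simp_all only: diag_zero_H_0[OF n] rotated_H2 of_real_0 mult_zero_left order.refl)
    next
      case False
      then have pos: "frobenius_sq (C 0) > 0" using frobenius_sq_nonneg[OF C, of 0] by simp
      obtain V l r z where V: "V \<in> unitary_group n" and l: "l > 0" and r: "r > 0"
        and z: "z 1 = complex_of_real r"
        and V0: "mat_adjoint V * C 0 * V = diag_zero n (H1 l)"
        and Vs: "\<And>s. s \<in> {1} \<Longrightarrow> mat_adjoint V * C s * V = diag_zero n (hollow (z s))"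
        by (rule extremal_normal_form[OF n C hC pos, of "{1}" C 1]) (use C hC pos nrm comm in auto)
      have V1: "mat_adjoint V * C 1 * V = diag_zero n (hollow (complex_of_real r))" using Vs[of 1] z by simp
      have "frobenius_sq (C 0) = 2 * l\<^sup>2"
        using frobenius_sq_congruence[OF V C, of 0] n by (simp add: V0 frobenius_sq_diag_zero frobenius_sq_mat2)
      moreover have "frobenius_sq (C 1) = 2 * r\<^sup>2"
        using frobenius_sq_congruence[OF V C, of 1] n unfolding V1
        by (simp add: frobenius_sq_diag_zero frobenius_sq_mat2)
      ultimately have rl: "r = l" using r l nrm by simp
      \<comment> \<open>The phase contained in \<open>V\<close> absorbs the angle, so
        \<open>\<theta> = 0\<close> can be chosen. In the converse every angle works because
        \<open>cis t\<close> has modulus 1.\<close>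
      have "K_act n 2 (V, R) B 1 = diag_zero n
            (complex_of_real (cos 0) \<cdot>\<^sub>m H2 l + complex_of_real (sin 0) \<cdot>\<^sub>m H3 l)"
        unfolding act[OF V] V1 rl rotated_H2 by simp
      moreover have "K_act n 2 (V, R) B 0 = diag_zero n (H1 l)" unfolding act[OF V] V0 ..
      moreover have "(V, R) \<in> K_group n 2" using R V by (simp add: K_group_def)
      ultimately show ?thesis using l less_imp_le by blast
    qed
  next
    assume ?normal
    then obtain g l t where g: "g \<in> K_group n 2"
      and K0: "K_act n 2 g B 0 = diag_zero n (H1 l)"
      and K1: "K_act n 2 g B 1 = diag_zero n (hollow (complex_of_real l * cnj (cis t)))"
      unfolding rotated_H2 by blast
    have "N = (\<Sum>k<2. frobenius_sq (K_act n 2 g B k))"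
      unfolding N_def by (rule sum_frobenius_sq_K_act[OF g, symmetric]) (rule B)
    also have "\<dots> = 4 * l\<^sup>2"
      unfolding sum_lessThan_2 K0 K1
      using n by (simp add: frobenius_sq_diag_zero frobenius_sq_mat2 norm_mult)
    finally have N4: "N = 4 * l\<^sup>2" .
    have "F = (\<Sum>r<2. \<Sum>s<2. frobenius_sq (mat_commutator (K_act n 2 g B r) (K_act n 2 g B s)))"
      unfolding F_def by (rule sum_commutators_K_act[OF g, symmetric]) (rule B)
    also have "\<dots> = 16 * l^4"
      unfolding F2[OF K_act_carrier] K0 K1
      by (simp add: frobenius_sq_commutator_diag_zero[OF n] frobenius_sq_commutator_hollow norm_mult
          power2_eq_square power4_eq_xxxx)
    finally show "F = N\<^sup>2" by (simp add: N4 power2_eq_square power4_eq_xxxx)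
  qed
qed

section \<open>Reduction of skew-Hermitian tuples to Hermitian ones\<close>

lemma frobenius_sq_smult_unit:
  assumes "X \<in> carrier_mat n n" "cmod c = 1"
  shows "frobenius_sq (c \<cdot>\<^sub>m X) = frobenius_sq X"
proof -
  have "c \<cdot>\<^sub>m X \<in> carrier_mat n n" using assms(1) by simp
  then show ?thesis
    unfolding frobenius_sq_sum[OF assms(1)] frobenius_sq_sum[OF \<open>c \<cdot>\<^sub>m X \<in> carrier_mat n n\<close>]
    using assms by (auto simp: norm_mult intro!: sum.cong)
qed

lemma mat_commutator_smult:
  assumes "X \<in> carrier_mat n n" "Y \<in> carrier_mat n n"
  shows "mat_commutator (c \<cdot>\<^sub>m X) (d \<cdot>\<^sub>m Y) = (c * d) \<cdot>\<^sub>m mat_commutator X Y"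
proof (rule eq_matI)
  note cX = smult_carrier_mat[OF assms(1), of c] and dY = smult_carrier_mat[OF assms(2), of d]
  fix i j assume "i < dim_row ((c * d) \<cdot>\<^sub>m mat_commutator X Y)" "j < dim_col ((c * d) \<cdot>\<^sub>m mat_commutator X Y)"
  then have ij: "i < n" "j < n" using carrier_matD[OF mat_commutator_carrier[OF assms]] by auto
  have "mat_commutator (c \<cdot>\<^sub>m X) (d \<cdot>\<^sub>m Y) $$ (i, j) = c * d * mat_commutator X Y $$ (i, j)"
    unfolding index_commutator[OF cX dY ij] index_commutator[OF assms ij]
    using assms ij by (auto simp: sum_distrib_left algebra_simps intro!: sum.cong)
  then show "mat_commutator (c \<cdot>\<^sub>m X) (d \<cdot>\<^sub>m Y) $$ (i, j) = ((c * d) \<cdot>\<^sub>m mat_commutator X Y) $$ (i, j)"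
    using ij carrier_matD[OF mat_commutator_carrier[OF assms]] by simp
qed (use carrier_matD[OF mat_commutator_carrier[OF smult_carrier_mat[OF assms(1), of c] smult_carrier_mat[OF assms(2), of d]]]
    carrier_matD[OF mat_commutator_carrier[OF assms]] in auto)

text \<open>Unitary conjugation and real combinations are both complex linear, so a complex scalar
  passes through the action.\<close>

lemma K_act_smult:
  assumes "g \<in> K_group n m" "\<And>j. j < m \<Longrightarrow> B j \<in> carrier_mat n n"
  shows "K_act n m g (\<lambda>j. c \<cdot>\<^sub>m B j) k = c \<cdot>\<^sub>m K_act n m g B k"
proof -
  obtain P R where g: "g = (P, R)" "P \<in> unitary_group n" using K_group_cases[OF assms(1)] .
  note P = unitary_groupD(1)[OF g(2)]
  have mix: "mix n m R (\<lambda>j. c \<cdot>\<^sub>m B j) k = c \<cdot>\<^sub>m mix n m R B k"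
    using assms(2) by (intro eq_matI)
      (auto simp: mix_def sum_distrib_left carrier_matD[OF assms(2)] mult.left_commute intro!: sum.cong)
  have "K_act n m (P, R) (\<lambda>j. c \<cdot>\<^sub>m B j) k = mat_adjoint P * mix n m R (\<lambda>j. c \<cdot>\<^sub>m B j) k * P"
    by (rule K_act_mix[OF P]) (use assms(2) in auto)
  also have "\<dots> = c \<cdot>\<^sub>m (mat_adjoint P * mix n m R B k * P)"
    unfolding mix by (rule congruence_smult[OF P mix_carrier])
  also have "mat_adjoint P * mix n m R B k * P = K_act n m (P, R) B k"
    by (rule K_act_mix[OF P, symmetric]) (use assms(2) in auto)
  finally show ?thesis by (simp only: g)
qed

lemma smult_i_eq_iff:
  fixes X Y :: "complex mat"
  shows "- \<i> \<cdot>\<^sub>m X = Y \<longleftrightarrow> X = \<i> \<cdot>\<^sub>m Y"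
proof -
  have "\<i> \<cdot>\<^sub>m (- \<i> \<cdot>\<^sub>m X) = X" "- \<i> \<cdot>\<^sub>m (\<i> \<cdot>\<^sub>m Y) = Y"
    by (intro eq_matI, auto)+
  then show ?thesis by metis
qed

lemma hermitian_smult_skew:
  assumes "X \<in> carrier_mat n n" "skew_hermitian_mat X"
  shows "hermitian_mat (- \<i> \<cdot>\<^sub>m X)"
  unfolding hermitian_mat_def
proof (rule eq_matI)
  fix i j assume "i < dim_row (- \<i> \<cdot>\<^sub>m X)" "j < dim_col (- \<i> \<cdot>\<^sub>m X)"
  then have ij: "i < n" "j < n" using assms(1) by auto
  have "cnj (X $$ (j, i)) = mat_adjoint X $$ (i, j)" using assms(1) ij by simp
  also have "\<dots> = - X $$ (i, j)"
    using assms ij unfolding skew_hermitian_mat_def by (simp only: index_uminus_mat carrier_matD)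
  finally show "mat_adjoint (- \<i> \<cdot>\<^sub>m X) $$ (i, j) = (- \<i> \<cdot>\<^sub>m X) $$ (i, j)"
    using assms(1) ij by simp
qed (use assms in auto)

theorem theorem1p1:
  fixes n m :: nat and B :: "nat \<Rightarrow> complex mat"
  assumes "n \<ge> 2" and "m \<ge> 2" and "\<And>r. r < m \<Longrightarrow> B r \<in> carrier_mat n n"
  shows "((\<forall>r<m. hermitian_mat (B r)) \<longrightarrow> m \<ge> 3 \<longrightarrow>
      (\<Sum>r<m. \<Sum>s<m. frobenius_sq (mat_commutator (B r) (B s)))
        \<le> 4 / 3 * (\<Sum>r<m. frobenius_sq (B r))\<^sup>2 \<and>
      ((\<Sum>r<m. \<Sum>s<m. frobenius_sq (mat_commutator (B r) (B s)))
        = 4 / 3 * (\<Sum>r<m. frobenius_sq (B r))\<^sup>2 \<longleftrightarrow>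
       (\<exists>g \<in> K_group n m. \<exists>l\<ge>0. \<exists>a<m. \<exists>b<m. \<exists>c<m. a \<noteq> b \<and> a \<noteq> c \<and> b \<noteq> c \<and>
          K_act n m g B a = diag_zero n (H1 l) \<and>
          K_act n m g B b = diag_zero n (H2 l) \<and>
          K_act n m g B c = diag_zero n (H3 l) \<and>
          (\<forall>k<m. k \<noteq> a \<and> k \<noteq> b \<and> k \<noteq> c \<longrightarrow> K_act n m g B k = 0\<^sub>m n n)))) \<and>
     ((\<forall>r<m. hermitian_mat (B r)) \<longrightarrow> m = 2 \<longrightarrow>
      (\<Sum>r<2. \<Sum>s<2. frobenius_sq (mat_commutator (B r) (B s)))
        \<le> (\<Sum>r<2. frobenius_sq (B r))\<^sup>2 \<and>
      ((\<Sum>r<2. \<Sum>s<2. frobenius_sq (mat_commutator (B r) (B s)))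
        = (\<Sum>r<2. frobenius_sq (B r))\<^sup>2 \<longleftrightarrow>
       (\<exists>g \<in> K_group n 2. \<exists>l\<ge>0. \<exists>\<theta>::real.
          K_act n 2 g B 0 = diag_zero n (H1 l) \<and>
          K_act n 2 g B 1 = diag_zero n
            (complex_of_real (cos \<theta>) \<cdot>\<^sub>m H2 l + complex_of_real (sin \<theta>) \<cdot>\<^sub>m H3 l)))) \<and>
     ((\<forall>r<m. skew_hermitian_mat (B r)) \<longrightarrow> m \<ge> 3 \<longrightarrow>
      (\<Sum>r<m. \<Sum>s<m. frobenius_sq (mat_commutator (B r) (B s)))
        \<le> 4 / 3 * (\<Sum>r<m. frobenius_sq (B r))\<^sup>2 \<and>
      ((\<Sum>r<m. \<Sum>s<m. frobenius_sq (mat_commutator (B r) (B s)))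
        = 4 / 3 * (\<Sum>r<m. frobenius_sq (B r))\<^sup>2 \<longleftrightarrow>
       (\<exists>g \<in> K_group n m. \<exists>l\<ge>0. \<exists>a<m. \<exists>b<m. \<exists>c<m. a \<noteq> b \<and> a \<noteq> c \<and> b \<noteq> c \<and>
          K_act n m g B a = diag_zero n (\<i> \<cdot>\<^sub>m H1 l) \<and>
          K_act n m g B b = diag_zero n (\<i> \<cdot>\<^sub>m H2 l) \<and>
          K_act n m g B c = diag_zero n (\<i> \<cdot>\<^sub>m H3 l) \<and>
          (\<forall>k<m. k \<noteq> a \<and> k \<noteq> b \<and> k \<noteq> c \<longrightarrow> K_act n m g B k = 0\<^sub>m n n)))) \<and>
     ((\<forall>r<m. skew_hermitian_mat (B r)) \<longrightarrow> m = 2 \<longrightarrow>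
      (\<Sum>r<2. \<Sum>s<2. frobenius_sq (mat_commutator (B r) (B s)))
        \<le> (\<Sum>r<2. frobenius_sq (B r))\<^sup>2 \<and>
      ((\<Sum>r<2. \<Sum>s<2. frobenius_sq (mat_commutator (B r) (B s)))
        = (\<Sum>r<2. frobenius_sq (B r))\<^sup>2 \<longleftrightarrow>
       (\<exists>g \<in> K_group n 2. \<exists>l\<ge>0. \<exists>\<theta>::real.
          K_act n 2 g B 0 = diag_zero n (\<i> \<cdot>\<^sub>m H1 l) \<and>
          K_act n 2 g B 1 = diag_zero n
            (complex_of_real (cos \<theta>) \<cdot>\<^sub>m (\<i> \<cdot>\<^sub>m H2 l) + complex_of_real (sin \<theta>) \<cdot>\<^sub>m (\<i> \<cdot>\<^sub>m H3 l)))))"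
proof -
  have B: "B r \<in> carrier_mat n n" if "r < m" for r using assms(3)[OF that] .
  \<comment> \<open>The factor \<open>- \<i>\<close> turns skew-Hermitian matrices into Hermitian
    ones. It keeps all Frobenius norms, multiplies commutators by \<open>-1\<close> and commutes
    with the action, so the normal forms are merely multiplied by \<open>\<i>\<close>.\<close>
  define C where "C r = - \<i> \<cdot>\<^sub>m B r" for r
  have C: "C r \<in> carrier_mat n n" if "r < m" for r using B[OF that] by (simp add: C_def)
  have hC: "hermitian_mat (C r)" if "\<forall>r<m. skew_hermitian_mat (B r)" "r < m" for r
    using that hermitian_smult_skew[OF B] by (simp add: C_def)
  have N: "(\<Sum>r<m. frobenius_sq (C r)) = (\<Sum>r<m. frobenius_sq (B r))"
    by (intro sum.cong refl) (simp add: C_def frobenius_sq_smult_unit[OF B])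
  have F: "(\<Sum>r<m. \<Sum>s<m. frobenius_sq (mat_commutator (C r) (C s)))
      = (\<Sum>r<m. \<Sum>s<m. frobenius_sq (mat_commutator (B r) (B s)))"
    by (intro sum.cong refl)
      (simp add: C_def mat_commutator_smult[OF B B] frobenius_sq_smult_unit[OF mat_commutator_carrier[OF B B]])
  have K: "K_act n m g C k = X \<longleftrightarrow> K_act n m g B k = \<i> \<cdot>\<^sub>m X" if "g \<in> K_group n m" for g k X
  proof -
    have "K_act n m g C k = - \<i> \<cdot>\<^sub>m K_act n m g B k"
      unfolding C_def by (rule K_act_smult[OF that]) (rule B)
    then show ?thesis by (simp only: smult_i_eq_iff)
  qed
  have diag: "\<i> \<cdot>\<^sub>m diag_zero n H = diag_zero n (\<i> \<cdot>\<^sub>m H)" if "H \<in> carrier_mat 2 2" for H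
    by (rule smult_diag_zero[OF assms(1) that])
  have zero: "\<i> \<cdot>\<^sub>m 0\<^sub>m n n = 0\<^sub>m n n" by (intro eq_matI) auto
  have rot: "\<i> \<cdot>\<^sub>m (complex_of_real x \<cdot>\<^sub>m H2 l + complex_of_real y \<cdot>\<^sub>m H3 l)
      = complex_of_real x \<cdot>\<^sub>m (\<i> \<cdot>\<^sub>m H2 l) + complex_of_real y \<cdot>\<^sub>m (\<i> \<cdot>\<^sub>m H3 l)" for x y l
    by (intro eq_matI)
      (auto simp: carrier_matD[OF mat2_carrier(2)] carrier_matD[OF mat2_carrier(3)] algebra_simps)
  have rotc: "complex_of_real x \<cdot>\<^sub>m H2 l + complex_of_real y \<cdot>\<^sub>m H3 l \<in> carrier_mat 2 2" for x y l
    using mat2_carrier by simp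
  show ?thesis
  proof (intro conjI impI)
    assume h: "\<forall>r<m. hermitian_mat (B r)" and m: "m \<ge> 3"
    show "(\<Sum>r<m. \<Sum>s<m. frobenius_sq (mat_commutator (B r) (B s)))
        \<le> 4 / 3 * (\<Sum>r<m. frobenius_sq (B r))\<^sup>2"
      by (rule hermitian_case_ge_3(1)[OF assms(1) m B]) (use h in auto)
    show "(\<Sum>r<m. \<Sum>s<m. frobenius_sq (mat_commutator (B r) (B s)))
        = 4 / 3 * (\<Sum>r<m. frobenius_sq (B r))\<^sup>2 \<longleftrightarrow>
       (\<exists>g \<in> K_group n m. \<exists>l\<ge>0. \<exists>a<m. \<exists>b<m. \<exists>c<m. a \<noteq> b \<and> a \<noteq> c \<and> b \<noteq> c \<and>
          K_act n m g B a = diag_zero n (H1 l) \<and>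
          K_act n m g B b = diag_zero n (H2 l) \<and>
          K_act n m g B c = diag_zero n (H3 l) \<and>
          (\<forall>k<m. k \<noteq> a \<and> k \<noteq> b \<and> k \<noteq> c \<longrightarrow> K_act n m g B k = 0\<^sub>m n n))"
      by (rule hermitian_case_ge_3(2)[OF assms(1) m B]) (use h in auto)
  next
    assume h: "\<forall>r<m. hermitian_mat (B r)" and m: "m = 2"
    show "(\<Sum>r<2. \<Sum>s<2. frobenius_sq (mat_commutator (B r) (B s)))
        \<le> (\<Sum>r<2. frobenius_sq (B r))\<^sup>2"
      by (rule hermitian_case_2(1)[OF assms(1) B]) (use h m in auto)
    show "(\<Sum>r<2. \<Sum>s<2. frobenius_sq (mat_commutator (B r) (B s)))
        = (\<Sum>r<2. frobenius_sq (B r))\<^sup>2 \<longleftrightarrow>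
       (\<exists>g \<in> K_group n 2. \<exists>l\<ge>0. \<exists>\<theta>::real.
          K_act n 2 g B 0 = diag_zero n (H1 l) \<and>
          K_act n 2 g B 1 = diag_zero n
            (complex_of_real (cos \<theta>) \<cdot>\<^sub>m H2 l + complex_of_real (sin \<theta>) \<cdot>\<^sub>m H3 l))"
      by (rule hermitian_case_2(2)[OF assms(1) B]) (use h m in auto)
  next
    assume h: "\<forall>r<m. skew_hermitian_mat (B r)" and m: "m \<ge> 3"
    show "(\<Sum>r<m. \<Sum>s<m. frobenius_sq (mat_commutator (B r) (B s)))
        \<le> 4 / 3 * (\<Sum>r<m. frobenius_sq (B r))\<^sup>2"
      unfolding F[symmetric] N[symmetric]
      by (rule hermitian_case_ge_3(1)[OF assms(1) m]) (use C hC[OF h] in auto)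
    show "(\<Sum>r<m. \<Sum>s<m. frobenius_sq (mat_commutator (B r) (B s)))
        = 4 / 3 * (\<Sum>r<m. frobenius_sq (B r))\<^sup>2 \<longleftrightarrow>
       (\<exists>g \<in> K_group n m. \<exists>l\<ge>0. \<exists>a<m. \<exists>b<m. \<exists>c<m. a \<noteq> b \<and> a \<noteq> c \<and> b \<noteq> c \<and>
          K_act n m g B a = diag_zero n (\<i> \<cdot>\<^sub>m H1 l) \<and>
          K_act n m g B b = diag_zero n (\<i> \<cdot>\<^sub>m H2 l) \<and>
          K_act n m g B c = diag_zero n (\<i> \<cdot>\<^sub>m H3 l) \<and>
          (\<forall>k<m. k \<noteq> a \<and> k \<noteq> b \<and> k \<noteq> c \<longrightarrow> K_act n m g B k = 0\<^sub>m n n))"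
      unfolding F[symmetric] N[symmetric]
      by (subst hermitian_case_ge_3(2)[of n m C, OF assms(1) m])
        (use C hC[OF h] in \<open>simp_all add: K diag zero cong: bex_cong\<close>)
  next
    assume h: "\<forall>r<m. skew_hermitian_mat (B r)" and m: "m = 2"
    show "(\<Sum>r<2. \<Sum>s<2. frobenius_sq (mat_commutator (B r) (B s)))
        \<le> (\<Sum>r<2. frobenius_sq (B r))\<^sup>2"
      unfolding F[unfolded m, symmetric] N[unfolded m, symmetric]
      by (rule hermitian_case_2(1)[OF assms(1)]) (use C hC[OF h] m in auto)
    show "(\<Sum>r<2. \<Sum>s<2. frobenius_sq (mat_commutator (B r) (B s)))
        = (\<Sum>r<2. frobenius_sq (B r))\<^sup>2 \<longleftrightarrow>
       (\<exists>g \<in> K_group n 2. \<exists>l\<ge>0. \<exists>\<theta>::real.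
          K_act n 2 g B 0 = diag_zero n (\<i> \<cdot>\<^sub>m H1 l) \<and>
          K_act n 2 g B 1 = diag_zero n
            (complex_of_real (cos \<theta>) \<cdot>\<^sub>m (\<i> \<cdot>\<^sub>m H2 l) + complex_of_real (sin \<theta>) \<cdot>\<^sub>m (\<i> \<cdot>\<^sub>m H3 l)))"
      unfolding F[unfolded m, symmetric] N[unfolded m, symmetric]
      by (subst hermitian_case_2(2)[of n C, OF assms(1)])
        (use C hC[OF h] m in \<open>simp_all add: K[unfolded m] diag rotc rot cong: bex_cong\<close>)
  qed
qed

end
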